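(* Let $T_L\curvearrowright\mathbb{C}^n$ be a quasi-symmetric representation with associated set of rays $A\subset N$ and polytope $\Delta$. Then the log-discriminant locus in $L^\vee\otimes\mathbb{C}$ associated to this representation is an (affine) hyperplane arrangement, i.e. a union of complex affine hyperplanes of $L^\vee\otimes\mathbb{C}$. Moreover, its hyperplanes are those making up the log-$(A\cap\Gamma)$-discriminants of the faces $\Gamma\subset\Delta$ which are circuits; that is, the log-discriminant locus is the union, over all faces $\Gamma\subset\Delta$ that are circuits, of the log-$(A\cap\Gamma)$-discriminants.
   Context: Setting. $T_L=L\otimes\mathbb{C}^*$ is a connected complex torus with cocharacter lattice $L$ of rank $k$, acting linearly on $\mathbb{C}^n$ with weights $\beta_1,\dots,\beta_n\in L^\vee=\mathrm{Hom}(L,\mathbb{Z})$ (listed with multiplicity). The representation is quasi-symmetric if for every line $\ell\subset L^\vee_{\mathbb{R}}$ through the origin the sum of the weights $\beta_i$ lying on $\ell$ is zero. It is Calabi--Yau if $\sum_i\beta_i=0$; quasi-symmetric representations are Calabi--Yau. Standing assumptions and toric data. The map $Q:(\mathbb{Z}^n)^\vee\to L^\vee$, $e_i^\vee\mapsto\beta_i$, is assumed surjective. Put $M=\ker Q$, $N=M^\vee$. Dualising gives an exact sequence $0\to L\xrightarrow{Q^\vee}\mathbb{Z}^n\xrightarrow{A}N\to 0$. The vectors $\omega_i:=A(e_i)\in N$ are called the rays; they are assumed pairwise distinct, and $A$ also denotes the set $\{\omega_1,\dots,\omega_n\}\subset N$. Since the representation is Calabi--Yau, there is $m\in M$ with $\langle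 m,\omega_i\rangle=1$ for all $i$. Let $\sigma\subset N_{\mathbb{R}}$ be the cone generated by the rays, $H=\{\langle m,-\rangle=1\}$, and $\Delta=\sigma\cap H$, a polytope equal to the convex hull of $A$. Faces of $\Delta$ are nonempty and include $\Delta$ itself. Circuits. A collection of rays forms a circuit if there is precisely one linear relation between them (up to scaling). A face $\Gamma\subset\Delta$ is called a circuit if the collection of all rays lying in $\Gamma$ forms a circuit. Discriminants. Let $T_M=M\otimes\mathbb{C}^*$, so that elements $\omega\in N$ are characters $x^\omega$ of $T_M$. For a subset $B\subset A$ of the form $B=A\cap\Gamma$, let $\mathbb{C}^B=\{f=\sum_{\omega\in B}a_\omega x^\omega\}$, and let $\nabla_B\subset\mathbb{C}^B$ be the Zariski closure of the set of $f\in\mathbb{C}^B$ having a critical point in $T_M$. If $\nabla_B$ is a hypersurface, $\Delta_B\in\mathbb{C}[a_\omega:\omega\in B]$ denotes its defining equation; otherwise $\Delta_B:=1$. Via the projection $\mathbb{C}^A\to\mathbb{C}^{B}$, $\Delta_B$ is regarded as a function on $\mathbb{C}^A\cong\mathbb{C}^n$. The principal $A$-determinant is (up to sign) $E_A=\prod_{\Gamma\subset\Delta}\Delta_{A\cap\Gamma}^{m(\Gamma)}$, the product over all faces $\Gamma$ of $\Delta$, where $m(\Gamma)$ is the Gelfand--Kapranov--Zelevinsky multiplicity $m(\Gamma)=[N\cap\mathrm{Span}_{\mathbb{R}}(\Gamma):\mathbb{Z}(A\cap\Gamma)]\cdot u(\Gamma)$. Here $u(\Delta)=1$, and for $\Gamma\neq\Delta$,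 $u(\Gamma)$ is the normalized lattice volume, with respect to $N/(N\cap\mathrm{Span}_{\mathbb{R}}(\Gamma))$, of the closure of $K\setminus K_+$, where $S_\Gamma$ is the image in this quotient of the semigroup generated by $A$ and $0$, $K$ is the convex hull of $S_\Gamma$, and $K_+$ is the convex hull of $S_\Gamma\setminus\{0\}$. The zero loci of $E_A$ and of the $\Delta_{A\cap\Gamma}$ in $(\mathbb{C}^* )^n$ are invariant under the subtorus $T_M\subset(\mathbb{Z}^n)^\vee\otimes\mathbb{C}^*=(\mathbb{C}^* )^n$, so they descend to subsets $\{E_A=0\}$ and $\{\Delta_{A\cap\Gamma}=0\}$ of the quotient torus $T_{L^\vee}=L^\vee\otimes\mathbb{C}^*=\mathrm{Hom}(L,\mathbb{C}^* )$. The discriminant locus is $\{E_A=0\}\subset T_{L^\vee}$. Log versions. Let $\pi:L^\vee\otimes\mathbb{C}\to T_{L^\vee}$ be the universal cover $y\mapsto(l\mapsto e^{2\pi i\langle l,y\rangle})$. The log-discriminant locus is $\pi^{-1}(\{E_A=0\})$, and the log-$(A\cap\Gamma)$-discriminant is $\pi^{-1}(\{\Delta_{A\cap\Gamma}=0\})$. *)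

theory Defs
  imports "HOL-Analysis.Analysis" "HOL-Library.Poly_Mapping"
begin

text \<open>
  Conventions. The cocharacter lattice \<open>L\<close> is an arbitrary free abelian group of finite rank, given
  as a type \<open>'l\<close>. For an abelian group \<open>G\<close>, the group \<open>L\<^sup>\<or> \<otimes> G\<close> is identified with \<open>Hom(L, G)\<close>; thus
  \<open>L\<^sup>\<or>\<close>, \<open>L\<^sup>\<or> \<otimes> \<real>\<close> and \<open>L\<^sup>\<or> \<otimes> \<complex>\<close> are the sets of additive functions from \<open>'l\<close> to the integers, the reals
  and the complex numbers. The finite type \<open>'n\<close> indexes the weights and the coordinates of the
  representation. The lattice \<open>N\<close> is identified with \<open>\<int>\<^sup>d\<close>, \<open>d = CARD('d)\<close>, by the choice of a basis; then
  \<open>N \<otimes> \<real>\<close> is \<open>real ^ 'd\<close>, and \<open>T\<^sub>M = Hom(N, \<complex>\<^sup>*)\<close> is the set of points of \<open>complex ^ 'd\<close> with nonzero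
  coordinates.
\<close>

subsection \<open>The representation\<close>

definition lattice_of_rank :: "'l::ab_group_add itself \<Rightarrow> nat \<Rightarrow> bool" where
  "lattice_of_rank _ k \<longleftrightarrow>
     (\<exists>\<phi> :: 'l \<Rightarrow> nat \<Rightarrow> int.
        (\<forall>x y i. \<phi> (x + y) i = \<phi> x i + \<phi> y i) \<and> bij_betw \<phi> UNIV {c. \<forall>i\<ge>k. c i = 0})"

text \<open>A representation is given by its weights \<open>\<beta> i\<close>, which are elements of \<open>Hom(L, \<int>)\<close>.\<close>

definition is_weights :: "('n::finite \<Rightarrow> 'l::ab_group_add \<Rightarrow> int) \<Rightarrow> bool" where
  "is_weights \<beta> \<longleftrightarrow> (\<forall>i. Modules.additive (\<beta> i))"

definition lines_through_origin :: "('l::ab_group_add \<Rightarrow> real) set set" where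
  "lines_through_origin = {range (\<lambda>t l. t * v l) | v. Modules.additive v \<and> v \<noteq> (\<lambda>l. 0)}"

definition quasi_symmetric :: "('n::finite \<Rightarrow> 'l::ab_group_add \<Rightarrow> int) \<Rightarrow> bool" where
  "quasi_symmetric \<beta> \<longleftrightarrow>
     (\<forall>r\<in>lines_through_origin. \<forall>l.
        (\<Sum>i | (\<lambda>x. real_of_int (\<beta> i x)) \<in> r. \<beta> i l) = 0)"

definition weight_map :: "('n::finite \<Rightarrow> 'l::ab_group_add \<Rightarrow> int) \<Rightarrow> int ^ 'n \<Rightarrow> 'l \<Rightarrow> int" where
  "weight_map \<beta> c = (\<lambda>l. \<Sum>i\<in>UNIV. c $ i * \<beta> i l)"

definition weight_map_surjective :: "('n::finite \<Rightarrow> 'l::ab_group_add \<Rightarrow> int) \<Rightarrow> bool" where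
  "weight_map_surjective \<beta> \<longleftrightarrow> range (weight_map \<beta>) = {b. Modules.additive b}"

definition dual_weight_map :: "('n::finite \<Rightarrow> 'l::ab_group_add \<Rightarrow> int) \<Rightarrow> 'l \<Rightarrow> int ^ 'n" where
  "dual_weight_map \<beta> l = (\<chi> i. \<beta> i l)"

definition ray_map :: "('n::finite \<Rightarrow> int ^ 'd::finite) \<Rightarrow> int ^ 'n \<Rightarrow> int ^ 'd" where
  "ray_map \<omega> c = (\<Sum>i\<in>UNIV. c $ i *s \<omega> i)"

text \<open>
  Exactness of \<open>0 \<rightarrow> L \<rightarrow> \<int>\<^sup>n \<rightarrow> N \<rightarrow> 0\<close>. For surjective \<open>Q\<close> this says that \<open>N = \<int>\<^sup>d\<close> is, up to the choice
  of a basis, the dual of \<open>M = ker Q\<close>, and that \<open>\<omega> i\<close> is the restriction to \<open>M\<close> of the \<open>i\<close>-th coordinate.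
\<close>

definition rays_of ::
    "('n::finite \<Rightarrow> 'l::ab_group_add \<Rightarrow> int) \<Rightarrow> ('n \<Rightarrow> int ^ 'd::finite) \<Rightarrow> bool" where
  "rays_of \<beta> \<omega> \<longleftrightarrow>
     inj (dual_weight_map \<beta>) \<and>
     range (dual_weight_map \<beta>) = {c. ray_map \<omega> c = 0} \<and>
     surj (ray_map \<omega>)"

subsection \<open>The polytope, its faces and circuits\<close>

definition real_ray :: "('n::finite \<Rightarrow> int ^ 'd::finite) \<Rightarrow> 'n \<Rightarrow> real ^ 'd" where
  "real_ray \<omega> i = (\<chi> j. real_of_int (\<omega> i $ j))"

definition ray_polytope :: "('n::finite \<Rightarrow> int ^ 'd::finite) \<Rightarrow> (real ^ 'd) set" where
  "ray_polytope \<omega> = convex hull (range (real_ray \<omega>))"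

definition faces :: "('n::finite \<Rightarrow> int ^ 'd::finite) \<Rightarrow> (real ^ 'd) set set" where
  "faces \<omega> = {\<Gamma>. \<Gamma> face_of ray_polytope \<omega> \<and> \<Gamma> \<noteq> {}}"

text \<open>Subsets of the set of rays, which are pairwise distinct, are represented by sets of indices.\<close>

definition rays_in :: "('n::finite \<Rightarrow> int ^ 'd::finite) \<Rightarrow> (real ^ 'd) set \<Rightarrow> 'n set" where
  "rays_in \<omega> \<Gamma> = {i. real_ray \<omega> i \<in> \<Gamma>}"

definition linear_relations :: "('n::finite \<Rightarrow> int ^ 'd::finite) \<Rightarrow> 'n set \<Rightarrow> (real ^ 'n) set" where
  "linear_relations \<omega> I =
     {c. (\<forall>i. i \<notin> I \<longrightarrow> c $ i = 0) \<and> (\<Sum>i\<in>I. c $ i *\<^sub>R real_ray \<omega> i) = 0}"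

definition circuit_face :: "('n::finite \<Rightarrow> int ^ 'd::finite) \<Rightarrow> (real ^ 'd) set \<Rightarrow> bool" where
  "circuit_face \<omega> \<Gamma> \<longleftrightarrow> \<Gamma> \<in> faces \<omega> \<and> dim (linear_relations \<omega> (rays_in \<omega> \<Gamma>)) = 1"

subsection \<open>Polynomials in the coefficients\<close>

type_synonym 'n cpoly = "('n \<Rightarrow>\<^sub>0 nat) \<Rightarrow>\<^sub>0 complex"

definition poly_eval :: "'n::finite cpoly \<Rightarrow> complex ^ 'n \<Rightarrow> complex" where
  "poly_eval p a =
     (\<Sum>m\<in>Poly_Mapping.keys p.
        Poly_Mapping.lookup p m * (\<Prod>i\<in>UNIV. (a $ i) ^ Poly_Mapping.lookup m i))"

text \<open>The polynomial ring in the variables \<open>a\<^sub>i\<close> with \<open>i \<in> I\<close>, and the affine space \<open>\<complex>\<^sup>I\<close>.\<close>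

definition poly_ring :: "'n::finite set \<Rightarrow> 'n cpoly set" where
  "poly_ring I = {p. \<forall>m\<in>Poly_Mapping.keys p. Poly_Mapping.keys m \<subseteq> I}"

definition coeff_space :: "'n::finite set \<Rightarrow> (complex ^ 'n) set" where
  "coeff_space I = {a. \<forall>i. i \<notin> I \<longrightarrow> a $ i = 0}"

definition vanishing_ideal :: "'n::finite set \<Rightarrow> (complex ^ 'n) set \<Rightarrow> 'n cpoly set" where
  "vanishing_ideal I Z = {p \<in> poly_ring I. \<forall>a\<in>Z. poly_eval p a = 0}"

definition zariski_closure :: "'n::finite set \<Rightarrow> (complex ^ 'n) set \<Rightarrow> (complex ^ 'n) set" where
  "zariski_closure I X = {a \<in> coeff_space I. \<forall>p\<in>vanishing_ideal I X. poly_eval p a = 0}"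

definition is_hypersurface :: "'n::finite set \<Rightarrow> (complex ^ 'n) set \<Rightarrow> bool" where
  "is_hypersurface I Z \<longleftrightarrow>
     (\<exists>p\<in>poly_ring I. \<not> Poly_Mapping.keys p \<subseteq> {0} \<and> Z = {a \<in> coeff_space I. poly_eval p a = 0})"

text \<open>
  The reduced equation of a hypersurface, that is, a generator of its vanishing ideal. It is unique up
  to a nonzero scalar.
\<close>

definition defining_equation :: "'n::finite set \<Rightarrow> (complex ^ 'n) set \<Rightarrow> 'n cpoly" where
  "defining_equation I Z = (SOME p. p \<in> poly_ring I \<and> vanishing_ideal I Z = {p * q | q. q \<in> poly_ring I})"

subsection \<open>Discriminants\<close>

definition torus :: "(complex ^ 'm::finite) set" where
  "torus = {x. \<forall>j. x $ j \<noteq> 0}"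

definition laurent_function ::
    "('n::finite \<Rightarrow> int ^ 'd::finite) \<Rightarrow> 'n set \<Rightarrow> complex ^ 'n \<Rightarrow> complex ^ 'd \<Rightarrow> complex" where
  "laurent_function \<omega> I a x = (\<Sum>i\<in>I. a $ i * (\<Prod>j\<in>UNIV. (x $ j) powi (\<omega> i $ j)))"

definition has_critical_point ::
    "('n::finite \<Rightarrow> int ^ 'd::finite) \<Rightarrow> 'n set \<Rightarrow> complex ^ 'n \<Rightarrow> bool" where
  "has_critical_point \<omega> I a \<longleftrightarrow>
     (\<exists>x\<in>torus. (laurent_function \<omega> I a has_derivative (\<lambda>h. 0)) (at x))"

definition discriminant_variety ::
    "('n::finite \<Rightarrow> int ^ 'd::finite) \<Rightarrow> 'n set \<Rightarrow> (complex ^ 'n) set" where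
  "discriminant_variety \<omega> I = zariski_closure I {a \<in> coeff_space I. has_critical_point \<omega> I a}"

definition discriminant :: "('n::finite \<Rightarrow> int ^ 'd::finite) \<Rightarrow> 'n set \<Rightarrow> 'n cpoly" where
  "discriminant \<omega> I =
     (if is_hypersurface I (discriminant_variety \<omega> I)
      then defining_equation I (discriminant_variety \<omega> I) else 1)"

subsection \<open>Multiplicities\<close>

definition integer_points :: "(real ^ 'd::finite) set" where
  "integer_points = {x. \<forall>j. x $ j \<in> \<int>}"

definition lattice_span :: "('n::finite \<Rightarrow> int ^ 'd::finite) \<Rightarrow> 'n set \<Rightarrow> (real ^ 'd) set" where
  "lattice_span \<omega> I = range (\<lambda>c :: 'n \<Rightarrow> int. \<Sum>i\<in>I. of_int (c i) *\<^sub>R real_ray \<omega> i)"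

text \<open>The index of \<open>\<int>(A \<inter> \<Gamma>)\<close> in \<open>N \<inter> Span \<Gamma>\<close>, as the number of cosets.\<close>

definition face_index :: "('n::finite \<Rightarrow> int ^ 'd::finite) \<Rightarrow> (real ^ 'd) set \<Rightarrow> nat" where
  "face_index \<omega> \<Gamma> =
     card ((integer_points \<inter> span \<Gamma>) // {(x, y). x - y \<in> lattice_span \<omega> (rays_in \<omega> \<Gamma>)})"

text \<open>
  \<open>quotient_coords V \<phi> J\<close>: the linear map \<open>\<phi>\<close> identifies \<open>N\<^sub>\<real> / V\<close> with the coordinate subspace
  \<open>\<real>\<^sup>J\<close> of \<open>\<real>\<^sup>d\<close>, in such a way that the lattice \<open>N / (N \<inter> V)\<close> becomes \<open>\<int>\<^sup>J\<close>.
\<close>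

definition quotient_coords ::
    "(real ^ 'd::finite) set \<Rightarrow> (real ^ 'd \<Rightarrow> real ^ 'd) \<Rightarrow> 'd set \<Rightarrow> bool" where
  "quotient_coords V \<phi> J \<longleftrightarrow>
     linear \<phi> \<and> {x. \<phi> x = 0} = V \<and>
     \<phi> ` integer_points = {z \<in> integer_points. \<forall>j. j \<notin> J \<longrightarrow> z $ j = 0}"

text \<open>
  The volume on \<open>\<real>\<^sup>J\<close> for which a unimodular simplex of \<open>\<int>\<^sup>J\<close> has volume \<open>1\<close>.
\<close>

definition normalized_volume :: "'d::finite set \<Rightarrow> (real ^ 'd) set \<Rightarrow> real" where
  "normalized_volume J X =
     fact (card J) * measure (Pi\<^sub>M J (\<lambda>_. lborel)) ((\<lambda>x. restrict (\<lambda>j. x $ j) J) ` X)"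

definition ray_semigroup :: "('n::finite \<Rightarrow> int ^ 'd::finite) \<Rightarrow> (real ^ 'd) set" where
  "ray_semigroup \<omega> = range (\<lambda>c :: 'n \<Rightarrow> nat. \<Sum>i\<in>UNIV. of_nat (c i) *\<^sub>R real_ray \<omega> i)"

text \<open>The value does not depend on the chosen coordinates of the quotient.\<close>

definition subdiagram_volume :: "('n::finite \<Rightarrow> int ^ 'd::finite) \<Rightarrow> (real ^ 'd) set \<Rightarrow> real" where
  "subdiagram_volume \<omega> \<Gamma> =
     (let (\<phi>, J) = (SOME (\<phi>, J). quotient_coords (span \<Gamma>) \<phi> J);
          S = \<phi> ` ray_semigroup \<omega>
      in normalized_volume J (closure (convex hull S - convex hull (S - {0}))))"

text \<open>
  The normalized volume is an integer, because the closure in question is a union of lattice polytopes;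
  so \<open>nat \<lceil>_\<rceil>\<close> only converts its type.
\<close>

definition face_multiplicity :: "('n::finite \<Rightarrow> int ^ 'd::finite) \<Rightarrow> (real ^ 'd) set \<Rightarrow> nat" where
  "face_multiplicity \<omega> \<Gamma> =
     face_index \<omega> \<Gamma> * (if \<Gamma> = ray_polytope \<omega> then 1 else nat \<lceil>subdiagram_volume \<omega> \<Gamma>\<rceil>)"

definition principal_determinant :: "('n::finite \<Rightarrow> int ^ 'd::finite) \<Rightarrow> 'n cpoly" where
  "principal_determinant \<omega> =
     (\<Prod>\<Gamma>\<in>faces \<omega>. discriminant \<omega> (rays_in \<omega> \<Gamma>) ^ face_multiplicity \<omega> \<Gamma>)"

subsection \<open>Loci in the quotient torus and in its universal cover\<close>

text \<open>The map \<open>Q \<otimes> \<complex>\<^sup>*\<close> from \<open>(\<complex>\<^sup>*)\<^sup>n\<close> to \<open>Hom(L, \<complex>\<^sup>*)\<close>, which is the quotient map by \<open>T\<^sub>M\<close>.\<close>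

definition torus_quotient ::
    "('n::finite \<Rightarrow> 'l::ab_group_add \<Rightarrow> int) \<Rightarrow> complex ^ 'n \<Rightarrow> 'l \<Rightarrow> complex" where
  "torus_quotient \<beta> a = (\<lambda>l. \<Prod>i\<in>UNIV. (a $ i) powi (\<beta> i l))"

definition quotient_locus ::
    "('n::finite \<Rightarrow> 'l::ab_group_add \<Rightarrow> int) \<Rightarrow> 'n cpoly \<Rightarrow> ('l \<Rightarrow> complex) set" where
  "quotient_locus \<beta> p = torus_quotient \<beta> ` {a \<in> torus. poly_eval p a = 0}"

definition complex_dual :: "('l::ab_group_add \<Rightarrow> complex) set" where
  "complex_dual = {y. Modules.additive y}"

definition universal_cover :: "('l::ab_group_add \<Rightarrow> complex) \<Rightarrow> 'l \<Rightarrow> complex" where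
  "universal_cover y = (\<lambda>l. exp (2 * of_real pi * \<i> * y l))"

definition log_locus ::
    "('n::finite \<Rightarrow> 'l::ab_group_add \<Rightarrow> int) \<Rightarrow> 'n cpoly \<Rightarrow> ('l \<Rightarrow> complex) set" where
  "log_locus \<beta> p = {y \<in> complex_dual. universal_cover y \<in> quotient_locus \<beta> p}"

definition log_discriminant_locus ::
    "('n::finite \<Rightarrow> 'l::ab_group_add \<Rightarrow> int) \<Rightarrow> ('n \<Rightarrow> int ^ 'd::finite) \<Rightarrow> ('l \<Rightarrow> complex) set" where
  "log_discriminant_locus \<beta> \<omega> = log_locus \<beta> (principal_determinant \<omega>)"

definition log_face_discriminant ::
    "('n::finite \<Rightarrow> 'l::ab_group_add \<Rightarrow> int) \<Rightarrow> ('n \<Rightarrow> int ^ 'd::finite) \<Rightarrow> (real ^ 'd) set \<Rightarrow>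
       ('l \<Rightarrow> complex) set" where
  "log_face_discriminant \<beta> \<omega> \<Gamma> = log_locus \<beta> (discriminant \<omega> (rays_in \<omega> \<Gamma>))"

subsection \<open>Affine hyperplanes\<close>

definition complex_linear_functional :: "(('l::ab_group_add \<Rightarrow> complex) \<Rightarrow> complex) \<Rightarrow> bool" where
  "complex_linear_functional f \<longleftrightarrow>
     (\<forall>y\<in>complex_dual. \<forall>z\<in>complex_dual. f (\<lambda>l. y l + z l) = f y + f z) \<and>
     (\<forall>c. \<forall>y\<in>complex_dual. f (\<lambda>l. c * y l) = c * f y)"

definition complex_affine_hyperplane :: "('l::ab_group_add \<Rightarrow> complex) set \<Rightarrow> bool" where
  "complex_affine_hyperplane H \<longleftrightarrow>
     (\<exists>f c. complex_linear_functional f \<and> (\<exists>y\<in>complex_dual. f y \<noteq> 0) \<and>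
            H = {y \<in> complex_dual. f y = c})"

definition union_of_hyperplanes :: "('l::ab_group_add \<Rightarrow> complex) set \<Rightarrow> bool" where
  "union_of_hyperplanes X \<longleftrightarrow> (\<exists>\<H>. (\<forall>H\<in>\<H>. complex_affine_hyperplane H) \<and> X = \<Union>\<H>)"

end

theory Submission
  imports Defs "HOL-Computational_Algebra.Fundamental_Theorem_Algebra"
begin

text \<open>
  A coefficient vector with a critical point is, up to the action of \<open>T\<^sub>M\<close>, a linear relation between the
  rays, that is, \<open>c\<^sub>i = \<beta>\<^sub>i(l)\<close> for some \<open>l\<close> in \<open>L \<otimes> \<complex>\<close> (Horn--Kapranov uniformization). If no \<open>c\<^sub>i\<close>
  vanishes, its image in the quotient torus is \<open>u \<mapsto> \<Prod>\<^sub>i \<beta>\<^sub>i(l) powi \<beta>\<^sub>i(u)\<close>. On each line of weights the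
  numbers \<open>\<beta>\<^sub>i(l)\<close> are fixed multiples of a single one and the exponents sum to zero, so the image does not
  depend on \<open>l\<close>. Hence the discriminant of a face is, in the torus, a single orbit. If the relations of
  the face have rank one, its equation is a binomial, whose logarithm is a family of parallel hyperplanes.
  In higher rank the orbit has codimension at least two and misses a general translate of a one-parameter
  subgroup; a polynomial whose zeros in the torus lie in this orbit is then a monomial, so the discriminant
  is not a hypersurface. As all multiplicities are positive, only circuits contribute to the principal
  determinant.
\<close>

subsection \<open>Laurent monomials and polynomials\<close>

text \<open>The obstacle is that \<open>discriminant\<close> is defined through Zariski closures and
  vanishing ideals, while the orbit argument only sees points of the torus. Two devices bridge this.
  Dimension counts are replaced by restriction to one-parameter subgroups: in a direction that
  separates the exponents, a polynomial in many variables becomes univariate without merging terms,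
  and the fundamental theorem of algebra yields a zero as soon as there are two terms. Orbit
  equations are cleared of denominators, so that they also hold for relations with vanishing
  coefficients, which come from critical f too. A face with a ray that enters no relation is treated
  apart: all its critical f have that coefficient zero, so up to a scalar the discriminant can only
  be this variable or 1. For circuits the reduced equation has to be identified, which requires the
  whole vanishing ideal and not just its zero set. Positivity of the multiplicities amounts to
  finiteness of an index and to a small box between the two convex hulls of the semigroup.\<close>

definition laurent_monomial :: "complex ^ 'n::finite \<Rightarrow> int ^ 'n \<Rightarrow> complex" where
  "laurent_monomial a u = (\<Prod>i\<in>UNIV. (a $ i) powi (u $ i))"

definition exponent :: "('n::finite \<Rightarrow>\<^sub>0 nat) \<Rightarrow> int ^ 'n" where
  "exponent m = (\<chi> i. int (Poly_Mapping.lookup m i))"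

lemma exponent_nth [simp]: "exponent m $ i = int (Poly_Mapping.lookup m i)"
  by (simp add: exponent_def)

lemma exponent_add: "exponent (m + m') = exponent m + exponent m'"
  by (simp add: vec_eq_iff lookup_add)

lemma exponent_inject [simp]: "exponent m = exponent m' \<longleftrightarrow> m = m'"
  by (simp add: vec_eq_iff poly_mapping_eq_iff fun_eq_iff)

lemma torus_mult: "a \<in> torus \<Longrightarrow> b \<in> torus \<Longrightarrow> a * b \<in> torus"
  by (simp add: torus_def)

lemma laurent_monomial_nonzero [simp]: "a \<in> torus \<Longrightarrow> laurent_monomial a u \<noteq> 0"
  by (simp add: laurent_monomial_def torus_def power_int_not_zero)

lemma laurent_monomial_zero [simp]: "laurent_monomial a 0 = 1"
  by (simp add: laurent_monomial_def)

lemma laurent_monomial_mult: "laurent_monomial (a * b) u = laurent_monomial a u * laurent_monomial b u"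
  by (simp add: laurent_monomial_def power_int_mult_distrib prod.distrib)

lemma laurent_monomial_add:
  "a \<in> torus \<Longrightarrow> laurent_monomial a (u + v) = laurent_monomial a u * laurent_monomial a v"
  by (simp add: laurent_monomial_def torus_def power_int_add prod.distrib)

lemma laurent_monomial_uminus: "laurent_monomial a (- u) = inverse (laurent_monomial a u)"
  by (simp add: laurent_monomial_def power_int_minus flip: prod_inversef)

lemma laurent_monomial_diff:
  "a \<in> torus \<Longrightarrow> laurent_monomial a (u - v) = laurent_monomial a u / laurent_monomial a v"
  using laurent_monomial_add[of a u "- v"] by (simp add: laurent_monomial_uminus divide_inverse)

lemma laurent_monomial_cong:
  "(\<And>i. u $ i \<noteq> 0 \<Longrightarrow> a $ i = b $ i) \<Longrightarrow> laurent_monomial a u = laurent_monomial b u"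
  unfolding laurent_monomial_def by (intro prod.cong refl) (metis power_int_0_right)

lemma prod_power_int: "finite A \<Longrightarrow> (\<Prod>x\<in>A. f x) powi k = (\<Prod>x\<in>A. (f x :: 'a::field) powi k)"
  by (induction A rule: finite_induct) (simp_all add: power_int_mult_distrib)

lemma power_int_sum: "finite A \<Longrightarrow> s \<noteq> 0 \<Longrightarrow> (s :: 'a::field) powi (\<Sum>x\<in>A. f x) = (\<Prod>x\<in>A. s powi f x)"
  by (induction A rule: finite_induct) (simp_all add: power_int_add)

lemma power_int_2_eq_1: "(2 :: complex) powi n = 1 \<Longrightarrow> n = 0"
proof (rule ccontr)
  assume eq: "(2 :: complex) powi n = 1" and "n \<noteq> 0"
  have "(2 :: real) powi n = norm ((2 :: complex) powi n)" by (simp add: norm_power_int)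
  then have "(2 :: real) powi n = 1" using eq by simp
  then have "(2 :: real) powi n = 1 \<and> (2 :: real) powi (- n) = 1" by (simp add: power_int_minus)
  then show False
    using one_less_power_int[of "2 :: real" n] one_less_power_int[of "2 :: real" "- n"] \<open>n \<noteq> 0\<close> by linarith
qed

lemma laurent_monomial_smult: "laurent_monomial a (k *s u) = laurent_monomial a u powi k"
  by (simp add: laurent_monomial_def prod_power_int mult.commute[of k] flip: power_int_mult)

lemma laurent_monomial_sum:
  "finite A \<Longrightarrow> a \<in> torus \<Longrightarrow> laurent_monomial a (\<Sum>x\<in>A. f x) = (\<Prod>x\<in>A. laurent_monomial a (f x))"
  by (induction A rule: finite_induct) (simp_all add: laurent_monomial_add)

section \<open>Integer vectors in general position\<close>

definition int_dot :: "int ^ 'n::finite \<Rightarrow> int ^ 'n \<Rightarrow> int" where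
  "int_dot w u = (\<Sum>i\<in>UNIV. w $ i * u $ i)"

definition one_parameter :: "complex \<Rightarrow> int ^ 'n::finite \<Rightarrow> complex ^ 'n" where
  "one_parameter s w = (\<chi> i. s powi (w $ i))"

lemma one_parameter_torus: "s \<noteq> 0 \<Longrightarrow> one_parameter s w \<in> torus"
  by (simp add: one_parameter_def torus_def power_int_not_zero)

lemma laurent_monomial_one_parameter:
  "s \<noteq> 0 \<Longrightarrow> laurent_monomial (one_parameter s w) u = s powi int_dot w u"
  by (simp add: laurent_monomial_def one_parameter_def int_dot_def power_int_sum flip: power_int_mult)

lemma int_dot_diff: "int_dot w (u - v) = int_dot w u - int_dot w v"
  by (simp add: int_dot_def algebra_simps sum_subtractf)

lemma int_dot_smult: "int_dot w (k *s u) = k * int_dot w u"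
  by (simp add: int_dot_def algebra_simps sum_distrib_left)

text \<open>Induction on D. If the old \<open>w\<close> happens to be orthogonal to the new
  \<open>v\<close>, a large multiple of \<open>w\<close> is perturbed by a unit vector along which
  \<open>v\<close> is nonzero.\<close>

lemma generic_int_vector_nonzero:
  fixes D :: "(int ^ 'n::finite) set"
  assumes "finite D" "0 \<notin> D"
  shows "\<exists>w. \<forall>v\<in>D. int_dot w v \<noteq> 0"
  using assms
proof (induction D rule: finite_induct)
  case (insert v D)
  then obtain w where w: "\<forall>v\<in>D. int_dot w v \<noteq> 0" by auto
  show ?case
  proof (cases "int_dot w v = 0")
    case False
    with w show ?thesis by blast
  next
    case True
    from insert obtain j where j: "v $ j \<noteq> 0" by (auto simp: vec_eq_iff)
    \<comment> \<open>\<open>K\<close> exceeds the j-th coordinate of every x in D in absolute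
      value, so that coordinate cannot cancel the nonzero multiple \<open>K * int_dot w x\<close> of
      \<open>K\<close>.\<close>
    define K where "K = (\<Sum>v\<in>D. \<bar>v $ j\<bar>) + 1"
    define w' where "w' = K *s w + axis j 1"
    have dot: "int_dot w' x = K * int_dot w x + x $ j" for x
    proof -
      have "int_dot w' x = (\<Sum>i\<in>UNIV. K * (w $ i * x $ i) + (if i = j then x $ i else 0))"
        unfolding int_dot_def w'_def axis_def by (intro sum.cong) (auto simp: algebra_simps)
      then show ?thesis
        by (simp add: sum.distrib int_dot_def sum_distrib_left)
    qed
    have "int_dot w' x \<noteq> 0" if "x \<in> D" for x
    proof
      assume "int_dot w' x = 0"
      then have eq: "\<bar>x $ j\<bar> = K * \<bar>int_dot w x\<bar>"
        using dot[of x] by (metis abs_minus_cancel abs_mult abs_of_nonneg add_eq_0_iff K_def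
            add_nonneg_nonneg sum_nonneg abs_ge_zero zero_le_one)
      have "\<bar>x $ j\<bar> < K"
        using member_le_sum[of x D "\<lambda>v. \<bar>v $ j\<bar>"] that insert(1) by (simp add: K_def)
      moreover have "K \<le> K * \<bar>int_dot w x\<bar>"
        using w that calculation by (intro mult_le_cancel_left1[THEN iffD2]) force
      ultimately show False using eq by simp
    qed
    moreover have "int_dot w' v \<noteq> 0" using dot[of v] True j by simp
    ultimately show ?thesis by blast
  qed
qed auto

text \<open>Separating the points of F means not vanishing on their differences, so both demands
  become one finite set of nonzero vectors.\<close>

lemma generic_int_vector:
  fixes D F :: "(int ^ 'n::finite) set"
  assumes "finite D" "0 \<notin> D" "finite F"
  obtains w where "\<forall>v\<in>D. int_dot w v \<noteq> 0" "inj_on (int_dot w) F"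
proof -
  let ?E = "D \<union> ((\<lambda>(x, y). x - y) ` (F \<times> F) - {0})"
  have "finite ?E" "0 \<notin> ?E" using assms by auto
  from generic_int_vector_nonzero[OF this] obtain w where w: "\<forall>v\<in>?E. int_dot w v \<noteq> 0" by blast
  have "inj_on (int_dot w) F"
  proof (rule inj_onI, rule ccontr)
    fix x y assume "x \<in> F" "y \<in> F" "int_dot w x = int_dot w y" "x \<noteq> y"
    then have "x - y \<in> ?E" by force
    with w have "int_dot w (x - y) \<noteq> 0" by blast
    with \<open>int_dot w x = int_dot w y\<close> show False by (simp add: int_dot_diff)
  qed
  with w that show thesis by blast
qed

section \<open>Evaluation of polynomials as a ring homomorphism\<close>

lemma poly_eval_superset:
  assumes "finite S" "Poly_Mapping.keys p \<subseteq> S"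
  shows "poly_eval p a = (\<Sum>m\<in>S. Poly_Mapping.lookup p m * laurent_monomial a (exponent m))"
  unfolding poly_eval_def laurent_monomial_def using assms
  by (intro sum.mono_neutral_cong_left) (auto simp: in_keys_iff)

lemma poly_eval_keys:
  "poly_eval p a = (\<Sum>m\<in>Poly_Mapping.keys p. Poly_Mapping.lookup p m * laurent_monomial a (exponent m))"
  by (rule poly_eval_superset) auto

lemma poly_eval_add: "poly_eval (p + q) a = poly_eval p a + poly_eval q a"
proof -
  let ?S = "Poly_Mapping.keys p \<union> Poly_Mapping.keys q"
  have "Poly_Mapping.keys (p + q) \<subseteq> ?S" by (rule Poly_Mapping.keys_add)
  then show ?thesis
    by (simp add: poly_eval_superset[of ?S] lookup_add algebra_simps sum.distrib)
qed

lemma poly_eval_zero [simp]: "poly_eval 0 a = 0"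
  by (simp add: poly_eval_def)

lemma poly_eval_uminus: "poly_eval (- p) a = - poly_eval p a"
  using poly_eval_add[of p "- p" a] by (simp add: eq_neg_iff_add_eq_0 add.commute)

lemma poly_eval_diff: "poly_eval (p - q) a = poly_eval p a - poly_eval q a"
  using poly_eval_add[of p "- q" a] by (simp add: poly_eval_uminus)

lemma poly_eval_sum: "poly_eval (\<Sum>x\<in>A. f x) a = (\<Sum>x\<in>A. poly_eval (f x) a)"
  by (induction A rule: infinite_finite_induct) (simp_all add: poly_eval_add)

lemma poly_eval_single [simp]:
  "poly_eval (Poly_Mapping.single m c) a = c * laurent_monomial a (exponent m)"
  by (cases "c = 0") (simp_all add: poly_eval_keys)

lemma laurent_monomial_exponent_add:
  "laurent_monomial a (exponent (m + m')) = laurent_monomial a (exponent m) * laurent_monomial a (exponent m')"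
  by (simp add: laurent_monomial_def lookup_add power_add power_int_of_nat flip: prod.distrib of_nat_add)

lemma poly_mapping_eq_sum_singles:
  "p = (\<Sum>m\<in>Poly_Mapping.keys p. Poly_Mapping.single m (Poly_Mapping.lookup p m))"
  by (rule poly_mapping_eqI) (auto simp: lookup_sum lookup_single when_def in_keys_iff)

lemma poly_eval_mult: "poly_eval (p * q) a = poly_eval p a * poly_eval q a"
proof -
  let ?s = "\<lambda>p :: 'a cpoly. \<lambda>m. Poly_Mapping.single m (Poly_Mapping.lookup p m)"
  let ?K = "\<lambda>p :: 'a cpoly. Poly_Mapping.keys p"
  have "p * q = (\<Sum>m\<in>?K p. \<Sum>n\<in>?K q. ?s p m * ?s q n)"
    by (subst (1) poly_mapping_eq_sum_singles[of p], subst (1) poly_mapping_eq_sum_singles[of q])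
      (simp add: sum_product)
  then have "poly_eval (p * q) a = (\<Sum>m\<in>?K p. \<Sum>n\<in>?K q. poly_eval (?s p m) a * poly_eval (?s q n) a)"
    by (simp add: poly_eval_sum mult_single laurent_monomial_exponent_add mult_ac)
  also have "\<dots> = poly_eval (\<Sum>m\<in>?K p. ?s p m) a * poly_eval (\<Sum>m\<in>?K q. ?s q m) a"
    unfolding poly_eval_sum by (simp add: sum_product)
  finally show ?thesis by (simp flip: poly_mapping_eq_sum_singles)
qed

lemma poly_eval_one [simp]: "poly_eval 1 a = 1"
proof -
  have "poly_eval (Poly_Mapping.single 0 1) a = 1"
    unfolding poly_eval_single by (simp add: laurent_monomial_def)
  then show ?thesis by simp
qed

lemma poly_eval_power: "poly_eval (p ^ k) a = poly_eval p a ^ k"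
  by (induction k) (simp_all add: poly_eval_mult)

lemma poly_eval_prod: "poly_eval (\<Prod>x\<in>A. f x) a = (\<Prod>x\<in>A. poly_eval (f x) a)"
  by (induction A rule: infinite_finite_induct) (simp_all add: poly_eval_mult)

lemma poly_eval_cong:
  assumes "p \<in> poly_ring I" "\<And>i. i \<in> I \<Longrightarrow> a $ i = b $ i"
  shows "poly_eval p a = poly_eval p b"
proof -
  have "laurent_monomial a (exponent m) = laurent_monomial b (exponent m)" if "m \<in> Poly_Mapping.keys p" for m
  proof (rule laurent_monomial_cong)
    fix i assume "exponent m $ i \<noteq> 0"
    then have "i \<in> Poly_Mapping.keys m" by (simp add: in_keys_iff)
    then have "i \<in> I" using assms(1) that unfolding poly_ring_def by blast
    then show "a $ i = b $ i" by (rule assms(2))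
  qed
  then show ?thesis by (simp add: poly_eval_keys)
qed

lemma poly_ring_mult: "p \<in> poly_ring I \<Longrightarrow> q \<in> poly_ring I \<Longrightarrow> p * q \<in> poly_ring I"
proof -
  assume p: "p \<in> poly_ring I" and q: "q \<in> poly_ring I"
  have "Poly_Mapping.keys m \<subseteq> I" if m: "m \<in> Poly_Mapping.keys (p * q)" for m
  proof -
    obtain x y where "m = x + y" "x \<in> Poly_Mapping.keys p" "y \<in> Poly_Mapping.keys q"
      using m keys_mult[of p q] by blast
    with p q Poly_Mapping.keys_add[of x y] show ?thesis unfolding poly_ring_def by blast
  qed
  then show ?thesis by (simp add: poly_ring_def)
qed

lemma poly_ring_add: "p \<in> poly_ring I \<Longrightarrow> q \<in> poly_ring I \<Longrightarrow> p + q \<in> poly_ring I"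
  using Poly_Mapping.keys_add[of p q] unfolding poly_ring_def by blast

lemma poly_ring_diff: "p \<in> poly_ring I \<Longrightarrow> q \<in> poly_ring I \<Longrightarrow> p - q \<in> poly_ring I"
  using keys_diff[of p q] unfolding poly_ring_def by blast

lemma poly_ring_single: "c = 0 \<or> Poly_Mapping.keys m \<subseteq> I \<Longrightarrow> Poly_Mapping.single m c \<in> poly_ring I"
  by (auto simp: poly_ring_def)

lemma poly_ring_sum: "(\<And>x. x \<in> A \<Longrightarrow> f x \<in> poly_ring I) \<Longrightarrow> (\<Sum>x\<in>A. f x) \<in> poly_ring I"
  by (induction A rule: infinite_finite_induct) (simp_all add: poly_ring_add, simp_all add: poly_ring_def)

text \<open>Multiplying by a power of \<open>s\<close> turns an exponential sum into a polynomial.\<close>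

lemma exp_sum_as_poly:
  fixes g :: "'k \<Rightarrow> complex" and e :: "'k \<Rightarrow> int"
  assumes "finite K"
  obtains P b where "\<And>s. s \<noteq> 0 \<Longrightarrow> poly P s = s powi b * (\<Sum>k\<in>K. g k * s powi e k)"
    "\<And>n. n + b \<ge> 0 \<Longrightarrow> coeff P (nat (n + b)) = (\<Sum>k | k \<in> K \<and> e k = n. g k)"
    "\<And>k. k \<in> K \<Longrightarrow> e k + b \<ge> 0"
proof -
  define b where "b = (\<Sum>k\<in>K. \<bar>e k\<bar>)"
  have b: "e k + b \<ge> 0" if "k \<in> K" for k
    using member_le_sum[of k K "\<lambda>k. \<bar>e k\<bar>"] assms that by (simp add: b_def)
  define P where "P = (\<Sum>k\<in>K. monom (g k) (nat (e k + b)))"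
  have "poly P s = s powi b * (\<Sum>k\<in>K. g k * s powi e k)" if "s \<noteq> 0" for s
  proof -
    have "s ^ nat (e k + b) = s powi b * s powi e k" if "k \<in> K" for k
      using b[OF that] \<open>s \<noteq> 0\<close>
      by (metis power_int_nonneg_exp power_int_add mult.commute)
    then show ?thesis
      by (simp add: P_def poly_sum poly_monom sum_distrib_left mult_ac cong: sum.cong)
  qed
  moreover have "coeff P (nat (n + b)) = (\<Sum>k | k \<in> K \<and> e k = n. g k)" if "n + b \<ge> 0" for n
  proof -
    have "coeff P (nat (n + b)) = (\<Sum>k\<in>K. if e k = n then g k else 0)"
      unfolding P_def coeff_sum coeff_monom
      using b that by (intro sum.cong refl) (auto simp: nat_eq_iff)
    then show ?thesis using assms by (simp add: sum.inter_filter)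
  qed
  ultimately show thesis using b that by blast
qed

text \<open>After clearing negative exponents the sum is a polynomial with infinitely many roots, so
  each of its coefficients is zero. Frequencies may coincide; a coefficient is then the sum over a
  fibre of e.\<close>

lemma exp_sum_zero:
  fixes g :: "'k \<Rightarrow> complex" and e :: "'k \<Rightarrow> int"
  assumes "finite K" "\<And>s. s \<noteq> 0 \<Longrightarrow> (\<Sum>k\<in>K. g k * s powi e k) = 0"
  shows "(\<Sum>k | k \<in> K \<and> e k = n. g k) = 0"
proof -
  obtain P b where P: "\<And>s. s \<noteq> 0 \<Longrightarrow> poly P s = s powi b * (\<Sum>k\<in>K. g k * s powi e k)"
    "\<And>n. n + b \<ge> 0 \<Longrightarrow> coeff P (nat (n + b)) = (\<Sum>k | k \<in> K \<and> e k = n. g k)"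
    "\<And>k. k \<in> K \<Longrightarrow> e k + b \<ge> 0"
    using exp_sum_as_poly[OF assms(1)] by blast
  have "- {0} \<subseteq> {s. poly P s = 0}" using P(1) assms(2) by auto
  moreover have "infinite (- {0 :: complex})"
    by (simp add: infinite_UNIV_char_0)
  ultimately have "P = 0" using poly_roots_finite finite_subset by blast
  show ?thesis
  proof (cases "n + b \<ge> 0")
    case True
    then show ?thesis using P(2) \<open>P = 0\<close> by (metis coeff_0)
  next
    case False
    then have "{k \<in> K. e k = n} = {}" using P(3) by auto
    then show ?thesis by (metis sum.empty)
  qed
qed

text \<open>Without a nonzero root, the polynomial is a power of the variable times a factor without
  roots, which is constant by the fundamental theorem of algebra; a single monomial cannot carry two
  distinct exponents.\<close>

lemma exp_sum_has_zero:
  fixes g :: "'k \<Rightarrow> complex" and e :: "'k \<Rightarrow> int"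
  assumes K: "finite K" and inj: "inj_on e K" and k: "k1 \<in> K" "k2 \<in> K" "k1 \<noteq> k2" "g k1 \<noteq> 0" "g k2 \<noteq> 0"
  shows "\<exists>s. s \<noteq> 0 \<and> (\<Sum>k\<in>K. g k * s powi e k) = 0"
proof (rule ccontr)
  assume no: "\<not> ?thesis"
  obtain P b where P: "\<And>s. s \<noteq> 0 \<Longrightarrow> poly P s = s powi b * (\<Sum>k\<in>K. g k * s powi e k)"
    "\<And>n. n + b \<ge> 0 \<Longrightarrow> coeff P (nat (n + b)) = (\<Sum>k | k \<in> K \<and> e k = n. g k)"
    "\<And>k. k \<in> K \<Longrightarrow> e k + b \<ge> 0"
    using exp_sum_as_poly[OF K] by blast
  have cf: "coeff P (nat (e k + b)) = g k" if "k \<in> K" for k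
  proof -
    have "{k' \<in> K. e k' = e k} = {k}" using inj that by (auto dest: inj_onD)
    then show ?thesis using P(2)[OF P(3)[OF that]] by simp
  qed
  have "P \<noteq> 0" using cf[OF k(1)] k(4) by auto
  then obtain Q where Q: "P = [:0, 1:] ^ order 0 P * Q" "\<not> [:0, 1:] dvd Q"
    using order_decomp[of P 0] by auto
  have "poly Q s \<noteq> 0" for s
  proof (cases "s = 0")
    case True
    then show ?thesis using Q(2) poly_eq_0_iff_dvd[of Q 0] by simp
  next
    case False
    then have "poly P s \<noteq> 0" using P(1) no power_int_not_zero[of s b] by auto
    then show ?thesis using Q(1) by (metis mult_zero_right poly_mult)
  qed
  then have "constant (poly Q)" using fundamental_theorem_of_algebra by blast
  then obtain c where "Q = [:c:]"
    by (metis constant_degree degree_eq_zeroE)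
  then have "P = monom c (order 0 P)" using Q(1)
    by (simp add: monom_altdef mult.commute)
  then have deg: "n = order 0 P" if "coeff P n \<noteq> 0" for n
    using that by (metis coeff_monom)
  have "nat (e k1 + b) = nat (e k2 + b)"
    using deg cf[OF k(1)] cf[OF k(2)] k by metis
  then have "e k1 = e k2" using P(3)[OF k(1)] P(3)[OF k(2)] by linarith
  then show False using inj k by (auto dest: inj_onD)
qed

lemma poly_eval_one_parameter:
  assumes "s \<noteq> 0"
  shows "poly_eval p (b * one_parameter s w) = (\<Sum>m\<in>Poly_Mapping.keys p.
    (Poly_Mapping.lookup p m * laurent_monomial b (exponent m)) * s powi int_dot w (exponent m))"
  using assms by (simp add: poly_eval_keys laurent_monomial_mult laurent_monomial_one_parameter mult_ac)

text \<open>Along a direction that separates the exponents no two terms of p merge, so on every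
  translate of the subgroup p restricts to a sum with at least two frequencies.\<close>

lemma poly_has_zero_on_one_parameter:
  assumes "inj_on (int_dot w) (exponent ` Poly_Mapping.keys p)" "b \<in> torus"
    and m: "m1 \<in> Poly_Mapping.keys p" "m2 \<in> Poly_Mapping.keys p" "m1 \<noteq> m2"
  shows "\<exists>s. s \<noteq> 0 \<and> poly_eval p (b * one_parameter s w) = 0"
proof -
  let ?g = "\<lambda>m. Poly_Mapping.lookup p m * laurent_monomial b (exponent m)"
  have "inj_on (\<lambda>m. int_dot w (exponent m)) (Poly_Mapping.keys p)"
    using assms(1) by (auto simp: inj_on_def)
  moreover have "?g m1 \<noteq> 0" "?g m2 \<noteq> 0" using assms(2) m by (simp_all add: in_keys_iff)
  ultimately obtain s where s: "s \<noteq> 0" "(\<Sum>m\<in>Poly_Mapping.keys p. ?g m * s powi int_dot w (exponent m)) = 0"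
    using exp_sum_has_zero[OF finite_keys _ m, where g = ?g and e = "\<lambda>m. int_dot w (exponent m)"] by blast
  have "poly_eval p (b * one_parameter s w) = 0"
    unfolding poly_eval_one_parameter[OF s(1)] by (rule s(2))
  with s(1) show ?thesis by blast
qed

text \<open>On a separating one-parameter subgroup, distinct monomials become distinct powers of s,
  whose coefficients can be read off.\<close>

lemma poly_zero_on_torus:
  assumes "\<And>a. a \<in> torus \<Longrightarrow> poly_eval p a = 0"
  shows "p = 0"
proof -
  obtain w where w: "inj_on (int_dot w) (exponent ` Poly_Mapping.keys p)"
    using generic_int_vector[of "{}" "exponent ` Poly_Mapping.keys p"] by auto
  have "Poly_Mapping.keys p = {}"
  proof (rule ccontr)
    assume "Poly_Mapping.keys p \<noteq> {}"
    then obtain m where m: "m \<in> Poly_Mapping.keys p" by blast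
    have z: "(\<Sum>m\<in>Poly_Mapping.keys p. Poly_Mapping.lookup p m * s powi int_dot w (exponent m)) = 0"
      if "s \<noteq> 0" for s
      using assms[OF one_parameter_torus[OF that, of w]] that
      by (simp add: poly_eval_keys laurent_monomial_one_parameter)
    have "{k \<in> Poly_Mapping.keys p. int_dot w (exponent k) = int_dot w (exponent m)} = {m}"
      using w m by (auto simp: inj_on_def)
    with exp_sum_zero[OF _ z, of "int_dot w (exponent m)"] m show False
      by (simp add: in_keys_iff)
  qed
  then show ?thesis by simp
qed

text \<open>The geometric form of the fact that the units of a Laurent polynomial ring are the
  scalar multiples of monomials.\<close>

lemma nonvanishing_on_torus_monomial:
  assumes "\<And>a. a \<in> torus \<Longrightarrow> poly_eval p a \<noteq> 0"
  obtains m where "Poly_Mapping.keys p = {m}"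
proof -
  obtain w where w: "inj_on (int_dot w) (exponent ` Poly_Mapping.keys p)"
    using generic_int_vector[of "{}" "exponent ` Poly_Mapping.keys p"] by auto
  have one: "1 \<in> torus" by (simp add: torus_def)
  have "poly_eval p 1 \<noteq> 0" using assms one by blast
  then have "Poly_Mapping.keys p \<noteq> {}" by auto
  moreover have "m1 = m2" if "m1 \<in> Poly_Mapping.keys p" "m2 \<in> Poly_Mapping.keys p" for m1 m2
    using poly_has_zero_on_one_parameter[OF w one that] assms one one_parameter_torus torus_mult by blast
  ultimately show thesis using that by (metis is_singletonE is_singletonI')
qed

subsection \<open>Linear relations between the rays\<close>

text \<open>Under \<open>rays_of\<close> these are the vectors
  \<open>dual_weight_map \<beta> l\<close> supported in I, so an integer relation stands for an
  element l of L.\<close>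

definition int_relations :: "('n::finite \<Rightarrow> int ^ 'd::finite) \<Rightarrow> 'n set \<Rightarrow> (int ^ 'n) set" where
  "int_relations \<omega> I = {u. ray_map \<omega> u = 0 \<and> (\<forall>i. i \<notin> I \<longrightarrow> u $ i = 0)}"

text \<open>The kernel of A over \<complex>; under \<open>rays_of\<close> it is L \<otimes>
  \<complex>, embedded by the weights.\<close>

definition complex_relation :: "('n::finite \<Rightarrow> int ^ 'd::finite) \<Rightarrow> complex ^ 'n \<Rightarrow> bool" where
  "complex_relation \<omega> c \<longleftrightarrow> (\<forall>j. (\<Sum>i\<in>UNIV. c $ i * of_int (\<omega> i $ j)) = 0)"

definition of_int_vec :: "int ^ 'n::finite \<Rightarrow> 'a::ring_1 ^ 'n" where
  "of_int_vec u = (\<chi> i. of_int (u $ i))"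

lemma of_int_vec_nth [simp]: "of_int_vec u $ i = of_int (u $ i)"
  by (simp add: of_int_vec_def)

lemma ray_map_nth: "ray_map \<omega> c $ j = (\<Sum>i\<in>UNIV. c $ i * \<omega> i $ j)"
  by (simp add: ray_map_def)

lemma ray_map_eq_0_iff: "ray_map \<omega> u = 0 \<longleftrightarrow> (\<forall>j. (\<Sum>i\<in>UNIV. u $ i * \<omega> i $ j) = 0)"
  by (simp add: vec_eq_iff ray_map_nth)

lemma ray_map_add: "ray_map \<omega> (u + v) = ray_map \<omega> u + ray_map \<omega> v"
  by (simp add: vec_eq_iff ray_map_nth algebra_simps sum.distrib)

lemma ray_map_diff: "ray_map \<omega> (u - v) = ray_map \<omega> u - ray_map \<omega> v"
  by (simp add: vec_eq_iff ray_map_nth algebra_simps sum_subtractf)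

lemma ray_map_smult: "ray_map \<omega> (k *s u) = k *s ray_map \<omega> u"
  by (simp add: vec_eq_iff ray_map_nth algebra_simps sum_distrib_left)

lemma int_relations_diff:
  "u \<in> int_relations \<omega> I \<Longrightarrow> v \<in> int_relations \<omega> I \<Longrightarrow> u - v \<in> int_relations \<omega> I"
  by (simp add: int_relations_def ray_map_diff)

lemma int_relations_smult: "u \<in> int_relations \<omega> I \<Longrightarrow> k *s u \<in> int_relations \<omega> I"
  by (simp add: int_relations_def ray_map_smult)

lemma int_relations_sum:
  "(\<And>x. x \<in> A \<Longrightarrow> f x \<in> int_relations \<omega> I) \<Longrightarrow> (\<Sum>x\<in>A. f x) \<in> int_relations \<omega> I"
  by (induction A rule: infinite_finite_induct)
    (auto simp: int_relations_def ray_map_add, auto simp: ray_map_def)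

lemma int_relations_mono: "I \<subseteq> J \<Longrightarrow> int_relations \<omega> I \<subseteq> int_relations \<omega> J"
  by (auto simp: int_relations_def)

lemma complex_relation_of_int_vec: "u \<in> int_relations \<omega> I \<Longrightarrow> complex_relation \<omega> (of_int_vec u)"
proof -
  assume "u \<in> int_relations \<omega> I"
  then have "(\<Sum>i\<in>UNIV. u $ i * \<omega> i $ j) = 0" for j
    by (simp add: int_relations_def ray_map_eq_0_iff)
  then have "of_int (\<Sum>i\<in>UNIV. u $ i * \<omega> i $ j) = (0 :: complex)" for j by simp
  then show ?thesis by (simp add: complex_relation_def)
qed

lemma common_denominator:
  fixes q :: "'a \<Rightarrow> rat"
  assumes "finite A"
  shows "\<exists>D > 0. \<forall>x\<in>A. \<exists>z. of_int D * q x = of_int z"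
  using assms
proof (induction A rule: finite_induct)
  case (insert x A)
  then obtain D where D: "D > 0" "\<forall>x\<in>A. \<exists>z. of_int D * q x = of_int z" by blast
  obtain n d where nd: "quotient_of (q x) = (n, d)" by fastforce
  then have q: "q x = of_int n / of_int d" and "d > 0"
    by (simp_all add: quotient_of_div quotient_of_denom_pos)
  have "\<exists>z. of_int (D * d) * q y = of_int z" if y: "y \<in> insert x A" for y
  proof (cases "y = x")
    case True
    then have "of_int (D * d) * q y = of_int (D * n)" using q \<open>d > 0\<close> by simp
    then show ?thesis by blast
  next
    case False
    then obtain z where "of_int D * q y = of_int z" using D y by auto
    then have "of_int (D * d) * q y = of_int (d * z)" by (simp add: mult_ac)
    then show ?thesis by blast
  qed
  then show ?case using D(1) \<open>d > 0\<close> by (intro exI[of _ "D * d"]) auto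
qed (auto intro: exI[of _ 1])

text \<open>The coefficients of a relation span a finite-dimensional space over \<rat>; since the
  rays are integral, the relation holds coordinate by coordinate in a basis of it. This is how real
  and complex relations are reduced to integer ones.\<close>

lemma rational_coordinates:
  fixes c :: "'n::finite \<Rightarrow> complex"
  obtains B :: "complex set" and q :: "'n \<Rightarrow> complex \<Rightarrow> rat"
  where "finite B" "\<And>i. c i = (\<Sum>b\<in>B. of_rat (q i b) * b)"
    "\<And>r. (\<Sum>b\<in>B. of_rat (r b) * b) = 0 \<Longrightarrow> \<forall>b\<in>B. r b = 0"
proof -
  interpret V: vector_space "\<lambda>(q::rat) (x::complex). of_rat q * x"
    by standard (simp_all add: algebra_simps of_rat_add of_rat_mult)
  obtain B where B: "B \<subseteq> range c" "\<not> V.dependent B" "range c \<subseteq> V.span B"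
    using V.maximal_independent_subset by blast
  have fin: "finite B" by (rule finite_subset[OF B(1)]) simp
  have "\<exists>q. c i = (\<Sum>b\<in>B. of_rat (q b) * b)" for i
    using B(3) V.span_finite[OF fin] by auto
  then obtain q where q: "\<And>i. c i = (\<Sum>b\<in>B. of_rat (q i b) * b)" by metis
  moreover have "\<forall>b\<in>B. r b = 0" if "(\<Sum>b\<in>B. of_rat (r b) * b) = 0" for r
    using B(2) V.dependent_finite[OF fin] that by blast
  ultimately show thesis using that fin by blast
qed

text \<open>A relation over the complex numbers is expanded in a rational basis of the span of its
  coefficients; the coordinates are rational relations with smaller support.\<close>

lemma complex_relation_decomp:
  fixes \<omega> :: "'n::finite \<Rightarrow> int ^ 'd::finite"
  assumes "complex_relation \<omega> c"
  shows "\<exists>(B :: complex set) u g. finite B \<and> (\<forall>b\<in>B. u b \<in> int_relations \<omega> {i. c $ i \<noteq> 0}) \<and>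
    (\<forall>i. c $ i = (\<Sum>b\<in>B. g b * of_int (u b $ i)))"
proof -
  obtain B and q :: "'n \<Rightarrow> complex \<Rightarrow> rat" where fin: "finite B"
    and q: "\<And>i. c $ i = (\<Sum>b\<in>B. of_rat (q i b) * b)"
    and indep: "\<And>r. (\<Sum>b\<in>B. of_rat (r b) * b) = 0 \<Longrightarrow> \<forall>b\<in>B. r b = 0"
    using rational_coordinates[of "\<lambda>i. c $ i"] by blast
  have rel: "(\<Sum>i\<in>UNIV. q i b * of_int (\<omega> i $ j)) = 0" if "b \<in> B" for b j
  proof -
    have "(\<Sum>b\<in>B. of_rat (\<Sum>i\<in>UNIV. q i b * of_int (\<omega> i $ j)) * b) =
        (\<Sum>b\<in>B. \<Sum>i\<in>UNIV. of_rat (q i b) * b * of_int (\<omega> i $ j))"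
      by (simp add: of_rat_sum of_rat_mult sum_distrib_right sum_distrib_left mult_ac)
    also have "\<dots> = (\<Sum>i\<in>UNIV. c $ i * of_int (\<omega> i $ j))"
      by (subst sum.swap) (simp add: q sum_distrib_right)
    also have "\<dots> = 0" using assms by (simp add: complex_relation_def)
    finally show ?thesis using bspec[OF indep[of "\<lambda>b. \<Sum>i\<in>UNIV. q i b * of_int (\<omega> i $ j)"] that] by blast
  qed
  \<comment> \<open>Independence applied to the expansion of zero: a vanishing coefficient has only
    zero coordinates, which gives \<open>u b\<close> its small support.\<close>
  have supp: "q i b = 0" if "b \<in> B" "c $ i = 0" for i b
    using indep[of "q i"] unfolding q[of i, symmetric] using that by blast
  have "\<exists>D > 0. \<forall>i. \<exists>z. of_int D * q i b = of_int z" for b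
    using common_denominator[of UNIV "\<lambda>i. q i b"] by simp
  then obtain D z where D: "\<And>b. D b > 0" "\<And>b i. of_int (D b) * q i b = of_int (z b i)" by metis
  define u :: "complex \<Rightarrow> int ^ 'n" where "u = (\<lambda>b. \<chi> i. z b i)"
  define g :: "complex \<Rightarrow> complex" where "g = (\<lambda>b. b / of_int (D b))"
  have "\<forall>b\<in>B. u b \<in> int_relations \<omega> {i. c $ i \<noteq> 0}"
  proof
    fix b assume b: "b \<in> B"
    have "(\<Sum>i\<in>UNIV. z b i * \<omega> i $ j) = 0" for j
    proof -
      have "rat_of_int (\<Sum>i\<in>UNIV. z b i * \<omega> i $ j) = of_int (D b) * (\<Sum>i\<in>UNIV. q i b * of_int (\<omega> i $ j))"
        by (simp add: sum_distrib_left D(2) flip: mult.assoc)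
      then show ?thesis unfolding rel[OF b] mult_zero_right of_int_eq_0_iff .
    qed
    moreover have "z b i = 0" if "c $ i = 0" for i
      using D(2)[of b i] supp[OF b that] by simp
    ultimately show "u b \<in> int_relations \<omega> {i. c $ i \<noteq> 0}"
      by (simp add: int_relations_def ray_map_eq_0_iff u_def)
  qed
  moreover have "c $ i = (\<Sum>b\<in>B. g b * of_int (u b $ i))" for i
  proof -
    have "g b * of_int (u b $ i) = of_rat (q i b) * b" for b
    proof -
      have "of_rat (of_int (D b) * q i b) = (of_int (u b $ i) :: complex)"
        unfolding D(2) u_def by simp
      then show ?thesis using D(1)[of b] by (simp add: g_def of_rat_mult field_simps)
    qed
    then show ?thesis using q[of i] by simp
  qed
  ultimately show ?thesis using fin by blast
qed

lemma linear_relations_iff: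
  "c \<in> linear_relations \<omega> I \<longleftrightarrow>
    (\<forall>i. i \<notin> I \<longrightarrow> c $ i = 0) \<and> (\<forall>j. (\<Sum>i\<in>UNIV. c $ i * of_int (\<omega> i $ j)) = 0)"
proof -
  have "(\<Sum>i\<in>I. c $ i *\<^sub>R real_ray \<omega> i) = (\<Sum>i\<in>UNIV. c $ i *\<^sub>R real_ray \<omega> i)" if "\<forall>i. i \<notin> I \<longrightarrow> c $ i = 0"
    using that by (intro sum.mono_neutral_left) auto
  then show ?thesis
    by (auto simp: linear_relations_def vec_eq_iff real_ray_def)
qed

lemma subspace_linear_relations: "subspace (linear_relations \<omega> I)"
  unfolding linear_relations_def
  by (auto simp: subspace_def scaleR_add_left sum.distrib simp flip: scaleR_scaleR scaleR_right.sum)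

lemma of_int_vec_linear_relations:
  "u \<in> int_relations \<omega> I \<Longrightarrow> of_int_vec u \<in> linear_relations \<omega> I"
proof -
  assume u: "u \<in> int_relations \<omega> I"
  then have "(\<Sum>i\<in>UNIV. u $ i * \<omega> i $ j) = 0" for j
    by (simp add: int_relations_def ray_map_eq_0_iff)
  then have "of_int (\<Sum>i\<in>UNIV. u $ i * \<omega> i $ j) = (0 :: real)" for j by simp
  then show ?thesis using u by (simp add: linear_relations_iff int_relations_def)
qed

text \<open>Ranks can therefore be tested on integer vectors. A real relation is decomposed over
  \<complex>, and since the vectors \<open>u b\<close> are integral, taking real parts of the
  scalars gives a real combination.\<close>

lemma linear_relations_span:
  "linear_relations \<omega> I \<subseteq> span (of_int_vec ` int_relations \<omega> I)"
proof
  fix c assume c: "c \<in> linear_relations \<omega> I"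
  have "complex_relation \<omega> (\<chi> i. of_real (c $ i))"
    unfolding complex_relation_def
  proof
    fix j
    have "complex_of_real (\<Sum>i\<in>UNIV. c $ i * of_int (\<omega> i $ j)) = 0"
      using c by (simp add: linear_relations_iff)
    then show "(\<Sum>i\<in>UNIV. (\<chi> i. complex_of_real (c $ i)) $ i * of_int (\<omega> i $ j)) = 0" by simp
  qed
  from complex_relation_decomp[OF this] obtain B u g where fin: "finite (B :: complex set)"
    and u: "\<forall>b\<in>B. u b \<in> int_relations \<omega> {i. c $ i \<noteq> 0}"
    and eq: "\<forall>i. complex_of_real (c $ i) = (\<Sum>b\<in>B. g b * of_int (u b $ i))"
    by (simp only: vec_lambda_beta of_real_eq_0_iff) blast
  have "c $ i = (\<Sum>b\<in>B. Re (g b) * of_int (u b $ i))" for i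
    using arg_cong[OF spec[OF eq, of i], of Re] by simp
  then have "c = (\<Sum>b\<in>B. Re (g b) *\<^sub>R of_int_vec (u b))"
    by (simp add: vec_eq_iff)
  moreover have "u b \<in> int_relations \<omega> I" if "b \<in> B" for b
    using bspec[OF u that] c int_relations_mono[of "{i. c $ i \<noteq> 0}" I \<omega>]
    by (auto simp: linear_relations_iff)
  ultimately show "c \<in> span (of_int_vec ` int_relations \<omega> I)"
    by (simp add: span_sum span_mul span_base)
qed

lemma of_int_vec_eq_0_iff [simp]: "(of_int_vec u :: real ^ 'n::finite) = 0 \<longleftrightarrow> u = 0"
  by (simp add: vec_eq_iff)

lemma dim_linear_relations_eq_1:
  assumes u: "u \<in> int_relations \<omega> I" "u \<noteq> 0"
    and multiples: "\<And>v. v \<in> int_relations \<omega> I \<Longrightarrow> of_int_vec v \<in> span {of_int_vec u :: real ^ 'n::finite}"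
  shows "dim (linear_relations \<omega> I) = 1"
proof -
  have "linear_relations \<omega> I \<subseteq> span {of_int_vec u}"
    using linear_relations_span[of \<omega> I] multiples span_minimal[OF _ subspace_span]
    by (metis (no_types, lifting) image_subsetI subset_trans)
  moreover have "span {of_int_vec u} \<subseteq> linear_relations \<omega> I"
    using u of_int_vec_linear_relations subspace_linear_relations by (intro span_minimal) auto
  ultimately have "linear_relations \<omega> I = span {of_int_vec u}" by blast
  then show ?thesis using u(2) by (simp add: dim_insert)
qed

text \<open>The combination \<open>int_dot w u *s v - int_dot w v *s u\<close> is a relation
  orthogonal to w. If only zero is orthogonal to w, every relation is proportional to u and the rank
  is one. An orthogonal relation gives a monomial that is constant along the one-parameter subgroup
  of direction w.\<close>

lemma orthogonal_int_relation:
  fixes \<omega> :: "'n::finite \<Rightarrow> int ^ 'd::finite"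
  assumes dim: "dim (linear_relations \<omega> I) \<noteq> 1" and u: "u \<in> int_relations \<omega> I" "u \<noteq> 0"
  shows "\<exists>v\<in>int_relations \<omega> I. v \<noteq> 0 \<and> int_dot w v = 0"
proof (rule ccontr)
  assume no: "\<not> ?thesis"
  then have wu: "int_dot w u \<noteq> 0" using u by blast
  have "of_int_vec v \<in> span {of_int_vec u :: real ^ 'n}" if v: "v \<in> int_relations \<omega> I" for v
  proof -
    let ?x = "int_dot w u *s v - int_dot w v *s u"
    have "?x \<in> int_relations \<omega> I" using u v by (intro int_relations_diff int_relations_smult)
    moreover have "int_dot w ?x = 0" by (simp add: int_dot_diff int_dot_smult)
    ultimately have "?x = 0" using no by blast
    then have "int_dot w u * v $ i = int_dot w v * u $ i" for i
      by (metis vector_minus_component vector_smult_component zero_index eq_iff_diff_eq_0)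
    then have "of_int (int_dot w u * v $ i) = (of_int (int_dot w v * u $ i) :: real)" for i
      by metis
    then have "of_int_vec v = (of_int (int_dot w v) / of_int (int_dot w u)) *\<^sub>R (of_int_vec u :: real ^ 'n)"
      using wu by (simp add: vec_eq_iff field_simps)
    then show ?thesis by (simp add: span_breakdown_eq)
  qed
  then have "dim (linear_relations \<omega> I) = 1" by (rule dim_linear_relations_eq_1[OF u])
  with dim show False by blast
qed

text \<open>A lattice of rank one is cyclic: at a coordinate where some relation is nonzero,
  division by a relation of least nonzero absolute value there leaves remainder zero.\<close>

lemma int_relations_generator:
  fixes \<omega> :: "'n::finite \<Rightarrow> int ^ 'd::finite"
  assumes "dim (linear_relations \<omega> I) = 1"
  obtains u where "u \<in> int_relations \<omega> I" "u \<noteq> 0" "\<And>v. v \<in> int_relations \<omega> I \<Longrightarrow> \<exists>k. v = k *s u"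
proof -
  have "\<exists>u0\<in>int_relations \<omega> I. u0 \<noteq> 0"
  proof (rule ccontr)
    assume "\<not> ?thesis"
    then have "(of_int_vec ` int_relations \<omega> I :: (real ^ 'n) set) \<subseteq> {0}" by auto
    then have "linear_relations \<omega> I \<subseteq> span {0 :: real ^ 'n}"
      using linear_relations_span[of \<omega> I] span_mono by (metis subset_trans)
    then show False using assms dim_subset[of "linear_relations \<omega> I" "span {0}"] by simp
  qed
  then obtain u0 where u0: "u0 \<in> int_relations \<omega> I" "u0 \<noteq> 0" by blast
  then obtain i where i: "u0 $ i \<noteq> 0" by (auto simp: vec_eq_iff)
  have span: "linear_relations \<omega> I = span {of_int_vec u0}"
  proof (rule sym, rule subspace_dim_equal)
    show "span {of_int_vec u0} \<subseteq> linear_relations \<omega> I"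
      using u0 of_int_vec_linear_relations subspace_linear_relations by (intro span_minimal) auto
    show "dim (linear_relations \<omega> I) \<le> dim (span {of_int_vec u0 :: real ^ 'n})"
      using assms u0(2) by (simp add: dim_insert)
  qed (auto simp: subspace_linear_relations)
  \<comment> \<open>All relations are real multiples of \<open>u0\<close>, so one that vanishes at i
    is zero.\<close>
  have zero: "v = 0" if v: "v \<in> int_relations \<omega> I" "v $ i = 0" for v
  proof -
    obtain t where t: "of_int_vec v = t *\<^sub>R (of_int_vec u0 :: real ^ 'n)"
      using of_int_vec_linear_relations[OF v(1)] unfolding span
      by (auto simp: span_breakdown_eq)
    then have "t * of_int (u0 $ i) = 0"
      using v(2) by (metis of_int_0 of_int_vec_nth real_scaleR_def vector_scaleR_component)
    then have "of_int_vec v = (0 :: real ^ 'n)" using i t by simp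
    then show ?thesis by simp
  qed
  define P where "P u \<longleftrightarrow> u \<in> int_relations \<omega> I \<and> u $ i \<noteq> 0" for u
  have "P u0" using u0 i by (simp add: P_def)
  then obtain u where u: "P u" "\<And>v. P v \<Longrightarrow> nat \<bar>u $ i\<bar> \<le> nat \<bar>v $ i\<bar>"
    using ex_has_least_nat[of P u0 "\<lambda>u. nat \<bar>u $ i\<bar>"] by blast
  have "\<exists>k. v = k *s u" if v: "v \<in> int_relations \<omega> I" for v
  proof -
    let ?k = "v $ i div u $ i"
    have mem: "v - ?k *s u \<in> int_relations \<omega> I"
      using u(1) v by (auto simp: P_def intro: int_relations_diff int_relations_smult)
    have comp: "(v - ?k *s u) $ i = v $ i mod u $ i" by (simp add: minus_div_mult_eq_mod)
    have "\<bar>v $ i mod u $ i\<bar> < \<bar>u $ i\<bar>" using u(1) abs_mod_less by (auto simp: P_def)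
    then have "\<not> P (v - ?k *s u)" using u(2)[of "v - ?k *s u"] comp by fastforce
    then have "v - ?k *s u = 0" using zero mem unfolding P_def by blast
    then show ?thesis using eq_iff_diff_eq_0 by blast
  qed
  moreover have "u \<noteq> 0" using u(1) by (auto simp: P_def)
  ultimately show thesis using that u(1) unfolding P_def by blast
qed

text \<open>Choose for each index a relation that is nonzero there; a generic integer combination of
  these is nonzero at all indices at once.\<close>

lemma full_support_relation:
  assumes "\<And>i. i \<in> I \<Longrightarrow> \<exists>u\<in>int_relations \<omega> I. u $ i \<noteq> 0"
  obtains e where "e \<in> int_relations \<omega> I" "\<And>i. i \<in> I \<Longrightarrow> e $ i \<noteq> 0"
proof -
  obtain U where U: "\<And>i. i \<in> I \<Longrightarrow> U i \<in> int_relations \<omega> I" "\<And>i. i \<in> I \<Longrightarrow> U i $ i \<noteq> 0"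
    using assms by metis
  \<comment> \<open>\<open>r i\<close> lists the i-th coordinates of the chosen relations, so the
    i-th coordinate of their combination with coefficients w is
    \<open>int_dot w (r i)\<close>.\<close>
  define r where "r = (\<lambda>i. \<chi> k. if k \<in> I then U k $ i else 0)"
  have "r i \<noteq> 0" if "i \<in> I" for i
    using U(2)[OF that] that by (auto simp: vec_eq_iff r_def intro!: exI[of _ i])
  then have "0 \<notin> r ` I" by force
  then obtain w where w: "\<forall>v\<in>r ` I. int_dot w v \<noteq> 0"
    using generic_int_vector_nonzero[of "r ` I"] by auto
  define e where "e = (\<Sum>k\<in>I. w $ k *s U k)"
  have "e \<in> int_relations \<omega> I"
    unfolding e_def using U(1) by (intro int_relations_sum int_relations_smult)
  moreover have "e $ i = int_dot w (r i)" for i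
    unfolding e_def int_dot_def r_def by (simp add: if_distrib sum.If_cases)
  ultimately show thesis using w that by auto
qed

subsection \<open>Quasi-symmetric weights\<close>

text \<open>Requiring t \<noteq> 0 makes this an equivalence relation with the zero weights as a
  class of their own; the line spanned by a nonzero weight contains the zero weights as
  well.\<close>

definition parallel_weights :: "('n::finite \<Rightarrow> 'l::ab_group_add \<Rightarrow> int) \<Rightarrow> 'n \<Rightarrow> 'n \<Rightarrow> bool" where
  "parallel_weights \<beta> i j \<longleftrightarrow> (\<exists>t::real. t \<noteq> 0 \<and> (\<forall>l. of_int (\<beta> i l) = t * of_int (\<beta> j l)))"

lemma quasi_symmetric_line_sum:
  fixes \<beta> :: "'n::finite \<Rightarrow> 'l::ab_group_add \<Rightarrow> int"
  assumes w: "is_weights \<beta>" and qs: "quasi_symmetric \<beta>" and nz: "\<beta> i l0 \<noteq> 0"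
  shows "(\<Sum>j | (\<lambda>x. real_of_int (\<beta> j x)) \<in> range (\<lambda>t l. t * real_of_int (\<beta> i l)). \<beta> j l) = 0"
proof -
  let ?v = "\<lambda>l. real_of_int (\<beta> i l)"
  have "Modules.additive ?v" using w unfolding is_weights_def Modules.additive_def by simp
  moreover have "?v \<noteq> (\<lambda>l. 0)" using nz by (auto dest: fun_cong[of _ _ l0])
  ultimately have "range (\<lambda>t l. t * ?v l) \<in> lines_through_origin"
    unfolding lines_through_origin_def mem_Collect_eq by (intro exI[of _ ?v]) simp
  with qs show ?thesis unfolding quasi_symmetric_def by blast
qed

text \<open>The weights on the line of \<open>\<beta> i\<close> are the parallel ones and the zero
  weights, and the latter add nothing to the sum.\<close>

lemma quasi_symmetric_class_sum:
  fixes \<beta> :: "'n::finite \<Rightarrow> 'l::ab_group_add \<Rightarrow> int"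
  assumes w: "is_weights \<beta>" and qs: "quasi_symmetric \<beta>" and nz: "\<beta> i l0 \<noteq> 0"
  shows "(\<Sum>j | parallel_weights \<beta> j i. \<beta> j l) = 0"
proof -
  have "(\<Sum>j | parallel_weights \<beta> j i. \<beta> j l) =
    (\<Sum>j | (\<lambda>x. real_of_int (\<beta> j x)) \<in> range (\<lambda>t l. t * real_of_int (\<beta> i l)). \<beta> j l)"
  proof (rule sum.mono_neutral_left)
    show "{j. parallel_weights \<beta> j i} \<subseteq> {j. (\<lambda>x. real_of_int (\<beta> j x)) \<in> range (\<lambda>t l. t * real_of_int (\<beta> i l))}"
      by (auto simp: parallel_weights_def image_iff fun_eq_iff)
    show "\<forall>j\<in>{j. (\<lambda>x. real_of_int (\<beta> j x)) \<in> range (\<lambda>t l. t * real_of_int (\<beta> i l))} - {j. parallel_weights \<beta> j i}. \<beta> j l = 0"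
    proof
      fix j assume "j \<in> {j. (\<lambda>x. real_of_int (\<beta> j x)) \<in> range (\<lambda>t l. t * real_of_int (\<beta> i l))} - {j. parallel_weights \<beta> j i}"
      then obtain t where "\<forall>x. real_of_int (\<beta> j x) = t * real_of_int (\<beta> i x)" "\<not> parallel_weights \<beta> j i"
        by (auto simp: image_iff fun_eq_iff)
      then have "t = 0" unfolding parallel_weights_def by blast
      then show "\<beta> j l = 0" using \<open>\<forall>x. real_of_int (\<beta> j x) = t * real_of_int (\<beta> i x)\<close> by simp
    qed
  qed simp
  then show ?thesis using quasi_symmetric_line_sum[OF assms] by simp
qed

lemma parallel_weights_refl: "parallel_weights \<beta> i i"
  unfolding parallel_weights_def by (intro exI[of _ 1]) simp

lemma parallel_weights_sym: "parallel_weights \<beta> i j \<Longrightarrow> parallel_weights \<beta> j i"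
proof -
  assume "parallel_weights \<beta> i j"
  then obtain t :: real where "t \<noteq> 0" "\<forall>l. of_int (\<beta> i l) = t * of_int (\<beta> j l)"
    by (auto simp: parallel_weights_def)
  then show ?thesis unfolding parallel_weights_def by (intro exI[of _ "1 / t"]) simp
qed

lemma parallel_weights_trans:
  "parallel_weights \<beta> i j \<Longrightarrow> parallel_weights \<beta> j k \<Longrightarrow> parallel_weights \<beta> i k"
proof -
  assume "parallel_weights \<beta> i j" "parallel_weights \<beta> j k"
  then obtain s t :: real where "s \<noteq> 0" "\<forall>l. of_int (\<beta> i l) = s * of_int (\<beta> j l)"
    "t \<noteq> 0" "\<forall>l. of_int (\<beta> j l) = t * of_int (\<beta> k l)"
    unfolding parallel_weights_def by blast
  then show ?thesis unfolding parallel_weights_def by (intro exI[of _ "s * t"]) simp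
qed

lemma parallel_weights_zero: "parallel_weights \<beta> i j \<Longrightarrow> \<beta> i l = 0 \<longleftrightarrow> \<beta> j l = 0"
  unfolding parallel_weights_def by (metis mult_eq_0_iff of_int_eq_0_iff)

text \<open>Applied to quotients of two relations, which are constant on parallel classes, and with
  the constant 2 to obtain the Calabi-Yau condition.\<close>

lemma quasi_symmetric_prod:
  fixes \<rho> :: "'n::finite \<Rightarrow> complex"
  assumes w: "is_weights \<beta>" and qs: "quasi_symmetric \<beta>"
    and nz: "\<And>i. \<rho> i \<noteq> 0" and eq: "\<And>i j. parallel_weights \<beta> i j \<Longrightarrow> \<rho> i = \<rho> j"
  shows "(\<Prod>i\<in>UNIV. \<rho> i powi \<beta> i l) = 1"
proof -
  let ?g = "\<lambda>i. {j. parallel_weights \<beta> j i}"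
  have g: "?g i = ?g j \<longleftrightarrow> parallel_weights \<beta> i j" for i j
  proof
    assume "?g i = ?g j"
    moreover have "i \<in> ?g i" by (simp add: parallel_weights_refl)
    ultimately show "parallel_weights \<beta> i j" by blast
  next
    assume "parallel_weights \<beta> i j"
    then show "?g i = ?g j" by (blast intro: parallel_weights_sym parallel_weights_trans)
  qed
  have "(\<Prod>i\<in>UNIV. \<rho> i powi \<beta> i l) = (\<Prod>r\<in>range ?g. \<Prod>j\<in>{j\<in>UNIV. ?g j = r}. \<rho> j powi \<beta> j l)"
    by (rule prod.group[symmetric]) auto
  also have "\<dots> = (\<Prod>r\<in>range ?g. 1)"
  proof (rule prod.cong[OF refl], elim imageE)
    fix r i assume r: "r = ?g i"
    have "(\<Prod>j\<in>{j\<in>UNIV. ?g j = r}. \<rho> j powi \<beta> j l) = (\<Prod>j | parallel_weights \<beta> j i. \<rho> i powi \<beta> j l)"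
      unfolding r g using eq by (intro prod.cong) auto
    also have "\<dots> = \<rho> i powi (\<Sum>j | parallel_weights \<beta> j i. \<beta> j l)"
      using nz by (simp add: power_int_sum)
    also have "(\<Sum>j | parallel_weights \<beta> j i. \<beta> j l) = 0"
    \<comment> \<open>The class sum lemma asks for a weight that is nonzero somewhere; if
      \<open>\<beta> i\<close> is zero at l, its whole class is, and the sum is trivial.\<close>
    proof (cases "\<beta> i l = 0")
      case True
      then show ?thesis using parallel_weights_zero by (intro sum.neutral) blast
    qed (rule quasi_symmetric_class_sum[OF w qs])
    finally show "(\<Prod>j\<in>{j\<in>UNIV. ?g j = r}. \<rho> j powi \<beta> j l) = 1" by simp
  qed
  finally show ?thesis by simp
qed

text \<open>Proportionality of two weights is a condition on L; it extends to L \<otimes> \<complex>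
  because c is a complex combination of integer relations, each of the form
  \<open>dual_weight_map \<beta> l\<close>.\<close>

lemma complex_relation_parallel:
  fixes \<omega> :: "'n::finite \<Rightarrow> int ^ 'd::finite"
  assumes "complex_relation \<omega> c" and rays: "rays_of \<beta> \<omega>"
    and t: "\<forall>l. of_int (\<beta> i l) = (t :: real) * of_int (\<beta> j l)"
  shows "c $ i = of_real t * c $ j"
proof -
  obtain B u g where fin: "finite (B :: complex set)"
    and u: "\<forall>b\<in>B. u b \<in> int_relations \<omega> {i. c $ i \<noteq> 0}"
    and c: "\<forall>i. c $ i = (\<Sum>b\<in>B. g b * of_int (u b $ i))"
    using complex_relation_decomp[OF assms(1)] by blast
  have "complex_of_int (u b $ i) = of_real t * of_int (u b $ j)" if b: "b \<in> B" for b
  proof -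
    have "ray_map \<omega> (u b) = 0" using bspec[OF u b] by (simp add: int_relations_def)
    then obtain l where "u b = dual_weight_map \<beta> l" using rays unfolding rays_of_def by blast
    then have "real_of_int (u b $ i) = t * of_int (u b $ j)" using t by (simp add: dual_weight_map_def)
    then have "complex_of_real (real_of_int (u b $ i)) = complex_of_real (t * of_int (u b $ j))" by simp
    then show ?thesis by simp
  qed
  then show ?thesis unfolding c[rule_format] by (simp add: sum_distrib_left mult_ac)
qed

text \<open>Numbers that sum to zero and are not all zero take both signs. Hence both monomials of a
  relation binomial vanish once the coefficients of such a class do.\<close>

lemma parallel_opposite_sign:
  fixes \<beta> :: "'n::finite \<Rightarrow> 'l::ab_group_add \<Rightarrow> int"
  assumes w: "is_weights \<beta>" and qs: "quasi_symmetric \<beta>" and nz: "\<beta> i l \<noteq> 0"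
  shows "(\<exists>j. parallel_weights \<beta> j i \<and> \<beta> j l > 0) \<and> (\<exists>j. parallel_weights \<beta> j i \<and> \<beta> j l < 0)"
proof -
  let ?C = "{j. parallel_weights \<beta> j i}"
  have sum: "(\<Sum>j\<in>?C. \<beta> j l) = 0" by (rule quasi_symmetric_class_sum[OF assms])
  have i: "i \<in> ?C" by (simp add: parallel_weights_refl)
  have "\<exists>j\<in>?C. \<beta> j l > 0"
  proof (rule ccontr)
    assume "\<not> ?thesis"
    then have "\<forall>j\<in>?C. - \<beta> j l \<ge> 0" by force
    moreover have "(\<Sum>j\<in>?C. - \<beta> j l) = 0" using sum by (simp add: sum_negf)
    ultimately have "- \<beta> i l = 0" using i by (subst (asm) sum_nonneg_eq_0_iff) auto
    with nz show False by simp
  qed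
  moreover have "\<exists>j\<in>?C. \<beta> j l < 0"
  proof (rule ccontr)
    assume "\<not> ?thesis"
    then have "\<forall>j\<in>?C. \<beta> j l \<ge> 0" by force
    then have "\<beta> i l = 0" using i sum by (subst (asm) sum_nonneg_eq_0_iff) auto
    with nz show False by simp
  qed
  ultimately show ?thesis by blast
qed

text \<open>Together with \<open>positive_part (- u)\<close> this writes a Laurent monomial as a
  quotient of two monomials with disjoint supports.\<close>

definition positive_part :: "int ^ 'n::finite \<Rightarrow> 'n \<Rightarrow>\<^sub>0 nat" where
  "positive_part u = Abs_poly_mapping (\<lambda>i. nat (u $ i))"

lemma lookup_positive_part [simp]: "Poly_Mapping.lookup (positive_part u) i = nat (u $ i)"
  unfolding positive_part_def by (subst lookup_Abs_poly_mapping) auto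

lemma exponent_positive_part: "exponent (positive_part u) - exponent (positive_part (- u)) = u"
  by (simp add: vec_eq_iff)

lemma laurent_monomial_eq_0: "a $ i = 0 \<Longrightarrow> v $ i \<noteq> 0 \<Longrightarrow> laurent_monomial a v = 0"
  unfolding laurent_monomial_def by (intro prod_zero) (auto intro!: bexI[of _ i])

text \<open>By quasi-symmetry the monomial \<open>c\<^sup>u\<close> takes the same value at all relations \<open>c\<close> with nonzero
  coefficients. The statement avoids denominators, so that it also covers vanishing coefficients.\<close>

lemma relation_binomial:
  fixes \<omega> :: "'n::finite \<Rightarrow> int ^ 'd::finite"
  assumes w: "is_weights \<beta>" and qs: "quasi_symmetric \<beta>" and rays: "rays_of \<beta> \<omega>"
    and c: "complex_relation \<omega> c" and e: "complex_relation \<omega> e"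
    and u: "u \<in> int_relations \<omega> UNIV" and supp: "\<And>i. u $ i \<noteq> 0 \<Longrightarrow> e $ i \<noteq> 0"
  shows "laurent_monomial c (exponent (positive_part u)) =
    laurent_monomial e u * laurent_monomial c (exponent (positive_part (- u)))"
proof -
  obtain l where l: "u = dual_weight_map \<beta> l"
    using u rays unfolding rays_of_def int_relations_def by blast
  then have ui: "u $ i = \<beta> i l" for i by (simp add: dual_weight_map_def)
  have scale: "c $ i * e $ j = c $ j * e $ i" if par: "parallel_weights \<beta> i j" for i j
  proof -
    obtain t :: real where t: "\<forall>l. of_int (\<beta> i l) = t * of_int (\<beta> j l)"
      using par by (auto simp: parallel_weights_def)
    show ?thesis
      using complex_relation_parallel[OF c rays t] complex_relation_parallel[OF e rays t] by simp
  qed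
  show ?thesis
  proof (cases "\<forall>i. u $ i \<noteq> 0 \<longrightarrow> c $ i \<noteq> 0")
    case True
    \<comment> \<open>Coefficients outside the support of u may vanish; replacing them by 1 gives
      torus points and leaves the monomials in question unchanged.\<close>
    define c' where "c' = (\<chi> i. if u $ i = 0 then 1 else c $ i)"
    define e' where "e' = (\<chi> i. if u $ i = 0 then 1 else e $ i)"
    have tor: "c' \<in> torus" "e' \<in> torus" using True supp by (auto simp: c'_def e'_def torus_def)
    have "(\<Prod>i\<in>UNIV. (c' $ i / e' $ i) powi \<beta> i l) = 1"
    proof (rule quasi_symmetric_prod[OF w qs])
      show "c' $ i / e' $ i \<noteq> 0" for i using tor by (simp add: torus_def)
      show "c' $ i / e' $ i = c' $ j / e' $ j" if "parallel_weights \<beta> i j" for i j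
        using scale[OF that] parallel_weights_zero[OF that, of l] supp[of i] supp[of j]
        by (auto simp: c'_def e'_def ui field_simps)
    qed
    then have "laurent_monomial c' u = laurent_monomial e' u"
      using tor by (simp add: power_int_divide_distrib prod_dividef laurent_monomial_def ui)
    moreover have "laurent_monomial e' u = laurent_monomial e u"
      by (rule laurent_monomial_cong) (simp add: e'_def)
    moreover have "laurent_monomial c' u =
      laurent_monomial c' (exponent (positive_part u)) / laurent_monomial c' (exponent (positive_part (- u)))"
      using laurent_monomial_diff[OF tor(1)] exponent_positive_part by metis
    moreover have "laurent_monomial c' (exponent (positive_part u)) = laurent_monomial c (exponent (positive_part u))"
      by (rule laurent_monomial_cong) (auto simp: c'_def)
    moreover have "laurent_monomial c' (exponent (positive_part (- u))) = laurent_monomial c (exponent (positive_part (- u)))"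
      by (rule laurent_monomial_cong) (auto simp: c'_def)
    ultimately show ?thesis using tor(1)
      by (metis laurent_monomial_nonzero nonzero_divide_eq_eq)
  next
    case False
    then obtain i where i: "\<beta> i l \<noteq> 0" "c $ i = 0" by (auto simp: ui)
    \<comment> \<open>One vanishing coefficient makes those of its whole parallel class vanish, and
      the weights of that class take both signs at l, so both sides are zero.\<close>
    have cz: "c $ j = 0" if "parallel_weights \<beta> j i" for j
      using scale[OF that] supp[of i] i by (auto simp: ui)
    obtain j k where "parallel_weights \<beta> j i" "\<beta> j l > 0" "parallel_weights \<beta> k i" "\<beta> k l < 0"
      using parallel_opposite_sign[OF w qs i(1)] by blast
    then show ?thesis
      using laurent_monomial_eq_0[of c j "exponent (positive_part u)"]
        laurent_monomial_eq_0[of c k "exponent (positive_part (- u))"] cz by (simp add: ui)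
  qed
qed

subsection \<open>Critical points\<close>

text \<open>The logarithmic form: the differential is a multiple of the monomial itself, which is
  what turns critical equations into linear relations.\<close>

lemma has_derivative_laurent_monomial:
  fixes x :: "complex ^ 'd::finite"
  assumes x: "x \<in> torus"
  shows "((\<lambda>x. laurent_monomial x v) has_derivative
    (\<lambda>h. laurent_monomial x v * (\<Sum>j\<in>UNIV. of_int (v $ j) * h $ j / x $ j))) (at x)"
proof -
  have "((\<lambda>x. laurent_monomial x v) has_derivative
    (\<lambda>h. \<Sum>j\<in>UNIV. (h $ j * (of_int (v $ j) * x $ j powi (v $ j - 1))) * (\<Prod>k\<in>UNIV - {j}. x $ k powi (v $ k)))) (at x)"
    unfolding laurent_monomial_def
  proof (rule has_derivative_prod)
    fix j :: 'd
    show "((\<lambda>x. x $ j powi v $ j) has_derivative (\<lambda>h. h $ j * (of_int (v $ j) * x $ j powi (v $ j - 1)))) (at x)"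
      using x by (intro has_derivative_power_int bounded_linear.has_derivative[OF bounded_linear_vec_nth has_derivative_ident])
        (auto simp: torus_def)
  qed
  moreover have "h $ j * (of_int (v $ j) * x $ j powi (v $ j - 1)) * (\<Prod>k\<in>UNIV - {j}. x $ k powi (v $ k)) =
      laurent_monomial x v * (of_int (v $ j) * h $ j / x $ j)" for h j
  proof -
    have "laurent_monomial x v = x $ j powi v $ j * (\<Prod>k\<in>UNIV - {j}. x $ k powi (v $ k))"
      unfolding laurent_monomial_def by (rule prod.remove) auto
    moreover have "x $ j powi (v $ j - 1) = x $ j powi v $ j / x $ j"
      using x by (simp add: power_int_diff torus_def)
    ultimately show ?thesis by simp
  qed
  ultimately show ?thesis by (simp add: sum_distrib_left)
qed

text \<open>The j-th partial derivative of f, multiplied by x_j, is the j-th coordinate of the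
  combination of the rays with coefficients a_i x^\<omega>_i; so x is critical iff this combination
  is zero.\<close>

lemma has_critical_point_iff:
  fixes \<omega> :: "'n::finite \<Rightarrow> int ^ 'd::finite"
  shows "has_critical_point \<omega> I a \<longleftrightarrow>
    (\<exists>x\<in>torus. complex_relation \<omega> (\<chi> i. if i \<in> I then a $ i * laurent_monomial x (\<omega> i) else 0))"
proof -
  have "(laurent_function \<omega> I a has_derivative (\<lambda>h. 0)) (at x) \<longleftrightarrow>
      complex_relation \<omega> (\<chi> i. if i \<in> I then a $ i * laurent_monomial x (\<omega> i) else 0)"
    (is "?D \<longleftrightarrow> ?R") if x: "x \<in> torus" for x
  proof -
    let ?s = "\<lambda>j. \<Sum>i\<in>I. a $ i * laurent_monomial x (\<omega> i) * of_int (\<omega> i $ j)"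
    let ?D' = "\<lambda>h. \<Sum>i\<in>I. a $ i * (laurent_monomial x (\<omega> i) * (\<Sum>j\<in>UNIV. of_int (\<omega> i $ j) * h $ j / x $ j))"
    have R: "?R \<longleftrightarrow> (\<forall>j. ?s j = 0)"
      by (simp add: complex_relation_def if_distrib[of "\<lambda>y. y * _"] sum.If_cases cong: if_cong)
    have der: "(laurent_function \<omega> I a has_derivative ?D') (at x)"
      unfolding laurent_function_def laurent_monomial_def[symmetric]
      by (intro has_derivative_sum has_derivative_mult_right has_derivative_laurent_monomial x)
    have D': "?D' h = (\<Sum>j\<in>UNIV. ?s j * (h $ j / x $ j))" for h
      by (simp add: sum_distrib_left sum_distrib_right mult_ac sum.swap[of _ UNIV I])
    show ?thesis
    proof
      assume ?D
      then have z: "?D' = (\<lambda>h. 0)" using has_derivative_unique[OF der] by blast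
      have "?s j = 0" for j
      proof -
        \<comment> \<open>Testing in the direction x_j times the j-th unit vector isolates the j-th
          logarithmic derivative.\<close>
        have "(\<Sum>k\<in>UNIV. ?s k * (axis j (x $ j) $ k / x $ k)) = 0" using z D' by metis
        moreover have "?s k * (axis j (x $ j) $ k / x $ k) = (if k = j then ?s j else 0)" for k
          using x by (auto simp: axis_def torus_def)
        ultimately show ?thesis by simp
      qed
      then show ?R using R by blast
    next
      assume ?R
      then have "?D' = (\<lambda>h. 0)" using R D' by (auto simp: fun_eq_iff)
      then show ?D using der by simp
    qed
  qed
  then show ?thesis unfolding has_critical_point_def by blast
qed

subsection \<open>Discriminants\<close>

lemma vanishing_ideal_zariski_closure: "vanishing_ideal I (zariski_closure I X) = vanishing_ideal I X"
  if "X \<subseteq> coeff_space I"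
  using that unfolding vanishing_ideal_def zariski_closure_def by blast

lemma subset_zariski_closure: "X \<subseteq> coeff_space I \<Longrightarrow> X \<subseteq> zariski_closure I X"
  unfolding vanishing_ideal_def zariski_closure_def by blast

lemma one_poly_ring: "1 \<in> poly_ring I"
  unfolding poly_ring_def by simp

text \<open>\<open>SOME\<close> picks an unspecified generator of the ideal; two generators divide
  each other and so have the same zeros.\<close>

lemma defining_equation_zero_iff:
  assumes "p \<in> poly_ring I" "vanishing_ideal I Z = {p * q | q. q \<in> poly_ring I}"
  shows "poly_eval (defining_equation I Z) a = 0 \<longleftrightarrow> poly_eval p a = 0"
proof -
  let ?d = "defining_equation I Z"
  have d: "?d \<in> poly_ring I \<and> vanishing_ideal I Z = {?d * q | q. q \<in> poly_ring I}"
    unfolding defining_equation_def by (rule someI[of _ p]) (use assms in blast)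
  have "p * 1 \<in> vanishing_ideal I Z" using assms(2) one_poly_ring by blast
  then obtain q where "p = ?d * q" using d by auto
  moreover have "?d * 1 \<in> vanishing_ideal I Z" using d one_poly_ring by blast
  then obtain q' where "?d = p * q'" using assms(2) by auto
  ultimately show ?thesis by (metis mult_zero_left poly_eval_mult)
qed

text \<open>The value z fills the coordinates outside I: 0 gives a point of
  \<open>coeff_space I\<close>, while 1 keeps torus points in the torus. Polynomials in the
  variables of I do not see the difference.\<close>

definition restrict_vec :: "'n set \<Rightarrow> complex \<Rightarrow> complex ^ 'n::finite \<Rightarrow> complex ^ 'n" where
  "restrict_vec I z a = (\<chi> i. if i \<in> I then a $ i else z)"

lemma restrict_vec_nth [simp]: "restrict_vec I z a $ i = (if i \<in> I then a $ i else z)"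
  by (simp add: restrict_vec_def)

lemma restrict_vec_coeff_space [simp]: "restrict_vec I 0 a \<in> coeff_space I"
  by (simp add: coeff_space_def)

lemma poly_eval_restrict_vec: "p \<in> poly_ring I \<Longrightarrow> poly_eval p (restrict_vec I z a) = poly_eval p a"
  by (rule poly_eval_cong) auto

definition variable :: "'n::finite \<Rightarrow> 'n cpoly" where
  "variable i = Poly_Mapping.single (Poly_Mapping.single i 1) 1"

lemma poly_eval_variable [simp]: "poly_eval (variable i) a = a $ i"
proof -
  have "laurent_monomial a (exponent (Poly_Mapping.single i 1)) = (\<Prod>j\<in>UNIV. if j = i then a $ i else 1)"
    unfolding laurent_monomial_def by (intro prod.cong) (auto simp: lookup_single when_def)
  then show ?thesis by (simp add: variable_def)
qed

lemma variable_poly_ring: "i \<in> I \<Longrightarrow> variable i \<in> poly_ring I"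
  unfolding variable_def by (rule poly_ring_single) auto

text \<open>The equation p has no zero in the torus, so it is a monomial; a variable other than a_i
  in it would give points of Z with a_i nonzero.\<close>

lemma hypersurface_in_coordinate_hyperplane:
  fixes Z :: "(complex ^ 'n::finite) set"
  assumes hyp: "is_hypersurface I Z" and i: "i \<in> I" and sub: "\<And>a. a \<in> Z \<Longrightarrow> a $ i = 0"
  shows "Z = {a \<in> coeff_space I. a $ i = 0}"
proof -
  obtain p where p: "p \<in> poly_ring I" "\<not> Poly_Mapping.keys p \<subseteq> {0}"
    and Z: "Z = {a \<in> coeff_space I. poly_eval p a = 0}"
    using hyp unfolding is_hypersurface_def by blast
  have "poly_eval p a \<noteq> 0" if "a \<in> torus" for a
  proof
    assume "poly_eval p a = 0"
    then have "restrict_vec I 0 a \<in> Z" by (simp add: Z poly_eval_restrict_vec[OF p(1)])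
    then have "a $ i = 0" using sub[of "restrict_vec I 0 a"] i by simp
    with that show False by (simp add: torus_def)
  qed
  then obtain m where m: "Poly_Mapping.keys p = {m}" by (rule nonvanishing_on_torus_monomial)
  then have ev: "poly_eval p a = 0 \<longleftrightarrow> laurent_monomial a (exponent m) = 0" for a
    using in_keys_iff[of m p] by (simp add: poly_eval_keys)
  have mi: "j = i" if "Poly_Mapping.lookup m j \<noteq> 0" for j
  proof (rule ccontr)
    assume "j \<noteq> i"
    have "j \<in> I" using p(1) m that by (auto simp: poly_ring_def in_keys_iff)
    \<comment> \<open>Zero at j and outside I, one elsewhere: p vanishes there although the i-th
      coordinate is 1.\<close>
    let ?a = "restrict_vec (I - {j}) 0 1"
    have "laurent_monomial ?a (exponent m) = 0"
      using that by (intro laurent_monomial_eq_0[of _ j]) auto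
    then have "?a \<in> Z" unfolding Z ev by (auto simp: coeff_space_def)
    from sub[OF this] i \<open>j \<noteq> i\<close> show False by simp
  qed
  have "m \<noteq> 0" using p(2) m by auto
  then have "\<exists>j. Poly_Mapping.lookup m j \<noteq> 0"
    by (simp add: poly_mapping_eq_iff fun_eq_iff)
  then obtain j where j: "Poly_Mapping.lookup m j \<noteq> 0" by (rule exE)
  have mi': "Poly_Mapping.lookup m i \<noteq> 0" using j unfolding mi[OF j] .
  have "laurent_monomial a (exponent m) = 0 \<longleftrightarrow> a $ i = 0" for a
  proof
    assume "laurent_monomial a (exponent m) = 0"
    then obtain j where "a $ j = 0" "Poly_Mapping.lookup m j \<noteq> 0"
      by (auto simp: laurent_monomial_def)
    then show "a $ i = 0" using mi by blast
  next
    assume "a $ i = 0"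
    then show "laurent_monomial a (exponent m) = 0"
      using mi' by (intro laurent_monomial_eq_0[of _ i]) auto
  qed
  then show ?thesis unfolding Z ev by simp
qed

text \<open>Setting a_i = 0 keeps exactly the terms of p free of a_i; their sum vanishes on the
  torus, so there are none and every term is divisible by a_i.\<close>

lemma vanishing_ideal_coordinate_hyperplane:
  fixes i :: "'n::finite"
  assumes i: "i \<in> I"
  shows "vanishing_ideal I {a \<in> coeff_space I. a $ i = 0} = {variable i * q | q. q \<in> poly_ring I}"
proof (intro equalityI subsetI)
  fix p assume "p \<in> {variable i * q | q. q \<in> poly_ring I}"
  then show "p \<in> vanishing_ideal I {a \<in> coeff_space I. a $ i = 0}"
    using variable_poly_ring[OF i] by (auto simp: vanishing_ideal_def poly_eval_mult poly_ring_mult)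
next
  fix p assume "p \<in> vanishing_ideal I {a \<in> coeff_space I. a $ i = 0}"
  then have p: "p \<in> poly_ring I" "\<And>a. a \<in> coeff_space I \<Longrightarrow> a $ i = 0 \<Longrightarrow> poly_eval p a = 0"
    by (auto simp: vanishing_ideal_def)
  let ?K = "{m \<in> Poly_Mapping.keys p. Poly_Mapping.lookup m i = 0}"
  let ?s = "\<lambda>m. Poly_Mapping.single m (Poly_Mapping.lookup p m)"
  have sum_zero: "(\<Sum>m\<in>?K. ?s m) = 0"
  proof (rule poly_zero_on_torus)
    fix a :: "complex ^ 'n" assume "a \<in> torus"
    let ?a = "restrict_vec (- {i}) 0 a"
    have "poly_eval p ?a = poly_eval p (restrict_vec I 0 ?a)"
      using poly_eval_restrict_vec[OF p(1)] by metis
    also have "\<dots> = 0" by (rule p(2)) auto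
    finally have "0 = (\<Sum>m\<in>Poly_Mapping.keys p. Poly_Mapping.lookup p m * laurent_monomial ?a (exponent m))"
      by (simp add: poly_eval_keys)
    also have "\<dots> = (\<Sum>m\<in>?K. Poly_Mapping.lookup p m * laurent_monomial a (exponent m))"
    proof (rule sum.mono_neutral_cong_right)
      show "\<forall>m\<in>Poly_Mapping.keys p - ?K. Poly_Mapping.lookup p m * laurent_monomial ?a (exponent m) = 0"
        using laurent_monomial_eq_0[of ?a i] by auto
      show "Poly_Mapping.lookup p m * laurent_monomial ?a (exponent m) =
          Poly_Mapping.lookup p m * laurent_monomial a (exponent m)" if "m \<in> ?K" for m
      proof -
        have "laurent_monomial ?a (exponent m) = laurent_monomial a (exponent m)"
          using that by (intro laurent_monomial_cong) (auto intro: ccontr)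
        then show ?thesis by simp
      qed
    qed auto
    finally show "poly_eval (\<Sum>m\<in>?K. ?s m) a = 0" by (simp add: poly_eval_sum)
  qed
  have Kz: "m \<notin> ?K" for m
  proof -
    have "Poly_Mapping.lookup (\<Sum>m\<in>?K. ?s m) m = 0" using sum_zero by simp
    then show ?thesis by (auto simp: lookup_sum lookup_single when_def in_keys_iff split: if_splits)
  qed
  let ?e = "Poly_Mapping.single i (1 :: nat)"
  have me: "?e + (m - ?e) = m" if "m \<in> Poly_Mapping.keys p" for m
    using Kz[of m] that by (intro poly_mapping_eqI) (auto simp: lookup_add lookup_minus lookup_single when_def)
  define q where "q = (\<Sum>m\<in>Poly_Mapping.keys p. Poly_Mapping.single (m - ?e) (Poly_Mapping.lookup p m))"
  have "variable i * q = (\<Sum>m\<in>Poly_Mapping.keys p. ?s m)"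
    unfolding q_def variable_def sum_distrib_left mult_single using me by (intro sum.cong) auto
  then have "p = variable i * q" using poly_mapping_eq_sum_singles[of p] by simp
  moreover have "q \<in> poly_ring I"
    unfolding q_def
  proof (intro poly_ring_sum poly_ring_single disjI2)
    fix m assume "m \<in> Poly_Mapping.keys p"
    then have "Poly_Mapping.keys m \<subseteq> I" using p(1) by (simp add: poly_ring_def)
    then show "Poly_Mapping.keys (m - ?e) \<subseteq> I"
      by (auto simp: in_keys_iff lookup_minus subset_iff)
  qed
  ultimately show "p \<in> {variable i * q | q. q \<in> poly_ring I}" by blast
qed

lemma laurent_monomial_ray_map:
  assumes "x \<in> torus"
  shows "laurent_monomial (\<chi> i. laurent_monomial x (\<omega> i)) u = laurent_monomial x (ray_map \<omega> u)"
  using assms by (simp add: ray_map_def laurent_monomial_sum laurent_monomial_smult)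
    (simp add: laurent_monomial_def)

definition critical_set :: "('n::finite \<Rightarrow> int ^ 'd::finite) \<Rightarrow> 'n set \<Rightarrow> (complex ^ 'n) set" where
  "critical_set \<omega> I = {a \<in> coeff_space I. has_critical_point \<omega> I a}"

lemma critical_set_coeff_space: "critical_set \<omega> I \<subseteq> coeff_space I"
  by (auto simp: critical_set_def)

lemma discriminant_variety_eq: "discriminant_variety \<omega> I = zariski_closure I (critical_set \<omega> I)"
  by (simp add: discriminant_variety_def critical_set_def)

lemma critical_set_relation:
  assumes "a \<in> critical_set \<omega> I"
  obtains x where "x \<in> torus" "complex_relation \<omega> (a * (\<chi> i. laurent_monomial x (\<omega> i)))"
proof -
  obtain x where x: "x \<in> torus"
    "complex_relation \<omega> (\<chi> i. if i \<in> I then a $ i * laurent_monomial x (\<omega> i) else 0)"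
    using assms unfolding critical_set_def has_critical_point_iff by blast
  moreover have "(\<chi> i. if i \<in> I then a $ i * laurent_monomial x (\<omega> i) else 0) =
      a * (\<chi> i. laurent_monomial x (\<omega> i))"
    using assms by (auto simp: vec_eq_iff critical_set_def coeff_space_def)
  ultimately show thesis using that by simp
qed

text \<open>The translate of a relation by x has a critical point at the inverse of x, whose
  characters undo the translation.\<close>

lemma relation_critical_set:
  assumes "complex_relation \<omega> c" "c \<in> coeff_space I" "x \<in> torus"
  shows "c * (\<chi> i. laurent_monomial x (\<omega> i)) \<in> critical_set \<omega> I"
proof -
  let ?y = "\<chi> j. inverse (x $ j)"
  have y: "?y \<in> torus" using assms(3) by (simp add: torus_def)
  have "laurent_monomial ?y v = inverse (laurent_monomial x v)" for v
    by (simp add: laurent_monomial_def power_int_inverse flip: prod_inversef)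
  then have "(\<chi> i. if i \<in> I then (c * (\<chi> i. laurent_monomial x (\<omega> i))) $ i * laurent_monomial ?y (\<omega> i) else 0) = c"
    using assms(2,3) by (auto simp: vec_eq_iff coeff_space_def)
  then have "has_critical_point \<omega> I (c * (\<chi> i. laurent_monomial x (\<omega> i)))"
    using assms(1) y unfolding has_critical_point_iff by metis
  then show ?thesis using assms(2) by (simp add: critical_set_def coeff_space_def)
qed

text \<open>A ray in no relation forces a_i = 0 at every critical f, so the variety lies in a
  coordinate hyperplane. If it is a hypersurface, it is that hyperplane, with equation a_i, which is
  nonzero on the torus. Faces without any relation, such as vertices, fall under this case.\<close>

lemma discriminant_unsupported:
  fixes \<omega> :: "'n::finite \<Rightarrow> int ^ 'd::finite"
  assumes i: "i \<in> I" and zero: "\<And>u. u \<in> int_relations \<omega> I \<Longrightarrow> u $ i = 0" and a: "a \<in> torus"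
  shows "poly_eval (discriminant \<omega> I) a \<noteq> 0"
proof (cases "is_hypersurface I (discriminant_variety \<omega> I)")
  case True
  have "b $ i = 0" if b: "b \<in> critical_set \<omega> I" for b
  proof -
    obtain x where x: "x \<in> torus" "complex_relation \<omega> (b * (\<chi> i. laurent_monomial x (\<omega> i)))" (is "complex_relation _ ?c")
      using critical_set_relation[OF b] by blast
    obtain B u g where u: "\<forall>b\<in>(B :: complex set). u b \<in> int_relations \<omega> {i. ?c $ i \<noteq> 0}"
      and c: "\<forall>i. ?c $ i = (\<Sum>b\<in>B. g b * of_int (u b $ i))"
      using complex_relation_decomp[OF x(2)] by blast
    have "{i. ?c $ i \<noteq> 0} \<subseteq> I" using b by (auto simp: critical_set_def coeff_space_def)
    then have "u y $ i = 0" if "y \<in> B" for y using zero u that int_relations_mono by blast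
    then have "?c $ i = 0" using c by simp
    then show ?thesis using x(1) by simp
  qed
  then have "variable i \<in> vanishing_ideal I (critical_set \<omega> I)"
    using variable_poly_ring[OF i] by (simp add: vanishing_ideal_def)
  then have "b $ i = 0" if "b \<in> discriminant_variety \<omega> I" for b
    using that unfolding discriminant_variety_eq zariski_closure_def by force
  then have "discriminant_variety \<omega> I = {a \<in> coeff_space I. a $ i = 0}"
    using hypersurface_in_coordinate_hyperplane[OF True i] by blast
  then have "poly_eval (discriminant \<omega> I) a = 0 \<longleftrightarrow> poly_eval (variable i) a = 0"
    unfolding discriminant_def using True vanishing_ideal_coordinate_hyperplane[OF i] variable_poly_ring[OF i]
    by (simp only: if_True) (intro defining_equation_zero_iff, auto)
  then show ?thesis using a by (simp add: torus_def)
qed (simp add: discriminant_def)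

text \<open>The equation a^u = e^u, which holds on the T_M-orbit of e for a relation u, cleared of
  denominators.\<close>

definition relation_binomial_poly :: "complex ^ 'n::finite \<Rightarrow> int ^ 'n \<Rightarrow> 'n cpoly" where
  "relation_binomial_poly e u = Poly_Mapping.single (positive_part u) 1 -
     Poly_Mapping.single (positive_part (- u)) (laurent_monomial e u)"

lemma poly_eval_relation_binomial_poly:
  "poly_eval (relation_binomial_poly e u) a = laurent_monomial a (exponent (positive_part u)) -
     laurent_monomial e u * laurent_monomial a (exponent (positive_part (- u)))"
  by (simp add: relation_binomial_poly_def poly_eval_diff)

lemma poly_eval_relation_binomial_poly_eq_0_iff:
  assumes "a \<in> torus"
  shows "poly_eval (relation_binomial_poly e u) a = 0 \<longleftrightarrow> laurent_monomial a u = laurent_monomial e u"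
proof -
  have "laurent_monomial a u =
      laurent_monomial a (exponent (positive_part u)) / laurent_monomial a (exponent (positive_part (- u)))"
    using laurent_monomial_diff[OF assms] exponent_positive_part by metis
  then show ?thesis using assms by (simp add: poly_eval_relation_binomial_poly nonzero_divide_eq_eq)
qed

lemma relation_binomial_poly_ring:
  assumes "u \<in> int_relations \<omega> I"
  shows "relation_binomial_poly e u \<in> poly_ring I"
proof -
  have "i \<in> I" if "u $ i \<noteq> 0" for i using assms that by (auto simp: int_relations_def)
  then have "Poly_Mapping.keys (positive_part u) \<subseteq> I" "Poly_Mapping.keys (positive_part (- u)) \<subseteq> I"
    by (force simp: in_keys_iff)+
  then show ?thesis unfolding relation_binomial_poly_def by (intro poly_ring_diff poly_ring_single disjI2)
qed

text \<open>A critical f differs from a relation by a point t of T_M. The binomial vanishes on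
  relations by quasi-symmetry, and t^u = 1 means that t scales both of its monomials by the same
  factor.\<close>

lemma relation_binomial_vanishing:
  fixes \<omega> :: "'n::finite \<Rightarrow> int ^ 'd::finite"
  assumes w: "is_weights \<beta>" and qs: "quasi_symmetric \<beta>" and rays: "rays_of \<beta> \<omega>"
    and e: "complex_relation \<omega> e" and u: "u \<in> int_relations \<omega> I"
    and supp: "\<And>i. u $ i \<noteq> 0 \<Longrightarrow> e $ i \<noteq> 0"
  shows "relation_binomial_poly e u \<in> vanishing_ideal I (critical_set \<omega> I)"
proof -
  have "poly_eval (relation_binomial_poly e u) a = 0" if a: "a \<in> critical_set \<omega> I" for a
  proof -
    obtain x where x: "x \<in> torus" "complex_relation \<omega> (a * (\<chi> i. laurent_monomial x (\<omega> i)))"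
      using critical_set_relation[OF a] by blast
    let ?t = "\<chi> i. laurent_monomial x (\<omega> i)"
    have t: "?t \<in> torus" using x(1) by (simp add: torus_def)
    have "laurent_monomial ?t u = 1"
      using u x(1) by (simp add: laurent_monomial_ray_map int_relations_def)
    then have "laurent_monomial ?t (exponent (positive_part u)) / laurent_monomial ?t (exponent (positive_part (- u))) = 1"
      using laurent_monomial_diff[OF t] exponent_positive_part by metis
    then have eq: "laurent_monomial ?t (exponent (positive_part u)) = laurent_monomial ?t (exponent (positive_part (- u)))"
      by simp
    have nz: "laurent_monomial ?t (exponent (positive_part (- u))) \<noteq> 0" using t by simp
    have u': "u \<in> int_relations \<omega> UNIV" using u int_relations_mono by blast
    have "laurent_monomial (a * ?t) (exponent (positive_part u)) =
        laurent_monomial e u * laurent_monomial (a * ?t) (exponent (positive_part (- u)))"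
      by (rule relation_binomial[OF w qs rays x(2) e u' supp])
    then show ?thesis
      using nz by (simp add: laurent_monomial_mult eq poly_eval_relation_binomial_poly)
  qed
  then show ?thesis using relation_binomial_poly_ring[OF u] by (simp add: vanishing_ideal_def)
qed

text \<open>A direction \<theta> separates the exponents of the supposed equation p, and a nonzero
  relation v is orthogonal to it. For every b in the torus, the translate by b of the subgroup meets
  the zeros of p, where a^v = e^v; as v is orthogonal to \<theta>, this says b^v = e^v for all b,
  which is absurd.\<close>

lemma discriminant_not_hypersurface:
  fixes \<omega> :: "'n::finite \<Rightarrow> int ^ 'd::finite"
  assumes w: "is_weights \<beta>" and qs: "quasi_symmetric \<beta>" and rays: "rays_of \<beta> \<omega>"
    and ne: "I \<noteq> {}" and supp: "\<And>i. i \<in> I \<Longrightarrow> \<exists>u\<in>int_relations \<omega> I. u $ i \<noteq> 0"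
    and dim: "dim (linear_relations \<omega> I) \<noteq> 1"
  shows "\<not> is_hypersurface I (discriminant_variety \<omega> I)"
proof
  assume "is_hypersurface I (discriminant_variety \<omega> I)"
  then obtain p where p: "p \<in> poly_ring I" "\<not> Poly_Mapping.keys p \<subseteq> {0}"
    and Z: "discriminant_variety \<omega> I = {a \<in> coeff_space I. poly_eval p a = 0}"
    unfolding is_hypersurface_def by blast
  obtain e0 where e0: "e0 \<in> int_relations \<omega> I" "\<And>i. i \<in> I \<Longrightarrow> e0 $ i \<noteq> 0"
    using full_support_relation[OF supp] by metis
  define e :: "complex ^ 'n" where "e = of_int_vec e0"
  have e: "complex_relation \<omega> e" "e \<in> coeff_space I" "\<And>i. i \<in> I \<Longrightarrow> e $ i \<noteq> 0"
    using e0 complex_relation_of_int_vec[OF e0(1)] by (auto simp: e_def coeff_space_def int_relations_def)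
  have one: "(1 :: complex ^ 'd) \<in> torus" "(1 :: complex ^ 'n) \<in> torus" by (simp_all add: torus_def)
  \<comment> \<open>The relation e is itself critical, with critical point 1.\<close>
  have "e * (\<chi> i. laurent_monomial 1 (\<omega> i)) \<in> critical_set \<omega> I"
    by (rule relation_critical_set[OF e(1,2) one(1)])
  moreover have "e * (\<chi> i. laurent_monomial 1 (\<omega> i)) = e"
    by (simp add: vec_eq_iff laurent_monomial_def)
  ultimately have "e \<in> discriminant_variety \<omega> I"
    unfolding discriminant_variety_eq using subset_zariski_closure[OF critical_set_coeff_space] by auto
  \<comment> \<open>p sees only the variables in I; with ones elsewhere e becomes a torus point,
    where a monomial could not vanish. So p has at least two terms.\<close>
  then have pe: "poly_eval p (restrict_vec I 1 e) = 0"
    using Z poly_eval_restrict_vec[OF p(1)] by simp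
  have et: "restrict_vec I 1 e \<in> torus" using e(3) by (simp add: torus_def)
  have "\<not> Poly_Mapping.keys p = {m}" for m
  proof
    assume "Poly_Mapping.keys p = {m}"
    then show False using pe et in_keys_iff[of m p] by (simp add: poly_eval_keys)
  qed
  moreover have "Poly_Mapping.keys p \<noteq> {}" using p(2) by auto
  ultimately obtain m1 m2 where m: "m1 \<in> Poly_Mapping.keys p" "m2 \<in> Poly_Mapping.keys p" "m1 \<noteq> m2"
    by (metis is_singletonI' is_singleton_def)
  obtain \<theta> where \<theta>: "inj_on (int_dot \<theta>) (exponent ` Poly_Mapping.keys p)"
    using generic_int_vector[of "{}" "exponent ` Poly_Mapping.keys p"] by auto
  have "e0 \<noteq> 0" using ne e0(2) by auto
  then obtain v where v: "v \<in> int_relations \<omega> I" "v \<noteq> 0" "int_dot \<theta> v = 0"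
    using orthogonal_int_relation[OF dim e0(1)] by blast
  have vI: "v $ i \<noteq> 0 \<Longrightarrow> i \<in> I" for i using v(1) by (auto simp: int_relations_def)
  have const: "laurent_monomial b v = laurent_monomial e v" if b: "b \<in> torus" for b
  proof -
    obtain s where s: "s \<noteq> 0" "poly_eval p (b * one_parameter s \<theta>) = 0"
      using poly_has_zero_on_one_parameter[OF \<theta> b m] by blast
    let ?a = "b * one_parameter s \<theta>"
    have a: "?a \<in> torus" by (intro torus_mult b one_parameter_torus s)
    have "restrict_vec I 0 ?a \<in> discriminant_variety \<omega> I"
      using s(2) by (simp add: Z poly_eval_restrict_vec[OF p(1)])
    moreover have rb: "relation_binomial_poly e v \<in> vanishing_ideal I (critical_set \<omega> I)"
      by (rule relation_binomial_vanishing[OF w qs rays e(1) v(1)]) (use vI e(3) in blast)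
    ultimately have "poly_eval (relation_binomial_poly e v) (restrict_vec I 0 ?a) = 0"
      unfolding discriminant_variety_eq zariski_closure_def by blast
    then have "poly_eval (relation_binomial_poly e v) ?a = 0"
      using poly_eval_restrict_vec relation_binomial_poly_ring[OF v(1)] by metis
    then have "laurent_monomial ?a v = laurent_monomial e v"
      using poly_eval_relation_binomial_poly_eq_0_iff[OF a] by blast
    then show ?thesis
      using s(1) v(3) by (simp add: laurent_monomial_mult laurent_monomial_one_parameter)
  qed
  \<comment> \<open>b = 1 gives e^v = 1; the point with coordinates 2^v_i then gives 2 to the power
    \<open>int_dot v v\<close> equal to 1.\<close>
  have "laurent_monomial e v = 1" using const[OF one(2)] by (simp add: laurent_monomial_def)
  then have "2 powi int_dot v v = (1 :: complex)"
    using const[OF one_parameter_torus[of 2 v]] by (simp add: laurent_monomial_one_parameter)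
  then have "int_dot v v = 0" by (rule power_int_2_eq_1)
  moreover have "int_dot v v > 0"
  proof -
    obtain i where "v $ i \<noteq> 0" using v(2) by (auto simp: vec_eq_iff)
    then show ?thesis unfolding int_dot_def by (intro sum_pos2[of _ i]) (auto simp: zero_less_mult_iff)
  qed
  ultimately show False by simp
qed

lemma lookup_exponent_add:
  "exponent m = exponent m' + v \<Longrightarrow> int (Poly_Mapping.lookup m i) = int (Poly_Mapping.lookup m' i) + v $ i"
  by (metis exponent_nth vector_add_component)

text \<open>Telescoping: a step from m' to m' + u exchanges the negative part of u for its positive
  part, and modulo the binomial this is multiplication by e^u.\<close>

lemma monomial_difference_in_ideal:
  fixes u :: "int ^ 'n::finite"
  assumes "Poly_Mapping.keys m' \<subseteq> I" "exponent m = exponent m' + int k *s u" "Poly_Mapping.keys m \<subseteq> I"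
  shows "\<exists>h\<in>poly_ring I. Poly_Mapping.single m 1 - Poly_Mapping.single m' (laurent_monomial e u ^ k) =
    relation_binomial_poly e u * h"
  using assms
proof (induction k arbitrary: m')
  case 0
  then have "exponent m = exponent m'" by simp
  then have "m = m'" by simp
  then show ?case by (intro bexI[of _ 0]) (auto simp: poly_ring_def)
next
  case (Suc k)
  define r where "r = m' - positive_part (- u)"
  define m'' where "m'' = r + positive_part u"
  \<comment> \<open>Where u is negative, the endpoint m of all the steps is still nonnegative, so m'
    has room for a single step.\<close>
  have le: "nat (- u $ i) \<le> Poly_Mapping.lookup m' i" for i
  proof (cases "u $ i \<ge> 0")
    case False
    have "int (Poly_Mapping.lookup m i) = int (Poly_Mapping.lookup m' i) + int (Suc k) * u $ i"
      using lookup_exponent_add[OF Suc.prems(2), of i] by (simp only: vector_smult_component)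
    moreover have "int (Suc k) * u $ i \<le> u $ i"
      using False by (simp add: algebra_simps mult_nonneg_nonpos)
    ultimately have "int (Poly_Mapping.lookup m' i) + u $ i \<ge> 0" by linarith
    then show ?thesis by linarith
  qed simp
  have m': "m' = r + positive_part (- u)"
    unfolding r_def using le by (intro poly_mapping_eqI) (simp add: lookup_add lookup_minus)
  have m'': "exponent m'' = exponent m' + u"
    unfolding m''_def m' by (simp add: exponent_add vec_eq_iff)
  have "int (Suc k) *s u = u + int k *s u" by (simp add: vec_eq_iff algebra_simps)
  then have mk: "exponent m = exponent m'' + int k *s u" using Suc.prems(2) m'' by simp
  have r: "Poly_Mapping.keys r \<subseteq> I"
    using Suc.prems(1) unfolding r_def by (auto simp: in_keys_iff lookup_minus subset_iff)
  have "Poly_Mapping.keys m'' \<subseteq> I"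
  proof
    fix i assume "i \<in> Poly_Mapping.keys m''"
    then have nz: "Poly_Mapping.lookup m'' i \<noteq> 0" by (simp add: in_keys_iff)
    show "i \<in> I"
    proof (rule ccontr)
      assume "i \<notin> I"
      then have "Poly_Mapping.lookup m i = 0" "Poly_Mapping.lookup m' i = 0"
        using Suc.prems(1,3) by (auto simp: in_keys_iff subset_iff)
      then have "int (Suc k) * u $ i = 0"
        using lookup_exponent_add[OF Suc.prems(2), of i] by (simp only: vector_smult_component)
      then have "u $ i = 0" by (simp only: mult_eq_0_iff of_nat_eq_0_iff nat.distinct simp_thms)
      then show False using nz lookup_exponent_add[OF m'', of i] \<open>Poly_Mapping.lookup m' i = 0\<close> by simp
    qed
  qed
  from Suc.IH[OF this mk Suc.prems(3)] obtain h where h: "h \<in> poly_ring I"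
    "Poly_Mapping.single m 1 - Poly_Mapping.single m'' (laurent_monomial e u ^ k) = relation_binomial_poly e u * h"
    by blast
  let ?h = "h + Poly_Mapping.single r (laurent_monomial e u ^ k)"
  have "relation_binomial_poly e u * Poly_Mapping.single r (laurent_monomial e u ^ k) =
      Poly_Mapping.single m'' (laurent_monomial e u ^ k) - Poly_Mapping.single m' (laurent_monomial e u ^ Suc k)"
    unfolding relation_binomial_poly_def left_diff_distrib mult_single m''_def m'
    by (simp add: add.commute)
  then have "relation_binomial_poly e u * ?h =
      Poly_Mapping.single m 1 - Poly_Mapping.single m' (laurent_monomial e u ^ Suc k)"
    unfolding distrib_left h(2)[symmetric] by simp
  moreover have "?h \<in> poly_ring I" using h(1) r by (intro poly_ring_add poly_ring_single disjI2)
  ultimately show ?case by metis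
qed

text \<open>The sign of k is free here: for negative k the roles of m and m' are exchanged and the
  result is rescaled, which needs e^u to be invertible.\<close>

lemma monomial_relation_in_ideal:
  fixes u :: "int ^ 'n::finite"
  assumes m: "Poly_Mapping.keys m \<subseteq> I" "Poly_Mapping.keys m' \<subseteq> I" "exponent m - exponent m' = k *s u"
    and nz: "laurent_monomial e u \<noteq> 0"
  shows "\<exists>c. \<exists>h\<in>poly_ring I. Poly_Mapping.single m 1 - Poly_Mapping.single m' c = relation_binomial_poly e u * h"
proof (cases "k \<ge> 0")
  case True
  then have "exponent m = exponent m' + int (nat k) *s u"
    using m(3) by (metis add.commute diff_add_cancel nat_0_le)
  then show ?thesis using monomial_difference_in_ideal[OF m(2) _ m(1)] by blast
next
  case False
  let ?k = "nat (- k)"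
  have "int ?k *s u = - (exponent m - exponent m')"
    using False unfolding m(3) by (simp add: vec_eq_iff)
  then have "exponent m' = exponent m + int ?k *s u" by simp
  then obtain h where h: "h \<in> poly_ring I"
    "Poly_Mapping.single m' 1 - Poly_Mapping.single m (laurent_monomial e u ^ ?k) = relation_binomial_poly e u * h"
    using monomial_difference_in_ideal[OF m(1) _ m(2)] by blast
  define z where "z = laurent_monomial e u ^ ?k"
  have z: "z \<noteq> 0" using nz by (simp add: z_def)
  let ?h = "h * Poly_Mapping.single 0 (- 1 / z)"
  have "relation_binomial_poly e u * ?h =
      (Poly_Mapping.single m' 1 - Poly_Mapping.single m z) * Poly_Mapping.single 0 (- 1 / z)"
    unfolding z_def h(2) by (simp add: mult.assoc)
  also have "\<dots> = Poly_Mapping.single m 1 - Poly_Mapping.single m' (1 / z)"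
    unfolding left_diff_distrib mult_single using z by (simp add: single_uminus)
  finally have "Poly_Mapping.single m 1 - Poly_Mapping.single m' (1 / z) = relation_binomial_poly e u * ?h" ..
  moreover have "?h \<in> poly_ring I" using h(1) by (intro poly_ring_mult poly_ring_single) auto
  ultimately show ?thesis by blast
qed

text \<open>The homogeneous parts, for the grading by \<open>N\<close>, of a polynomial that vanishes at all critical \<open>f\<close>
  also vanish there, so none of them is a monomial; and two monomials of the same degree differ by a multiple of the circuit relation. Subtracting multiples of
  the binomial therefore removes its monomials one by one.\<close>

lemma vanishing_ideal_circuit:
  fixes \<omega> :: "'n::finite \<Rightarrow> int ^ 'd::finite"
  assumes w: "is_weights \<beta>" and qs: "quasi_symmetric \<beta>" and rays: "rays_of \<beta> \<omega>"
    and u: "u \<in> int_relations \<omega> I" and full: "\<And>i. i \<in> I \<Longrightarrow> u $ i \<noteq> 0"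
    and gen: "\<And>v. v \<in> int_relations \<omega> I \<Longrightarrow> \<exists>k. v = k *s u"
  shows "vanishing_ideal I (critical_set \<omega> I) =
    {relation_binomial_poly (of_int_vec u) u * q | q. q \<in> poly_ring I}"
proof -
  define e :: "complex ^ 'n" where "e = of_int_vec u"
  define f where "f = relation_binomial_poly e u"
  have e: "complex_relation \<omega> e" "e \<in> coeff_space I" "\<And>i. i \<in> I \<Longrightarrow> e $ i \<noteq> 0"
    using u full complex_relation_of_int_vec[OF u] by (auto simp: e_def coeff_space_def int_relations_def)
  have f: "f \<in> vanishing_ideal I (critical_set \<omega> I)"
    unfolding f_def by (rule relation_binomial_vanishing[OF w qs rays e(1) u]) (simp add: e_def)
  then have fI: "f \<in> poly_ring I" by (simp add: vanishing_ideal_def)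
  have mult: "f * h \<in> vanishing_ideal I (critical_set \<omega> I)" if "h \<in> poly_ring I" for h
    using f that by (auto simp: vanishing_ideal_def poly_eval_mult poly_ring_mult)
  have e_nz: "laurent_monomial e v \<noteq> 0" if "\<And>i. v $ i \<noteq> 0 \<Longrightarrow> i \<in> I" for v
    using that e(3) unfolding laurent_monomial_def by (force simp: prod_zero_iff)
  have "\<exists>h\<in>poly_ring I. q = f * h" if "q \<in> vanishing_ideal I (critical_set \<omega> I)" for q
    using that
  proof (induction "card (Poly_Mapping.keys q)" arbitrary: q rule: less_induct)
    case less
    have qI: "q \<in> poly_ring I" using less.prems by (simp add: vanishing_ideal_def)
    show ?case
    proof (cases "q = 0")
      case True
      then show ?thesis by (intro bexI[of _ 0]) (auto simp: poly_ring_def)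
    next
      case False
      then obtain m where m: "m \<in> Poly_Mapping.keys q" by (metis all_not_in_conv keys_eq_empty)
      have keysI: "Poly_Mapping.keys m \<subseteq> I" if "m \<in> Poly_Mapping.keys q" for m
        using qI that by (simp add: poly_ring_def)
      have e_nz': "laurent_monomial e (exponent m) \<noteq> 0" if "m \<in> Poly_Mapping.keys q" for m
        using keysI[OF that] by (intro e_nz) (auto simp: in_keys_iff subset_iff)
      let ?deg = "\<lambda>m. ray_map \<omega> (exponent m)"
      \<comment> \<open>\<open>\<theta>\<close> separates the degrees in N that occur in q; when e
        moves along this one-parameter subgroup of T_M, the power of s records the degree.\<close>
      obtain \<theta> where \<theta>: "inj_on (int_dot \<theta>) (?deg ` Poly_Mapping.keys q)"
        using generic_int_vector[of "{}" "?deg ` Poly_Mapping.keys q"] by auto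
      let ?g = "\<lambda>m. Poly_Mapping.lookup q m * laurent_monomial e (exponent m)"
      have zero: "(\<Sum>m\<in>Poly_Mapping.keys q. ?g m * s powi int_dot \<theta> (?deg m)) = 0" if s: "s \<noteq> 0" for s
      proof -
        have x: "one_parameter s \<theta> \<in> torus" by (rule one_parameter_torus[OF s])
        \<comment> \<open>All translates of e by T_M are critical, so q vanishes along this
          curve.\<close>
        have "poly_eval q (e * (\<chi> i. laurent_monomial (one_parameter s \<theta>) (\<omega> i))) = 0"
          using less.prems relation_critical_set[OF e(1,2) x] unfolding vanishing_ideal_def by blast
        then have "(\<Sum>m\<in>Poly_Mapping.keys q. Poly_Mapping.lookup q m *
            (laurent_monomial e (exponent m) * laurent_monomial (one_parameter s \<theta>) (?deg m))) = 0"
          unfolding poly_eval_keys laurent_monomial_mult laurent_monomial_ray_map[OF x] .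
        then show ?thesis unfolding laurent_monomial_one_parameter[OF s] by (simp only: mult.assoc)
      qed
      have "\<exists>m'\<in>Poly_Mapping.keys q. m' \<noteq> m \<and> ?deg m' = ?deg m"
      proof (rule ccontr)
        assume no: "\<not> ?thesis"
        \<comment> \<open>A term alone in its degree would be the whole homogeneous part, which
          vanishes at e; but e has full support on I, so e^m is nonzero.\<close>
        have "{m' \<in> Poly_Mapping.keys q. int_dot \<theta> (?deg m') = int_dot \<theta> (?deg m)} = {m}"
          using no m \<theta> by (auto dest: inj_onD)
        with exp_sum_zero[OF finite_keys zero, of "int_dot \<theta> (?deg m)"]
        have "?g m = 0" by simp
        then show False using m e_nz'[OF m] by (simp add: in_keys_iff)
      qed
      then obtain m' where m': "m' \<in> Poly_Mapping.keys q" "m' \<noteq> m" "?deg m' = ?deg m" by blast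
      have "exponent m - exponent m' \<in> int_relations \<omega> I"
        using m'(3) keysI[OF m] keysI[OF m'(1)]
        by (auto simp: int_relations_def ray_map_diff in_keys_iff subset_iff) (metis gr0I)
      then obtain k where "exponent m - exponent m' = k *s u" using gen by blast
      then obtain c h where h: "h \<in> poly_ring I" "Poly_Mapping.single m 1 - Poly_Mapping.single m' c = f * h"
        using monomial_relation_in_ideal[OF keysI[OF m] keysI[OF m'(1)], of k u e] e_nz[of u] u
        unfolding f_def int_relations_def by blast
      define a where "a = Poly_Mapping.lookup q m"
      let ?h = "h * Poly_Mapping.single 0 a"
      have hI: "?h \<in> poly_ring I" using h(1) by (intro poly_ring_mult poly_ring_single) auto
      have fh: "f * ?h = Poly_Mapping.single m a - Poly_Mapping.single m' (c * a)"
        unfolding mult.assoc[symmetric] h(2)[symmetric] left_diff_distrib mult_single by simp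
      \<comment> \<open>The subtraction cancels m and otherwise only changes the coefficient at m',
        which already occurs; the number of terms drops.\<close>
      let ?q = "q - f * ?h"
      have "?q \<in> vanishing_ideal I (critical_set \<omega> I)"
        using less.prems mult[OF hI] by (simp add: vanishing_ideal_def poly_eval_diff poly_ring_diff)
      moreover have "Poly_Mapping.keys ?q \<subseteq> Poly_Mapping.keys q - {m}"
        unfolding fh using m m' by (auto simp: in_keys_iff lookup_minus lookup_single when_def a_def split: if_splits)
      then have "card (Poly_Mapping.keys ?q) < card (Poly_Mapping.keys q)"
        using m by (intro psubset_card_mono) auto
      ultimately obtain h' where h': "h' \<in> poly_ring I" "?q = f * h'" using less.hyps by blast
      have "q = f * (h' + ?h)" using h'(2) by (simp add: distrib_left algebra_simps)
      moreover have "h' + ?h \<in> poly_ring I" using h'(1) hI by (rule poly_ring_add)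
      ultimately show ?thesis by blast
    qed
  qed
  then show ?thesis using mult unfolding f_def e_def by blast
qed

lemma discriminant_not_circuit:
  fixes \<omega> :: "'n::finite \<Rightarrow> int ^ 'd::finite"
  assumes w: "is_weights \<beta>" and qs: "quasi_symmetric \<beta>" and rays: "rays_of \<beta> \<omega>"
    and "I \<noteq> {}" and "dim (linear_relations \<omega> I) \<noteq> 1" and "a \<in> torus"
  shows "poly_eval (discriminant \<omega> I) a \<noteq> 0"
proof (cases "\<exists>i\<in>I. \<forall>u\<in>int_relations \<omega> I. u $ i = 0")
  case True
  then show ?thesis using discriminant_unsupported assms(6) by blast
next
  case False
  then have "\<not> is_hypersurface I (discriminant_variety \<omega> I)"
    using assms by (intro discriminant_not_hypersurface) auto
  then show ?thesis by (simp add: discriminant_def)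
qed

text \<open>Rank one allows rays of the face whose coefficient in the relation is zero; then, or if
  the variety is no hypersurface, there are no zeros in the torus. Otherwise the ideal is generated
  by the binomial of a generator u of the relations.\<close>

lemma discriminant_circuit:
  fixes \<omega> :: "'n::finite \<Rightarrow> int ^ 'd::finite"
  assumes w: "is_weights \<beta>" and qs: "quasi_symmetric \<beta>" and rays: "rays_of \<beta> \<omega>"
    and dim: "dim (linear_relations \<omega> I) = 1"
  shows "(\<forall>a\<in>torus. poly_eval (discriminant \<omega> I) a \<noteq> 0) \<or>
    (\<exists>u c. ray_map \<omega> u = 0 \<and> u \<noteq> 0 \<and> c \<noteq> 0 \<and>
      (\<forall>a\<in>torus. poly_eval (discriminant \<omega> I) a = 0 \<longleftrightarrow> laurent_monomial a u = c))"
proof (cases "(\<exists>i\<in>I. \<forall>u\<in>int_relations \<omega> I. u $ i = 0) \<or> \<not> is_hypersurface I (discriminant_variety \<omega> I)")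
  case True
  then show ?thesis using discriminant_unsupported[of _ I \<omega>] by (auto simp: discriminant_def)
next
  case False
  obtain u where u: "u \<in> int_relations \<omega> I" "u \<noteq> 0" "\<And>v. v \<in> int_relations \<omega> I \<Longrightarrow> \<exists>k. v = k *s u"
    using int_relations_generator[OF dim] by blast
  have full: "u $ i \<noteq> 0" if "i \<in> I" for i
    using False that u(3) by (metis mult_zero_right vector_smult_component)
  let ?e = "of_int_vec u :: complex ^ 'n"
  let ?f = "relation_binomial_poly ?e u"
  have "vanishing_ideal I (discriminant_variety \<omega> I) = {?f * q | q. q \<in> poly_ring I}"
    unfolding discriminant_variety_eq vanishing_ideal_zariski_closure[OF critical_set_coeff_space]
    by (rule vanishing_ideal_circuit[OF w qs rays u(1) full u(3)])
  then have "poly_eval (discriminant \<omega> I) a = 0 \<longleftrightarrow> poly_eval ?f a = 0" for a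
    using False defining_equation_zero_iff[OF relation_binomial_poly_ring[OF u(1)]]
    by (simp add: discriminant_def)
  then have "\<forall>a\<in>torus. poly_eval (discriminant \<omega> I) a = 0 \<longleftrightarrow> laurent_monomial a u = laurent_monomial ?e u"
    using poly_eval_relation_binomial_poly_eq_0_iff by blast
  moreover have "laurent_monomial ?e u \<noteq> 0"
    unfolding laurent_monomial_def by (auto simp: prod_zero_iff)
  moreover have "ray_map \<omega> u = 0" using u(1) by (simp add: int_relations_def)
  ultimately show ?thesis using u(2) by blast
qed

subsection \<open>Faces\<close>

lemma real_ray_nth [simp]: "real_ray \<omega> i $ j = of_int (\<omega> i $ j)"
  by (simp add: real_ray_def)

lemma span_image_eq_sum:
  fixes f :: "'i \<Rightarrow> 'a::real_vector"
  assumes "finite I"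
  shows "span (f ` I) = {\<Sum>i\<in>I. c i *\<^sub>R f i | c. True}" (is "_ = ?R")
proof
  show "span (f ` I) \<subseteq> ?R"
  proof (rule span_minimal)
    show "f ` I \<subseteq> ?R"
    proof
      fix x assume "x \<in> f ` I"
      then obtain i where "i \<in> I" "x = f i" by blast
      then have "x = (\<Sum>k\<in>I. (if k = i then 1 else 0) *\<^sub>R f k)"
        using assms by (simp add: if_distrib[of "\<lambda>y. y *\<^sub>R _"] cong: if_cong)
      then show "x \<in> ?R" by (intro CollectI exI[of _ "\<lambda>k. if k = i then 1 else 0"]) simp
    qed
    show "subspace ?R"
    proof (intro subspaceI)
      show "0 \<in> ?R" by (intro CollectI exI[of _ "\<lambda>_. 0"]) simp
    next
      fix x y assume "x \<in> ?R" "y \<in> ?R"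
      then obtain c d where "x = (\<Sum>i\<in>I. c i *\<^sub>R f i)" "y = (\<Sum>i\<in>I. d i *\<^sub>R f i)" by blast
      then show "x + y \<in> ?R"
        by (intro CollectI exI[of _ "\<lambda>i. c i + d i"]) (simp add: scaleR_add_left sum.distrib)
    next
      fix k x assume "x \<in> ?R"
      then obtain c where "x = (\<Sum>i\<in>I. c i *\<^sub>R f i)" by blast
      then show "k *\<^sub>R x \<in> ?R"
        by (intro CollectI exI[of _ "\<lambda>i. k * c i"]) (simp add: scaleR_sum_right)
    qed
  qed
  show "?R \<subseteq> span (f ` I)"
    by (clarify, intro span_sum span_mul span_base imageI)
qed

text \<open>The sum of the coordinates is zero on ker A, so it descends to a functional on N; its
  values on the basis are read off from lifts \<open>c j\<close>.\<close>

lemma calabi_yau_functional: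
  fixes \<omega> :: "'n::finite \<Rightarrow> int ^ 'd::finite"
  assumes w: "is_weights \<beta>" and qs: "quasi_symmetric \<beta>" and rays: "rays_of \<beta> \<omega>"
  obtains m :: "real ^ 'd" where "\<And>i. m \<bullet> real_ray \<omega> i = 1"
proof -
  have sum0: "(\<Sum>i\<in>UNIV. c $ i) = 0" if c: "ray_map \<omega> c = 0" for c
  proof -
    obtain l where l: "c = dual_weight_map \<beta> l" using c rays unfolding rays_of_def by blast
    \<comment> \<open>With constant base 2 the product identity says that 2 to the power of the sum
      of all weights at l is 1.\<close>
    have "(\<Prod>i\<in>UNIV. (2 :: complex) powi \<beta> i l) = 1" by (rule quasi_symmetric_prod[OF w qs]) auto
    then have "(2 :: complex) powi (\<Sum>i\<in>UNIV. \<beta> i l) = 1" by (simp add: power_int_sum)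
    then show ?thesis using power_int_2_eq_1 by (simp add: l dual_weight_map_def)
  qed
  have "\<exists>c. ray_map \<omega> c = axis j 1" for j using rays unfolding rays_of_def by (metis surjD)
  then obtain c where c: "\<And>j. ray_map \<omega> (c j) = axis j 1" by metis
  define m :: "real ^ 'd" where "m = (\<chi> j. of_int (\<Sum>i\<in>UNIV. c j $ i))"
  have "m \<bullet> real_ray \<omega> i = 1" for i
  proof -
    have rs: "ray_map \<omega> (\<Sum>j\<in>A. f j) = (\<Sum>j\<in>A. ray_map \<omega> (f j))" if "finite A" for A :: "'d set" and f
      using that by (induction A rule: finite_induct) (simp_all add: ray_map_add, simp add: ray_map_def)
    \<comment> \<open>The difference of two lifts of \<open>\<omega> i\<close> under A, hence a
      relation, with coordinate sum zero.\<close>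
    let ?u = "(\<Sum>j\<in>UNIV. \<omega> i $ j *s c j) - axis i 1"
    have "ray_map \<omega> (axis i 1) = \<omega> i"
      by (simp add: vec_eq_iff ray_map_nth axis_def if_distrib[of "\<lambda>x. x * _"] cong: if_cong)
    moreover have "(\<Sum>j\<in>UNIV. \<omega> i $ j *s axis j 1) = \<omega> i"
      by (simp add: vec_eq_iff axis_def if_distrib[of "\<lambda>x. _ * x"] cong: if_cong)
    ultimately have "ray_map \<omega> ?u = 0" by (simp add: ray_map_diff rs ray_map_smult c)
    then have "(\<Sum>k\<in>UNIV. ?u $ k) = 0" by (rule sum0)
    then have "(\<Sum>k\<in>UNIV. \<Sum>j\<in>UNIV. \<omega> i $ j * c j $ k) = 1"
      by (simp add: sum_subtractf axis_def)
    then have "(\<Sum>j\<in>UNIV. \<omega> i $ j * (\<Sum>k\<in>UNIV. c j $ k)) = 1"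
      by (subst (asm) sum.swap) (simp add: sum_distrib_left)
    then have "real_of_int (\<Sum>j\<in>UNIV. \<omega> i $ j * (\<Sum>k\<in>UNIV. c j $ k)) = 1" by simp
    then show ?thesis by (simp add: m_def inner_vec_def mult.commute)
  qed
  then show thesis using that by blast
qed

text \<open>The affine functional of an exposed face becomes linear: as m is 1 on all rays, b - a
  \<bullet> x equals (b m - a) \<bullet> x there.\<close>

lemma face_supporting_functional:
  fixes \<omega> :: "'n::finite \<Rightarrow> int ^ 'd::finite"
  assumes w: "is_weights \<beta>" and qs: "quasi_symmetric \<beta>" and rays: "rays_of \<beta> \<omega>"
    and \<Gamma>: "\<Gamma> \<in> faces \<omega>"
  obtains h :: "real ^ 'd" where "\<And>i. i \<in> rays_in \<omega> \<Gamma> \<Longrightarrow> h \<bullet> real_ray \<omega> i = 0"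
    "\<And>i. i \<notin> rays_in \<omega> \<Gamma> \<Longrightarrow> h \<bullet> real_ray \<omega> i > 0"
proof -
  obtain m :: "real ^ 'd" where m: "\<And>i. m \<bullet> real_ray \<omega> i = 1"
    using calabi_yau_functional[OF w qs rays] by metis
  have "polyhedron (ray_polytope \<omega>)"
    unfolding ray_polytope_def by (intro polytope_imp_polyhedron polytope_convex_hull) simp
  then have "\<Gamma> exposed_face_of ray_polytope \<omega>"
    using \<Gamma> exposed_face_of_polyhedron by (auto simp: faces_def)
  then obtain a b where ab: "ray_polytope \<omega> \<subseteq> {x. a \<bullet> x \<le> b}" "\<Gamma> = ray_polytope \<omega> \<inter> {x. a \<bullet> x = b}"
    by (auto simp: exposed_face_of_def)
  have mem: "real_ray \<omega> i \<in> ray_polytope \<omega>" for i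
    unfolding ray_polytope_def by (intro hull_inc) simp
  have h: "(b *\<^sub>R m - a) \<bullet> real_ray \<omega> i = b - a \<bullet> real_ray \<omega> i" for i
    by (simp add: inner_diff_left m)
  show thesis
  proof (rule that[of "b *\<^sub>R m - a"])
    fix i assume "i \<in> rays_in \<omega> \<Gamma>"
    then show "(b *\<^sub>R m - a) \<bullet> real_ray \<omega> i = 0" unfolding h using ab(2) by (simp add: rays_in_def)
  next
    fix i assume i: "i \<notin> rays_in \<omega> \<Gamma>"
    have "a \<bullet> real_ray \<omega> i \<le> b" using mem[of i] ab(1) by blast
    moreover have "a \<bullet> real_ray \<omega> i \<noteq> b" using i mem[of i] ab(2) by (auto simp: rays_in_def)
    ultimately show "(b *\<^sub>R m - a) \<bullet> real_ray \<omega> i > 0" unfolding h by simp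
  qed
qed

lemma face_rays:
  assumes "\<Gamma> \<in> faces \<omega>"
  shows "rays_in \<omega> \<Gamma> \<noteq> {}" "span \<Gamma> = span (real_ray \<omega> ` rays_in \<omega> \<Gamma>)"
proof -
  have "\<Gamma> face_of convex hull (range (real_ray \<omega>))" and ne: "\<Gamma> \<noteq> {}"
    using assms by (auto simp: faces_def ray_polytope_def)
  moreover have "compact (range (real_ray \<omega>))" by (intro finite_imp_compact finite_imageI) simp
  ultimately obtain S where S: "S \<subseteq> range (real_ray \<omega>)" "\<Gamma> = convex hull S"
    using face_of_convex_hull_subset by metis
  have sub: "S \<subseteq> real_ray \<omega> ` rays_in \<omega> \<Gamma>"
  proof
    fix x assume x: "x \<in> S"
    then obtain i where i: "x = real_ray \<omega> i" using S(1) by blast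
    have "x \<in> \<Gamma>" using x S(2) hull_inc by metis
    then show "x \<in> real_ray \<omega> ` rays_in \<omega> \<Gamma>" using i by (simp add: rays_in_def)
  qed
  have "S \<noteq> {}" using S(2) ne by auto
  then show "rays_in \<omega> \<Gamma> \<noteq> {}" using sub by auto
  show "span \<Gamma> = span (real_ray \<omega> ` rays_in \<omega> \<Gamma>)"
  proof
    have "\<Gamma> \<subseteq> span (real_ray \<omega> ` rays_in \<omega> \<Gamma>)"
      unfolding S(2) by (intro hull_minimal subspace_imp_convex subspace_span)
        (use sub span_superset S(2) in blast)
    then show "span \<Gamma> \<subseteq> span (real_ray \<omega> ` rays_in \<omega> \<Gamma>)"
      by (intro span_minimal subspace_span)
    show "span (real_ray \<omega> ` rays_in \<omega> \<Gamma>) \<subseteq> span \<Gamma>"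
      by (intro span_mono) (auto simp: rays_in_def)
  qed
qed

subsection \<open>Multiplicities\<close>

lemma finite_bounded_integer_points:
  "finite {x \<in> (integer_points :: (real ^ 'd::finite) set). \<forall>j. \<bar>x $ j\<bar> \<le> R}"
proof (rule finite_subset)
  let ?S = "{z \<in> \<int>. - R \<le> z \<and> z \<le> R}"
  show "{x \<in> integer_points. \<forall>j. \<bar>x $ j\<bar> \<le> R} \<subseteq> (\<lambda>f. \<chi> j. f j) ` (PiE (UNIV :: 'd set) (\<lambda>_. ?S))"
  proof
    fix x :: "real ^ 'd" assume "x \<in> {x \<in> integer_points. \<forall>j. \<bar>x $ j\<bar> \<le> R}"
    then have "(\<lambda>j. x $ j) \<in> PiE UNIV (\<lambda>_. ?S)" by (auto simp: integer_points_def abs_le_iff minus_le_iff)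
    then show "x \<in> (\<lambda>f. \<chi> j. f j) ` (PiE (UNIV :: 'd set) (\<lambda>_. ?S))"
      by (intro image_eqI[of _ _ "\<lambda>j. x $ j"]) auto
  qed
  show "finite ((\<lambda>f. \<chi> j. f j) ` (PiE (UNIV :: 'd set) (\<lambda>_. ?S)))"
    by (intro finite_imageI finite_PiE finite_int_segment) auto
qed

lemma lattice_span_diff:
  assumes "x \<in> lattice_span \<omega> I" "y \<in> lattice_span \<omega> I"
  shows "x - y \<in> lattice_span \<omega> I"
proof -
  obtain c d where "x = (\<Sum>i\<in>I. of_int (c i) *\<^sub>R real_ray \<omega> i)" "y = (\<Sum>i\<in>I. of_int (d i) *\<^sub>R real_ray \<omega> i)"
    using assms unfolding lattice_span_def by blast
  then have "x - y = (\<Sum>i\<in>I. of_int (c i - d i) *\<^sub>R real_ray \<omega> i)"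
    by (simp add: sum_subtractf scaleR_diff_left)
  then show ?thesis unfolding lattice_span_def by (rule range_eqI[of _ _ "\<lambda>i. c i - d i"])
qed

lemma zero_lattice_span: "0 \<in> lattice_span \<omega> I"
  unfolding lattice_span_def by (intro range_eqI[of _ _ "\<lambda>_. 0"]) simp

lemma lattice_span_integer_points: "lattice_span \<omega> I \<subseteq> integer_points"
  unfolding lattice_span_def integer_points_def by (auto intro!: Ints_sum Ints_mult)

text \<open>\<open>card\<close> is zero for infinite sets, so finiteness of the index is the issue.
  Reducing coefficients to their fractional parts moves each lattice point into a bounded region,
  which contains only finitely many.\<close>

lemma face_index_pos:
  fixes \<omega> :: "'n::finite \<Rightarrow> int ^ 'd::finite"
  assumes "\<Gamma> \<in> faces \<omega>"
  shows "face_index \<omega> \<Gamma> > 0"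
proof -
  let ?I = "rays_in \<omega> \<Gamma>"
  let ?L = "lattice_span \<omega> ?I"
  let ?r = "{(x, y). x - y \<in> ?L}"
  let ?N = "integer_points \<inter> span \<Gamma>"
  define R where "R = (\<Sum>j\<in>UNIV. \<Sum>i\<in>?I. \<bar>real_ray \<omega> i $ j\<bar>)"
  let ?F = "{x \<in> (integer_points :: (real ^ 'd) set). \<forall>j. \<bar>x $ j\<bar> \<le> R}"
  have "\<exists>y\<in>?F. ?r `` {x} = ?r `` {y}" if x: "x \<in> ?N" for x
  proof -
    have "x \<in> span (real_ray \<omega> ` ?I)" using x face_rays(2)[OF assms] by auto
    then obtain c where c: "x = (\<Sum>i\<in>?I. c i *\<^sub>R real_ray \<omega> i)"
      using span_image_eq_sum[of ?I "real_ray \<omega>"] by auto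
    define z where "z = (\<Sum>i\<in>?I. of_int \<lfloor>c i\<rfloor> *\<^sub>R real_ray \<omega> i)"
    have z: "z \<in> ?L" unfolding z_def lattice_span_def by (intro range_eqI[of _ _ "\<lambda>i. \<lfloor>c i\<rfloor>"]) simp
    have xz: "x - z = (\<Sum>i\<in>?I. frac (c i) *\<^sub>R real_ray \<omega> i)"
      by (simp add: c z_def frac_def scaleR_diff_left sum_subtractf)
    have "\<bar>(x - z) $ j\<bar> \<le> R" for j
    proof -
      have "\<bar>(x - z) $ j\<bar> \<le> (\<Sum>i\<in>?I. \<bar>frac (c i) * real_ray \<omega> i $ j\<bar>)"
        unfolding xz sum_component vector_scaleR_component real_scaleR_def by (rule sum_abs)
      also have "\<dots> \<le> (\<Sum>i\<in>?I. \<bar>real_ray \<omega> i $ j\<bar>)"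
        by (intro sum_mono) (simp add: abs_mult mult_left_le_one_le frac_lt_1 less_imp_le)
      also have "\<dots> \<le> R"
        unfolding R_def by (rule member_le_sum) (auto intro: sum_nonneg)
      finally show ?thesis .
    qed
    moreover have "x - z \<in> integer_points"
      using x z lattice_span_integer_points[of \<omega> ?I] by (auto simp: integer_points_def)
    ultimately have "x - z \<in> ?F" by blast
    moreover have "?r `` {x} = ?r `` {x - z}"
    proof (intro equalityI subsetI)
      fix y assume "y \<in> ?r `` {x}"
      then have "x - y \<in> ?L" by simp
      then have "(x - y) - z \<in> ?L" using z by (rule lattice_span_diff)
      then show "y \<in> ?r `` {x - z}" by (simp add: algebra_simps)
    next
      fix y assume "y \<in> ?r `` {x - z}"
      then have "x - z - y \<in> ?L" by simp
      then have "(x - z - y) - (0 - z) \<in> ?L" using z zero_lattice_span lattice_span_diff by blast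
      then show "y \<in> ?r `` {x}" by simp
    qed
    ultimately show ?thesis by blast
  qed
  then have "?N // ?r \<subseteq> (\<lambda>y. ?r `` {y}) ` ?F" unfolding quotient_def by blast
  then have "finite (?N // ?r)" using finite_bounded_integer_points finite_subset by blast
  moreover have "0 \<in> ?N" by (simp add: integer_points_def span_zero)
  then have "?N // ?r \<noteq> {}" unfolding quotient_def by blast
  ultimately show ?thesis unfolding face_index_def by (simp add: card_gt_0_iff)
qed

text \<open>Adding an integer multiple of one coordinate to another is unimodular; the opposite
  multiple inverts it.\<close>

lemma quotient_coords_shear:
  fixes V :: "(real ^ 'd::finite) set"
  assumes q: "quotient_coords V \<phi> J" and ab: "a \<in> J" "b \<in> J" "a \<noteq> b"
  shows "quotient_coords V (\<lambda>x. \<phi> x + (of_int t * \<phi> x $ b) *\<^sub>R axis a 1) J"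
proof -
  have lin: "linear \<phi>" and ker: "{x. \<phi> x = 0} = V"
    and img: "\<phi> ` integer_points = {z \<in> integer_points. \<forall>j. j \<notin> J \<longrightarrow> z $ j = 0}"
    using q by (auto simp: quotient_coords_def)
  define E :: "int \<Rightarrow> real ^ 'd \<Rightarrow> real ^ 'd" where "E t z = z + (of_int t * z $ b) *\<^sub>R axis a 1" for t z
  have inv: "E t (E (- t) z) = z" for t z
    using ab(3) by (simp add: E_def vec_eq_iff axis_def algebra_simps)
  have E0: "E t 0 = 0" for t by (simp add: E_def)
  have "linear (E t)"
    by (rule linearI) (simp_all add: E_def algebra_simps)
  then have "linear (\<lambda>x. E t (\<phi> x))" using lin linear_compose[of \<phi> "E t"] by (simp add: o_def)
  moreover have "E t (\<phi> x) = 0 \<longleftrightarrow> \<phi> x = 0" for x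
    using inv[of "- t" "\<phi> x"] E0 by (metis minus_minus)
  then have "{x. E t (\<phi> x) = 0} = V" using ker by simp
  moreover have pres: "E t z \<in> \<phi> ` integer_points" if "z \<in> \<phi> ` integer_points" for z t
    using that ab unfolding img by (auto simp: E_def integer_points_def axis_def)
  have "(\<lambda>x. E t (\<phi> x)) ` integer_points = \<phi> ` integer_points"
  proof (intro equalityI subsetI)
    fix z assume "z \<in> (\<lambda>x. E t (\<phi> x)) ` integer_points"
    then show "z \<in> \<phi> ` integer_points" using pres by blast
  next
    fix z assume "z \<in> \<phi> ` integer_points"
    then obtain x where "x \<in> integer_points" "E (- t) z = \<phi> x" using pres by blast
    then have "z = E t (\<phi> x)" using inv[of t z] by simp
    with \<open>x \<in> integer_points\<close> show "z \<in> (\<lambda>x. E t (\<phi> x)) ` integer_points" by blast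
  qed
  ultimately show ?thesis using img unfolding quotient_coords_def E_def by simp
qed

text \<open>Euclid's algorithm on the coordinates of the image of an integer vector \<open>w\<close>.\<close>

lemma quotient_coords_reduce:
  fixes V :: "(real ^ 'd::finite) set"
  assumes q: "quotient_coords V \<phi> J" and w: "w \<in> integer_points"
  shows "\<exists>\<phi>' j0. quotient_coords V \<phi>' J \<and> (\<forall>j. j \<noteq> j0 \<longrightarrow> \<phi>' w $ j = 0)"
proof -
  let ?P = "\<lambda>\<phi>. quotient_coords V \<phi> J"
  let ?m = "\<lambda>\<phi> :: real ^ 'd \<Rightarrow> real ^ 'd. nat \<lfloor>\<Sum>j\<in>UNIV. \<bar>\<phi> w $ j\<bar>\<rfloor>"
  \<comment> \<open>Coordinates in which the image of w has least l1-norm; two nonzero coordinates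
    would allow a further reduction.\<close>
  obtain \<psi> where \<psi>: "?P \<psi>" "\<And>\<phi>. ?P \<phi> \<Longrightarrow> ?m \<psi> \<le> ?m \<phi>"
    using ex_has_least_nat[of ?P \<phi> ?m] q by blast
  have int: "\<phi> w $ j \<in> \<int>" "\<phi> w $ j \<noteq> 0 \<Longrightarrow> j \<in> J" if "?P \<phi>" for \<phi> j
  proof -
    have "\<phi> w \<in> {z \<in> integer_points. \<forall>j. j \<notin> J \<longrightarrow> z $ j = 0}"
      using that w unfolding quotient_coords_def by blast
    then show "\<phi> w $ j \<in> \<int>" "\<phi> w $ j \<noteq> 0 \<Longrightarrow> j \<in> J" by (auto simp: integer_points_def)
  qed
  have no: False if a: "\<psi> w $ a \<noteq> 0" and b: "\<psi> w $ b \<noteq> 0" and "a \<noteq> b" and le: "\<bar>\<psi> w $ b\<bar> \<le> \<bar>\<psi> w $ a\<bar>" for a b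
  proof -
    \<comment> \<open>The sign that moves the larger coordinate towards zero.\<close>
    define t :: int where "t = (if \<psi> w $ a * \<psi> w $ b > 0 then - 1 else 1)"
    define \<phi>' where "\<phi>' = (\<lambda>x. \<psi> x + (of_int t * \<psi> x $ b) *\<^sub>R axis a 1)"
    have P': "?P \<phi>'"
      unfolding \<phi>'_def by (rule quotient_coords_shear[OF \<psi>(1) int(2)[OF \<psi>(1) a] int(2)[OF \<psi>(1) b] \<open>a \<noteq> b\<close>])
    have oth: "\<phi>' w $ j = \<psi> w $ j" if "j \<noteq> a" for j using that by (simp add: \<phi>'_def axis_def)
    have "\<phi>' w $ a = \<psi> w $ a + of_int t * \<psi> w $ b" by (simp add: \<phi>'_def axis_def)
    then have "\<bar>\<phi>' w $ a\<bar> = \<bar>\<psi> w $ a\<bar> - \<bar>\<psi> w $ b\<bar>"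
      using a b le by (auto simp: t_def zero_less_mult_iff abs_if split: if_splits)
    then have lt: "\<bar>\<phi>' w $ a\<bar> < \<bar>\<psi> w $ a\<bar>" using b by simp
    let ?S = "\<lambda>\<phi>. \<Sum>j\<in>UNIV. \<bar>\<phi> w $ j\<bar>"
    have "?S \<phi>' < ?S \<psi>"
    proof (rule sum_strict_mono_ex1)
      show "\<forall>j\<in>UNIV. \<bar>\<phi>' w $ j\<bar> \<le> \<bar>\<psi> w $ j\<bar>" using lt oth by (metis less_imp_le order_refl)
      show "\<exists>j\<in>UNIV. \<bar>\<phi>' w $ j\<bar> < \<bar>\<psi> w $ j\<bar>" using lt by blast
    qed simp
    moreover have "?S \<phi>' \<in> \<int>" using int(1)[OF P'] by (intro Ints_sum) (auto simp: Ints_abs)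
    then obtain x where x: "?S \<phi>' = of_int x" by (rule Ints_cases)
    have "?S \<psi> \<in> \<int>" using int(1)[OF \<psi>(1)] by (intro Ints_sum) (auto simp: Ints_abs)
    then obtain y where y: "?S \<psi> = of_int y" by (rule Ints_cases)
    have "?S \<phi>' \<ge> 0" by (simp add: sum_nonneg)
    then have "x \<ge> 0" unfolding x by simp
    moreover have "x < y" using calculation(1) unfolding x y by simp
    ultimately have "?m \<phi>' < ?m \<psi>" unfolding x y by simp
    with \<psi>(2)[OF P'] show False by simp
  qed
  show ?thesis
  proof (cases "\<exists>a. \<psi> w $ a \<noteq> 0")
    case True
    then obtain a where "\<psi> w $ a \<noteq> 0" by blast
    then have "\<forall>j. j \<noteq> a \<longrightarrow> \<psi> w $ j = 0" using no by (metis linorder_le_cases)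
    with \<psi>(1) show ?thesis by blast
  next
    case False
    with \<psi>(1) show ?thesis by blast
  qed
qed

text \<open>Once the image of w lies on a single axis, dividing by w means forgetting that
  coordinate; the projection maps integer points onto integer points, so the lattice of the quotient
  stays standard.\<close>

lemma quotient_coords_insert:
  fixes V :: "(real ^ 'd::finite) set"
  assumes q0: "quotient_coords V \<phi>0 J" and w: "w \<in> integer_points"
  shows "\<exists>\<phi> J. quotient_coords (span (insert w V)) \<phi> J"
proof -
  obtain \<phi> j0 where q: "quotient_coords V \<phi> J" and j0: "\<And>j. j \<noteq> j0 \<Longrightarrow> \<phi> w $ j = 0"
    using quotient_coords_reduce[OF assms] by blast
  have lin: "linear \<phi>" and ker: "V = {x. \<phi> x = 0}"
    and img: "\<phi> ` integer_points = {z \<in> integer_points. \<forall>j. j \<notin> J \<longrightarrow> z $ j = 0}"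
    using q by (auto simp: quotient_coords_def)
  have "subspace V" unfolding ker by (rule linear_subspace_kernel[OF lin])
  then have spV: "span V = V" by (simp add: span_eq_iff)
  show ?thesis
  proof (cases "\<phi> w = 0")
    case True
    then have "insert w V = V" using ker by auto
    then show ?thesis using q spV by metis
  next
    case False
    then have g: "\<phi> w $ j0 \<noteq> 0" using j0 by (metis vec_eq_iff zero_index)
    define P :: "real ^ 'd \<Rightarrow> real ^ 'd" where "P z = z - (z $ j0) *\<^sub>R axis j0 1" for z
    have P: "P z $ j = (if j = j0 then 0 else z $ j)" for z j by (simp add: P_def axis_def)
    have "linear P" by (rule linearI) (simp_all add: P_def algebra_simps)
    then have "linear (\<lambda>x. P (\<phi> x))" using lin linear_compose[of \<phi> P] by (simp add: o_def)
    moreover have "{x. P (\<phi> x) = 0} = span (insert w V)"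
    proof (intro equalityI subsetI)
      fix x assume "x \<in> {x. P (\<phi> x) = 0}"
      then have z: "P (\<phi> x) $ j = 0" for j by simp
      let ?k = "\<phi> x $ j0 / \<phi> w $ j0"
      have "\<phi> (x - ?k *\<^sub>R w) = 0"
        using z j0 g by (auto simp: linear_diff[OF lin] linear_cmul[OF lin] vec_eq_iff P split: if_splits)
          (metis eq_iff_diff_eq_0 mult_zero_right nonzero_eq_divide_eq times_divide_eq_left)
      then have "x - ?k *\<^sub>R w \<in> span V" unfolding ker by (intro span_base) simp
      then show "x \<in> span (insert w V)" unfolding span_breakdown_eq by blast
    next
      fix x assume "x \<in> span (insert w V)"
      then obtain k where "x - k *\<^sub>R w \<in> V" unfolding span_breakdown_eq spV by blast
      then have "\<phi> x = k *\<^sub>R \<phi> w" using ker by (simp add: linear_diff[OF lin] linear_cmul[OF lin])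
      then show "x \<in> {x. P (\<phi> x) = 0}" using j0 by (simp add: vec_eq_iff P)
    qed
    moreover have "(\<lambda>x. P (\<phi> x)) ` integer_points = {z \<in> integer_points. \<forall>j. j \<notin> J - {j0} \<longrightarrow> z $ j = 0}"
    proof (intro equalityI subsetI)
      fix z assume "z \<in> (\<lambda>x. P (\<phi> x)) ` integer_points"
      then obtain y where "y \<in> \<phi> ` integer_points" "z = P y" by blast
      then show "z \<in> {z \<in> integer_points. \<forall>j. j \<notin> J - {j0} \<longrightarrow> z $ j = 0}"
        unfolding img by (auto simp: P integer_points_def)
    next
      fix z assume z: "z \<in> {z \<in> integer_points. \<forall>j. j \<notin> J - {j0} \<longrightarrow> z $ j = 0}"
      then have "z \<in> \<phi> ` integer_points" unfolding img by auto
      moreover have "P z = z" using z by (simp add: vec_eq_iff P)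
      ultimately show "z \<in> (\<lambda>x. P (\<phi> x)) ` integer_points" by force
    qed
    ultimately have "quotient_coords (span (insert w V)) (\<lambda>x. P (\<phi> x)) (J - {j0})"
      by (simp add: quotient_coords_def)
    then show ?thesis by blast
  qed
qed

text \<open>Guarantees that the \<open>SOME\<close> in \<open>subdiagram_volume\<close> picks
  genuine coordinates on the quotient lattice.\<close>

lemma quotient_coords_exists:
  fixes W :: "(real ^ 'd::finite) set"
  assumes "finite W" "W \<subseteq> integer_points"
  shows "\<exists>\<phi> J. quotient_coords (span W) \<phi> J"
  using assms
proof (induction W rule: finite_induct)
  case empty
  have "quotient_coords (span {}) (\<lambda>x :: real ^ 'd. x) UNIV"
    by (simp add: quotient_coords_def linear_id[unfolded id_def])
  then show ?case by blast
next
  case (insert w W)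
  then obtain \<phi> J where "quotient_coords (span W) \<phi> J" by auto
  then have "\<exists>\<phi> J. quotient_coords (span (insert w (span W))) \<phi> J"
    using insert.prems by (intro quotient_coords_insert) auto
  moreover have "span (insert w (span W)) = span (insert w W)"
    by (simp add: set_eq_iff span_breakdown_eq[of _ w] span_span)
  ultimately show ?case by simp
qed

text \<open>\<open>measure\<close> is zero on nonmeasurable sets and on sets of infinite measure, so
  closedness and boundedness are what makes the box inside count.\<close>

lemma normalized_volume_pos:
  fixes X :: "(real ^ 'd::finite) set"
  assumes X: "closed X" "bounded X" "\<And>z j. z \<in> X \<Longrightarrow> j \<notin> J \<Longrightarrow> z $ j = 0"
    and \<epsilon>: "\<epsilon> > 0"
    and box: "\<And>f. f \<in> PiE J (\<lambda>j. {q j - \<epsilon>..q j + \<epsilon>}) \<Longrightarrow> (\<chi> j. if j \<in> J then f j else 0) \<in> X"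
  shows "normalized_volume J X > 0"
proof -
  let ?M = "Pi\<^sub>M J (\<lambda>_. lborel :: real measure)"
  let ?g = "\<lambda>f. (\<chi> j. if j \<in> J then f j else 0) :: real ^ 'd"
  let ?Y = "(\<lambda>x. restrict (\<lambda>j. x $ j) J) ` X"
  interpret product_sigma_finite "\<lambda>_ :: 'd. lborel :: real measure" by standard
  \<comment> \<open>The projection of X is the preimage of X under the inclusion of \<real>^J, hence
    measurable.\<close>
  have Y: "?Y = ?g -` X \<inter> space ?M"
  proof (intro equalityI subsetI)
    fix f assume "f \<in> ?Y"
    then obtain x where x: "x \<in> X" "f = restrict (\<lambda>j. x $ j) J" by blast
    then have gf: "?g f = x" using X(3) by (auto simp: vec_eq_iff)
    have "f \<in> space ?M" unfolding x(2) by (simp add: space_PiM)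
    then show "f \<in> ?g -` X \<inter> space ?M" using gf x(1) by blast
  next
    fix f assume f: "f \<in> ?g -` X \<inter> space ?M"
    then have "f = restrict (\<lambda>j. ?g f $ j) J"
      by (auto simp: space_PiM PiE_def extensional_def fun_eq_iff)
    with f show "f \<in> ?Y" by blast
  qed
  have "?g \<in> borel_measurable ?M"
  proof (subst borel_measurable_euclidean_space, intro ballI)
    fix b :: "real ^ 'd" assume "b \<in> Basis"
    then obtain k where k: "b = axis k 1" by (auto simp: Basis_vec_def)
    have "(\<lambda>f. ?g f \<bullet> b) = (\<lambda>f. if k \<in> J then f k else 0)"
      by (simp add: k inner_axis)
    moreover have "(\<lambda>f. if k \<in> J then f k else 0) \<in> borel_measurable ?M"
    proof (cases "k \<in> J")
      case True
      then show ?thesis using measurable_component_singleton[OF True, of "\<lambda>_. lborel :: real measure"] by simp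
    qed simp
    ultimately show "(\<lambda>f. ?g f \<bullet> b) \<in> borel_measurable ?M" by simp
  qed
  then have Ym: "?Y \<in> sets ?M" unfolding Y using X(1) by (intro measurable_sets[of _ _ borel]) auto
  obtain R where R: "\<And>z. z \<in> X \<Longrightarrow> norm z \<le> R" "R > 0" using X(2) bounded_pos by metis
  have "?Y \<subseteq> PiE J (\<lambda>_. {- R..R})"
  proof
    fix f assume "f \<in> ?Y"
    then obtain x where x: "x \<in> X" "f = restrict (\<lambda>j. x $ j) J" by blast
    have "\<bar>x $ j\<bar> \<le> R" for j using component_le_norm_cart[of x j] R(1)[OF x(1)] by simp
    then show "f \<in> PiE J (\<lambda>_. {- R..R})" unfolding x(2) by (auto simp: abs_le_iff minus_le_iff)
  qed
  then have "emeasure ?M ?Y \<le> emeasure ?M (PiE J (\<lambda>_. {- R..R}))"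
    by (intro emeasure_mono sets_PiM_I_finite) auto
  also have "\<dots> = (\<Prod>j\<in>J. ennreal (2 * R))"
    using R(2) by (subst emeasure_PiM) auto
  also have "\<dots> < top" using R(2) by (simp add: ennreal_power)
  finally have fin: "emeasure ?M ?Y < top" .
  have "PiE J (\<lambda>j. {q j - \<epsilon>..q j + \<epsilon>}) \<subseteq> ?Y"
    unfolding Y using box by (auto simp: space_PiM PiE_def)
  then have "emeasure ?M (PiE J (\<lambda>j. {q j - \<epsilon>..q j + \<epsilon>})) \<le> emeasure ?M ?Y"
    by (intro emeasure_mono Ym)
  moreover have "emeasure ?M (PiE J (\<lambda>j. {q j - \<epsilon>..q j + \<epsilon>})) = (\<Prod>j\<in>J. ennreal (2 * \<epsilon>))"
    using \<epsilon> by (subst emeasure_PiM) auto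
  moreover have "(\<Prod>j\<in>J. ennreal (2 * \<epsilon>)) > 0"
    using \<epsilon> by (simp add: ennreal_power)
  ultimately have "emeasure ?M ?Y > 0" by (simp add: less_le_trans)
  then have "measure ?M ?Y > 0" using fin by (simp add: measure_def enn2real_positive_iff)
  then show ?thesis by (simp add: normalized_volume_def)
qed

lemma integer_combination:
  fixes x :: "real ^ 'd::finite"
  assumes "surj (ray_map \<omega>)" "x \<in> integer_points"
  shows "\<exists>r :: 'n::finite \<Rightarrow> int. x = (\<Sum>i\<in>UNIV. of_int (r i) *\<^sub>R real_ray \<omega> i)"
proof -
  have "\<exists>z :: int. x $ j = of_int z" for j using assms(2) by (auto simp: integer_points_def elim: Ints_cases)
  then obtain z where z: "\<And>j. x $ j = of_int (z j)" by metis
  obtain c where c: "ray_map \<omega> c = (\<chi> j. z j)" using assms(1) by (metis surjD)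
  have "(\<Sum>i\<in>UNIV. c $ i * \<omega> i $ j) = z j" for j
    using arg_cong[OF c, of "\<lambda>v. v $ j"] by (simp add: ray_map_nth)
  then have "x $ j = of_int (\<Sum>i\<in>UNIV. c $ i * \<omega> i $ j)" for j using z by simp
  then show ?thesis by (intro exI[of _ "\<lambda>i. c $ i"]) (simp add: vec_eq_iff)
qed

text \<open>The difference of the hulls contains a box near the origin. A functional h that vanishes
  on \<Gamma> and is positive on the other rays has height at least \<delta> on the smaller hull,
  while small nonnegative combinations of the rays lie in the larger one below that height. The
  difference is bounded because there the coefficients of the rays outside \<Gamma> have sum less
  than 1.\<close>

lemma subdiagram_volume_pos:
  fixes \<omega> :: "'n::finite \<Rightarrow> int ^ 'd::finite"
  assumes w: "is_weights \<beta>" and qs: "quasi_symmetric \<beta>" and rays: "rays_of \<beta> \<omega>"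
    and \<Gamma>: "\<Gamma> \<in> faces \<omega>"
  shows "subdiagram_volume \<omega> \<Gamma> > 0"
proof -
  let ?v = "real_ray \<omega>"
  let ?I = "rays_in \<omega> \<Gamma>"
  let ?n = "real CARD('n)"
  have spG: "span \<Gamma> = span (?v ` ?I)" by (rule face_rays(2)[OF \<Gamma>])
  have vint: "?v i \<in> integer_points" for i by (simp add: integer_points_def)
  have "\<exists>\<phi> J. quotient_coords (span \<Gamma>) \<phi> J"
    unfolding spG using vint by (intro quotient_coords_exists) auto
  then obtain \<phi>J where \<phi>J: "(SOME (\<phi>, J). quotient_coords (span \<Gamma>) \<phi> J) = \<phi>J"
    "case \<phi>J of (\<phi>, J) \<Rightarrow> quotient_coords (span \<Gamma>) \<phi> J"
    using someI_ex[of "\<lambda>(\<phi>, J). quotient_coords (span \<Gamma>) \<phi> J"] by auto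
  obtain \<phi> J where pair: "\<phi>J = (\<phi>, J)" by (cases \<phi>J)
  have lin: "linear \<phi>" and ker: "\<And>x. \<phi> x = 0 \<longleftrightarrow> x \<in> span \<Gamma>"
    and img: "\<phi> ` integer_points = {z \<in> integer_points. \<forall>j. j \<notin> J \<longrightarrow> z $ j = 0}"
    using \<phi>J(2) unfolding pair quotient_coords_def by auto
  define S where "S = \<phi> ` ray_semigroup \<omega>"
  define X where "X = closure (convex hull S - convex hull (S - {0}))"
  have vol: "subdiagram_volume \<omega> \<Gamma> = normalized_volume J X"
    unfolding subdiagram_volume_def \<phi>J(1) pair X_def S_def by simp
  obtain h :: "real ^ 'd" where h0: "\<And>i. i \<in> ?I \<Longrightarrow> h \<bullet> ?v i = 0" and h1: "\<And>i. i \<notin> ?I \<Longrightarrow> h \<bullet> ?v i > 0"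
    using face_supporting_functional[OF w qs rays \<Gamma>] by metis
  have hge: "h \<bullet> ?v i \<ge> 0" for i using h0[of i] h1[of i] by (cases "i \<in> ?I") auto
  have hspan: "h \<bullet> x = 0" if "x \<in> span \<Gamma>" for x
  proof -
    have "span (?v ` ?I) \<subseteq> {x. h \<bullet> x = 0}"
      by (intro span_minimal subspace_hyperplane) (auto simp: h0)
    then show ?thesis using that spG by auto
  qed
  have \<phi>I: "\<phi> (?v i) = 0" if "i \<in> ?I" for i unfolding ker spG using that by (intro span_base) simp
  have \<phi>nI: "\<phi> (?v i) \<noteq> 0" if "i \<notin> ?I" for i using hspan h1[OF that] unfolding ker by force
  have \<phi>sum: "\<phi> (\<Sum>i\<in>A. c i *\<^sub>R ?v i) = (\<Sum>i\<in>A. c i *\<^sub>R \<phi> (?v i))" for A c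
    by (simp add: linear_sum[OF lin] linear_cmul[OF lin])
  have S_multiple: "real k *\<^sub>R \<phi> (?v i) \<in> S" for k i
  proof -
    have "real k *\<^sub>R ?v i = (\<Sum>j\<in>UNIV. of_nat (if j = i then k else 0) *\<^sub>R ?v j)"
      by (simp add: if_distrib[of "\<lambda>y. real y *\<^sub>R _"] cong: if_cong)
    then have "real k *\<^sub>R ?v i \<in> ray_semigroup \<omega>"
      unfolding ray_semigroup_def by (intro range_eqI[of _ _ "\<lambda>j. if j = i then k else 0"])
    then show ?thesis unfolding S_def linear_cmul[OF lin, symmetric] by (rule imageI)
  qed
  have S0: "0 \<in> S" using S_multiple[of 0] by simp
  have ray_in: "t *\<^sub>R \<phi> (?v i) \<in> convex hull S" if t: "t \<ge> 0" for t i
  proof -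
    obtain N where N: "t < real N" using reals_Archimedean2 by blast
    then have N0: "real N > 0" using t by linarith
    have "(t / real N) *\<^sub>R (real N *\<^sub>R \<phi> (?v i)) + (1 - t / real N) *\<^sub>R 0 \<in> convex hull S"
      using t N N0 by (intro convexD convex_convex_hull hull_inc S0 S_multiple) auto
    then show ?thesis using N0 by simp
  qed
  have cone_in: "\<phi> (\<Sum>i\<in>UNIV. c i *\<^sub>R ?v i) \<in> convex hull S" if c: "\<And>i. c i \<ge> 0" for c
  proof -
    have "(\<Sum>i\<in>UNIV. (1 / ?n) *\<^sub>R ((?n * c i) *\<^sub>R \<phi> (?v i))) \<in> convex hull S"
      using c by (intro convex_sum convex_convex_hull ray_in) auto
    then show ?thesis by (simp add: \<phi>sum)
  qed
  have ray_in': "t *\<^sub>R \<phi> (?v i) \<in> convex hull (S - {0})" if t: "t \<ge> 1" and i: "i \<notin> ?I" for t i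
  proof -
    obtain N where N: "t < real N" using reals_Archimedean2 by blast
    \<comment> \<open>The position of t between 1 and N, where both multiples of the image belong to
      S without 0.\<close>
    define s where "s = (t - 1) / (real N - 1)"
    have s: "0 \<le> s" "s \<le> 1" "s * (real N - 1) = t - 1" using t N by (auto simp: s_def)
    have "real 1 *\<^sub>R \<phi> (?v i) \<in> S - {0}" "real N *\<^sub>R \<phi> (?v i) \<in> S - {0}"
      using S_multiple[of 1 i] S_multiple[of N i] \<phi>nI[OF i] t N by auto
    then have "(1 - s) *\<^sub>R (real 1 *\<^sub>R \<phi> (?v i)) + s *\<^sub>R (real N *\<^sub>R \<phi> (?v i)) \<in> convex hull (S - {0})"
      using s by (intro convexD convex_convex_hull hull_inc) auto
    also have "(1 - s) *\<^sub>R (real 1 *\<^sub>R \<phi> (?v i)) + s *\<^sub>R (real N *\<^sub>R \<phi> (?v i)) = (1 + s * (real N - 1)) *\<^sub>R \<phi> (?v i)"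
      by (simp add: algebra_simps)
    finally show ?thesis by (simp add: s(3))
  qed
  have S_cone: "convex hull S \<subseteq> (\<lambda>c :: real ^ 'n. \<phi> (\<Sum>i\<in>UNIV. c $ i *\<^sub>R ?v i)) ` {c. \<forall>i. 0 \<le> c $ i}"
  proof (rule hull_minimal)
    show "S \<subseteq> (\<lambda>c :: real ^ 'n. \<phi> (\<Sum>i\<in>UNIV. c $ i *\<^sub>R ?v i)) ` {c. \<forall>i. 0 \<le> c $ i}"
    proof
      fix z assume "z \<in> S"
      then obtain k :: "'n \<Rightarrow> nat" where "z = \<phi> (\<Sum>i\<in>UNIV. of_nat (k i) *\<^sub>R ?v i)"
        unfolding S_def ray_semigroup_def by blast
      then show "z \<in> (\<lambda>c :: real ^ 'n. \<phi> (\<Sum>i\<in>UNIV. c $ i *\<^sub>R ?v i)) ` {c. \<forall>i. 0 \<le> c $ i}"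
        by (intro image_eqI[of _ _ "\<chi> i. of_nat (k i)"]) auto
    qed
    have "linear (\<lambda>c :: real ^ 'n. \<phi> (\<Sum>i\<in>UNIV. c $ i *\<^sub>R ?v i))"
      unfolding \<phi>sum by (rule linearI) (simp_all add: scaleR_add_left sum.distrib scaleR_sum_right)
    moreover have "convex {c :: real ^ 'n. \<forall>i. 0 \<le> c $ i}"
      by (auto simp: convex_def)
    ultimately show "convex ((\<lambda>c :: real ^ 'n. \<phi> (\<Sum>i\<in>UNIV. c $ i *\<^sub>R ?v i)) ` {c. \<forall>i. 0 \<le> c $ i})"
      by (rule convex_linear_image)
  qed
  define R where "R = (\<Sum>i\<in>- ?I. norm (\<phi> (?v i)))"
  have bounded: "convex hull S - convex hull (S - {0}) \<subseteq> cball 0 R"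
  proof
    fix z assume z: "z \<in> convex hull S - convex hull (S - {0})"
    then obtain c :: "real ^ 'n" where c: "\<And>i. 0 \<le> c $ i" "z = \<phi> (\<Sum>i\<in>UNIV. c $ i *\<^sub>R ?v i)"
      using S_cone by blast
    have zc: "z = (\<Sum>i\<in>- ?I. c $ i *\<^sub>R \<phi> (?v i))"
      unfolding c(2) \<phi>sum by (rule sum.mono_neutral_right) (auto simp: \<phi>I)
    let ?s = "\<Sum>i\<in>- ?I. c $ i"
    \<comment> \<open>With coefficient sum s \<ge> 1, z would be a convex combination of s-fold
      images of the rays outside \<Gamma>, which lie in the smaller hull.\<close>
    have "?s < 1"
    proof (rule ccontr)
      assume "\<not> ?s < 1"
      then have s: "?s \<ge> 1" by simp
      have "(\<Sum>i\<in>- ?I. (c $ i / ?s) *\<^sub>R (?s *\<^sub>R \<phi> (?v i))) \<in> convex hull (S - {0})"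
      proof (intro convex_sum convex_convex_hull ray_in' s)
        show "(\<Sum>i\<in>- ?I. c $ i / ?s) = 1" using s by (simp flip: sum_divide_distrib)
        show "0 \<le> c $ i / ?s" for i using c(1) s by simp
      qed auto
      then have "z \<in> convex hull (S - {0})" using s unfolding zc by simp
      then show False using z by blast
    qed
    then have c1: "c $ i \<le> 1" if "i \<in> - ?I" for i
      using member_le_sum[of i "- ?I" "\<lambda>i. c $ i"] c(1) that by force
    have "norm z \<le> (\<Sum>i\<in>- ?I. norm (c $ i *\<^sub>R \<phi> (?v i)))" unfolding zc by (rule norm_sum)
    also have "\<dots> \<le> R"
      unfolding R_def using c(1) c1 by (intro sum_mono) (simp add: mult_left_le_one_le)
    finally show "z \<in> cball 0 R" by simp
  qed
  have XR: "X \<subseteq> cball 0 R" unfolding X_def using bounded by (intro closure_minimal) auto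
  have sub: "subspace {z :: real ^ 'd. \<forall>j. j \<notin> J \<longrightarrow> z $ j = 0}" by (auto simp: subspace_def)
  have "ray_semigroup \<omega> \<subseteq> integer_points"
    unfolding ray_semigroup_def integer_points_def by (auto intro!: Ints_sum Ints_mult)
  then have "S \<subseteq> {z. \<forall>j. j \<notin> J \<longrightarrow> z $ j = 0}" using img unfolding S_def by blast
  then have "convex hull S \<subseteq> {z. \<forall>j. j \<notin> J \<longrightarrow> z $ j = 0}"
    by (intro hull_minimal subspace_imp_convex sub)
  then have XJ: "X \<subseteq> {z. \<forall>j. j \<notin> J \<longrightarrow> z $ j = 0}"
    unfolding X_def by (intro closure_minimal closed_subspace sub) blast
  obtain \<delta> where \<delta>: "\<delta> > 0" "\<And>i. i \<notin> ?I \<Longrightarrow> \<delta> \<le> h \<bullet> ?v i"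
  proof (cases "- ?I = {}")
    case True
    then show ?thesis using that[of 1] by auto
  next
    case False
    let ?d = "Min ((\<lambda>i. h \<bullet> ?v i) ` (- ?I))"
    have "?d > 0" using False h1 by (subst Min_gr_iff) auto
    moreover have "?d \<le> h \<bullet> ?v i" if "i \<notin> ?I" for i using that by (intro Min_le) auto
    ultimately show ?thesis using that by blast
  qed
  have upper: "convex hull (S - {0}) \<subseteq> \<phi> ` {x. h \<bullet> x \<ge> \<delta>}"
  proof (rule hull_minimal)
    show "convex (\<phi> ` {x. h \<bullet> x \<ge> \<delta>})"
      by (intro convex_linear_image lin convex_halfspace_ge)
    show "S - {0} \<subseteq> \<phi> ` {x. h \<bullet> x \<ge> \<delta>}"
    proof
      fix z assume z: "z \<in> S - {0}"
      then obtain k :: "'n \<Rightarrow> nat" where k: "z = \<phi> (\<Sum>i\<in>UNIV. of_nat (k i) *\<^sub>R ?v i)"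
        unfolding S_def ray_semigroup_def by blast
      have "\<exists>i. i \<notin> ?I \<and> k i \<noteq> 0"
      proof (rule ccontr)
        assume no: "\<not> ?thesis"
        have "(\<Sum>i\<in>UNIV. of_nat (k i) *\<^sub>R \<phi> (?v i)) = 0"
        proof (intro sum.neutral ballI)
          fix i show "of_nat (k i) *\<^sub>R \<phi> (?v i) = 0" using no \<phi>I[of i] by (cases "i \<in> ?I") auto
        qed
        then show False using z k by (simp add: \<phi>sum)
      qed
      then obtain i where i: "i \<notin> ?I" "k i \<noteq> 0" by blast
      have "\<delta> \<le> 1 * (h \<bullet> ?v i)" using \<delta>(2)[OF i(1)] by simp
      also have "\<dots> \<le> real (k i) * (h \<bullet> ?v i)" using i(2) hge by (intro mult_right_mono) auto
      also have "\<dots> \<le> (\<Sum>i\<in>UNIV. real (k i) * (h \<bullet> ?v i))"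
        using hge by (intro member_le_sum[of i UNIV "\<lambda>i. real (k i) * (h \<bullet> ?v i)"]) auto
      also have "\<dots> = h \<bullet> (\<Sum>i\<in>UNIV. of_nat (k i) *\<^sub>R ?v i)" by (simp add: inner_sum_right)
      finally show "z \<in> \<phi> ` {x. h \<bullet> x \<ge> \<delta>}" unfolding k by blast
    qed
  qed
  define H where "H = (\<Sum>i\<in>UNIV. h \<bullet> ?v i)"
  have H: "H \<ge> 0" unfolding H_def using hge by (intro sum_nonneg) auto
  \<comment> \<open>A combination of the rays with coefficients at most 2 \<eta> has height at most
    2 \<eta> H, which is below \<delta>.\<close>
  define \<eta> where "\<eta> = \<delta> / (2 * (H + 1))"
  have \<eta>: "\<eta> > 0" "2 * \<eta> * H < \<delta>"
    using \<delta>(1) H by (auto simp: \<eta>_def field_simps)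
  \<comment> \<open>The rays generate N, so each coordinate vector of the quotient is the image of
    an integer combination of them.\<close>
  have "\<exists>r :: 'n \<Rightarrow> int. axis j 1 = \<phi> (\<Sum>i\<in>UNIV. of_int (r i) *\<^sub>R ?v i)" if j: "j \<in> J" for j
  proof -
    have "axis j (1 :: real) \<in> \<phi> ` integer_points"
      unfolding img using j by (auto simp: integer_points_def axis_def)
    then obtain x where x: "x \<in> integer_points" "axis j 1 = \<phi> x" by blast
    have "surj (ray_map \<omega>)" using rays by (simp add: rays_of_def)
    then show ?thesis using integer_combination[OF _ x(1)] x(2) by metis
  qed
  then obtain r where r: "\<And>j. j \<in> J \<Longrightarrow> axis j 1 = \<phi> (\<Sum>i\<in>UNIV. of_int (r j i) *\<^sub>R ?v i)" by metis
  define K where "K = (\<Sum>j\<in>J. \<Sum>i\<in>UNIV. \<bar>real_of_int (r j i)\<bar>)"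
  have K: "K \<ge> 0" unfolding K_def by (intro sum_nonneg) auto
  \<comment> \<open>A displacement by at most \<epsilon> in each coordinate changes the coefficients
    by at most \<epsilon> K \<le> \<eta>, so they stay between 0 and 2 \<eta>.\<close>
  define \<epsilon> where "\<epsilon> = \<eta> / (K + 1)"
  have \<epsilon>: "\<epsilon> > 0" "\<epsilon> * K \<le> \<eta>" using \<eta>(1) K by (auto simp: \<epsilon>_def field_simps)
  define q where "q = \<phi> (\<Sum>i\<in>UNIV. \<eta> *\<^sub>R ?v i)"
  have qJ: "q $ j = 0" if "j \<notin> J" for j
  proof -
    have "\<phi> (?v i) $ j = 0" for i using that img vint by blast
    then show ?thesis by (simp add: q_def \<phi>sum)
  qed
  have "normalized_volume J X > 0"
  proof (rule normalized_volume_pos[of X J \<epsilon> "\<lambda>j. q $ j"])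
    show "closed X" by (simp add: X_def)
    show "bounded X" using XR bounded_cball bounded_subset by blast
    show "z $ j = 0" if "z \<in> X" "j \<notin> J" for z j using XJ that by blast
    show "\<epsilon> > 0" by (rule \<epsilon>)
    fix f assume f: "f \<in> PiE J (\<lambda>j. {q $ j - \<epsilon>..q $ j + \<epsilon>})"
    let ?z = "(\<chi> j. if j \<in> J then f j else 0) :: real ^ 'd"
    define c where "c i = \<eta> + (\<Sum>j\<in>J. (f j - q $ j) * of_int (r j i))" for i
    let ?x = "\<Sum>i\<in>UNIV. c i *\<^sub>R ?v i"
    have "?z = q + (\<Sum>j\<in>J. (f j - q $ j) *\<^sub>R axis j 1)"
      using qJ by (auto simp: vec_eq_iff axis_def if_distrib[of "\<lambda>y. _ * y"] cong: if_cong)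
    also have "(\<Sum>j\<in>J. (f j - q $ j) *\<^sub>R axis j 1) =
        (\<Sum>j\<in>J. \<Sum>i\<in>UNIV. ((f j - q $ j) * of_int (r j i)) *\<^sub>R \<phi> (?v i))"
      using r by (intro sum.cong refl) (simp add: \<phi>sum scaleR_sum_right)
    also have "\<dots> = (\<Sum>i\<in>UNIV. (\<Sum>j\<in>J. (f j - q $ j) * of_int (r j i)) *\<^sub>R \<phi> (?v i))"
      by (subst sum.swap) (simp add: scaleR_sum_left)
    also have "q + \<dots> = \<phi> ?x"
      unfolding \<phi>sum q_def[unfolded \<phi>sum] by (simp add: c_def q_def[unfolded \<phi>sum] scaleR_add_left sum.distrib)
    finally have z: "?z = \<phi> ?x" .
    have dev: "\<bar>\<Sum>j\<in>J. (f j - q $ j) * of_int (r j i)\<bar> \<le> \<eta>" for i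
    proof -
      have "\<bar>\<Sum>j\<in>J. (f j - q $ j) * of_int (r j i)\<bar> \<le> (\<Sum>j\<in>J. \<bar>(f j - q $ j) * of_int (r j i)\<bar>)"
        by (rule sum_abs)
      also have "\<dots> \<le> (\<Sum>j\<in>J. \<epsilon> * (\<Sum>i\<in>UNIV. \<bar>real_of_int (r j i)\<bar>))"
      proof (rule sum_mono)
        fix j assume "j \<in> J"
        then have "\<bar>f j - q $ j\<bar> \<le> \<epsilon>" using PiE_mem[OF f] by (force simp: abs_le_iff)
        moreover have "\<bar>real_of_int (r j i)\<bar> \<le> (\<Sum>i\<in>UNIV. \<bar>real_of_int (r j i)\<bar>)"
          by (rule member_le_sum) auto
        ultimately show "\<bar>(f j - q $ j) * of_int (r j i)\<bar> \<le> \<epsilon> * (\<Sum>i\<in>UNIV. \<bar>real_of_int (r j i)\<bar>)"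
          unfolding abs_mult using \<epsilon>(1) by (intro mult_mono) auto
      qed
      also have "\<dots> = \<epsilon> * K" by (simp add: K_def sum_distrib_left)
      finally show ?thesis using \<epsilon>(2) by simp
    qed
    have c: "0 \<le> c i" "c i \<le> 2 * \<eta>" for i using dev[of i] unfolding c_def by linarith+
    have "h \<bullet> ?x = (\<Sum>i\<in>UNIV. c i * (h \<bullet> ?v i))" by (simp add: inner_sum_right)
    also have "\<dots> \<le> (\<Sum>i\<in>UNIV. 2 * \<eta> * (h \<bullet> ?v i))"
      using c(2) hge by (intro sum_mono mult_right_mono) auto
    also have "\<dots> = 2 * \<eta> * H" by (simp add: H_def sum_distrib_left)
    finally have hx: "h \<bullet> ?x < \<delta>" using \<eta>(2) by simp
    have "\<phi> ?x \<notin> convex hull (S - {0})"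
    proof
      assume "\<phi> ?x \<in> convex hull (S - {0})"
      then obtain y where y: "\<phi> ?x = \<phi> y" "h \<bullet> y \<ge> \<delta>" using upper by blast
      \<comment> \<open>The kernel of \<open>\<phi>\<close> is \<open>span \<Gamma>\<close>, where h
        vanishes, so the height depends only on the image under \<open>\<phi>\<close>.\<close>
      then have "?x - y \<in> span \<Gamma>" using ker by (simp add: linear_diff[OF lin] flip: ker)
      then have "h \<bullet> ?x = h \<bullet> y" using hspan by (fastforce simp: inner_diff_right)
      then show False using hx y(2) by simp
    qed
    moreover have "\<phi> ?x \<in> convex hull S" by (rule cone_in[OF c(1)])
    ultimately have "\<phi> ?x \<in> convex hull S - convex hull (S - {0})" by (rule DiffI[rotated])
    then show "?z \<in> X" unfolding z X_def by (rule subsetD[OF closure_subset])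
  qed
  then show ?thesis using vol by simp
qed

lemma face_multiplicity_pos:
  fixes \<omega> :: "'n::finite \<Rightarrow> int ^ 'd::finite"
  assumes "is_weights \<beta>" "quasi_symmetric \<beta>" "rays_of \<beta> \<omega>" "\<Gamma> \<in> faces \<omega>"
  shows "face_multiplicity \<omega> \<Gamma> > 0"
  using face_index_pos[OF assms(4)] subdiagram_volume_pos[OF assms]
  by (simp add: face_multiplicity_def)

subsection \<open>The log-discriminant locus\<close>

text \<open>A factor with exponent 0 would be lost, and a product over infinitely many faces would
  be 1; positivity of the multiplicities and finiteness of the face set exclude both.\<close>

lemma log_discriminant_locus_eq_faces:
  fixes \<omega> :: "'n::finite \<Rightarrow> int ^ 'd::finite"
  assumes "is_weights \<beta>" "quasi_symmetric \<beta>" "rays_of \<beta> \<omega>"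
  shows "log_discriminant_locus \<beta> \<omega> = (\<Union>\<Gamma>\<in>faces \<omega>. log_face_discriminant \<beta> \<omega> \<Gamma>)"
proof -
  have "polytope (ray_polytope \<omega>)" unfolding ray_polytope_def by (intro polytope_convex_hull) simp
  then have fin: "finite (faces \<omega>)"
    unfolding faces_def by (rule finite_subset[OF _ finite_polytope_faces, rotated]) auto
  have "poly_eval (principal_determinant \<omega>) a = 0 \<longleftrightarrow>
      (\<exists>\<Gamma>\<in>faces \<omega>. poly_eval (discriminant \<omega> (rays_in \<omega> \<Gamma>)) a = 0)" for a
    using fin face_multiplicity_pos[OF assms]
    by (auto simp: principal_determinant_def poly_eval_prod poly_eval_power)
  then show ?thesis
    unfolding log_discriminant_locus_def log_face_discriminant_def log_locus_def quotient_locus_def by blast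
qed

lemma log_locus_empty: "(\<And>a. a \<in> torus \<Longrightarrow> poly_eval p a \<noteq> 0) \<Longrightarrow> log_locus \<beta> p = {}"
  by (auto simp: log_locus_def quotient_locus_def)

lemma torus_quotient_eq: "torus_quotient \<beta> a l = laurent_monomial a (dual_weight_map \<beta> l)"
  by (simp add: torus_quotient_def laurent_monomial_def dual_weight_map_def)

text \<open>Surjectivity of Q tensored with \<complex>. The functional y is expanded in the
  coordinates of L, which are additive and integer valued, hence integer combinations of the
  weights.\<close>

lemma complex_dual_combination:
  fixes \<beta> :: "'n::finite \<Rightarrow> 'l::ab_group_add \<Rightarrow> int"
  assumes lat: "lattice_of_rank TYPE('l) k" and surj: "weight_map_surjective \<beta>" and y: "y \<in> complex_dual"
  shows "\<exists>c. \<forall>l. y l = (\<Sum>i\<in>UNIV. c i * of_int (\<beta> i l))"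
proof -
  obtain \<phi> :: "'l \<Rightarrow> nat \<Rightarrow> int" where \<phi>: "\<And>x y i. \<phi> (x + y) i = \<phi> x i + \<phi> y i"
    "bij_betw \<phi> UNIV {c. \<forall>i\<ge>k. c i = 0}"
    using lat unfolding lattice_of_rank_def by blast
  have inj: "\<phi> x = \<phi> x' \<Longrightarrow> x = x'" for x x' using \<phi>(2) by (auto simp: bij_betw_def inj_on_def)
  have add: "y (a + b) = y a + y b" for a b using y by (simp add: complex_dual_def Modules.additive_def)
  interpret y: Modules.additive y using y by (simp add: complex_dual_def)
  have "\<exists>b. \<phi> b = (\<lambda>j. if j = i then 1 else 0)" if "i < k" for i
  proof -
    have "(\<lambda>j. if j = i then 1 else 0) \<in> {c. \<forall>i\<ge>k. c i = (0 :: int)}" using that by auto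
    then show ?thesis using \<phi>(2) unfolding bij_betw_def by (metis imageE)
  qed
  then obtain b where b: "\<And>i. i < k \<Longrightarrow> \<phi> (b i) = (\<lambda>j. if j = i then 1 else 0)" by metis
  have \<phi>0: "\<phi> 0 i = 0" for i using \<phi>(1)[of 0 0 i] by simp
  have \<phi>m: "\<phi> (- x) i = - \<phi> x i" for x i using \<phi>(1)[of x "- x" i] \<phi>0[of i] by simp
  \<comment> \<open>Integer multiples of x, built by induction inside the group L and respected by
    \<open>\<phi>\<close> and \<open>y\<close>.\<close>
  have cyc: "\<exists>x'. (\<forall>i. \<phi> x' i = n * \<phi> x i) \<and> y x' = of_int n * y x" for n :: int and x
  proof (induction n rule: int_induct[of _ 0])
    case base
    show ?case by (intro exI[of _ 0]) (simp add: \<phi>0 y.zero)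
  next
    case (step1 n)
    then obtain x' where "\<forall>i. \<phi> x' i = n * \<phi> x i" "y x' = of_int n * y x" by blast
    then show ?case by (intro exI[of _ "x' + x"]) (simp add: \<phi>(1) add algebra_simps)
  next
    case (step2 n)
    then obtain x' where "\<forall>i. \<phi> x' i = n * \<phi> x i" "y x' = of_int n * y x" by blast
    then show ?case by (intro exI[of _ "x' + - x"]) (simp only: \<phi>(1) \<phi>m add y.minus, simp add: algebra_simps)
  qed
  \<comment> \<open>Truncations of x to its first m coordinates, assembled from multiples of the
    basis vectors \<open>b i\<close>.\<close>
  have part: "\<exists>x'. (\<forall>i. \<phi> x' i = (if i < m then \<phi> x i else 0)) \<and> y x' = (\<Sum>i<m. of_int (\<phi> x i) * y (b i))"
    if "m \<le> k" for m x
    using that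
  proof (induction m)
    case 0
    show ?case by (intro exI[of _ 0]) (simp add: \<phi>0 y.zero)
  next
    case (Suc m)
    then obtain x' where x': "\<forall>i. \<phi> x' i = (if i < m then \<phi> x i else 0)" "y x' = (\<Sum>i<m. of_int (\<phi> x i) * y (b i))"
      by auto
    obtain x'' where x'': "\<forall>i. \<phi> x'' i = \<phi> x m * \<phi> (b m) i" "y x'' = of_int (\<phi> x m) * y (b m)"
      using cyc by blast
    have "\<phi> (b m) i = (if i = m then 1 else 0)" for i using b[of m] Suc.prems by simp
    then have "\<forall>i. \<phi> (x' + x'') i = (if i < Suc m then \<phi> x i else 0)"
      using x'(1) x''(1) by (auto simp: \<phi>(1) less_Suc_eq)
    moreover have "y (x' + x'') = (\<Sum>i<Suc m. of_int (\<phi> x i) * y (b i))"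
      using x'(2) x''(2) by (simp add: add)
    ultimately show ?case by blast
  qed
  have ysum: "y x = (\<Sum>i<k. of_int (\<phi> x i) * y (b i))" for x
  proof -
    obtain x' where x': "\<forall>i. \<phi> x' i = (if i < k then \<phi> x i else 0)" "y x' = (\<Sum>i<k. of_int (\<phi> x i) * y (b i))"
      using part[of k x] by auto
    have "\<phi> x \<in> {c. \<forall>i\<ge>k. c i = 0}" using \<phi>(2) unfolding bij_betw_def by blast
    then have "\<phi> x' = \<phi> x" using x'(1) by (auto simp: fun_eq_iff)
    then show ?thesis using inj x'(2) by metis
  qed
  have "\<exists>c. weight_map \<beta> c = (\<lambda>x. \<phi> x i)" for i
  proof -
    have "(\<lambda>x. \<phi> x i) \<in> {b. Modules.additive b}" using \<phi>(1) by (simp add: Modules.additive_def)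
    then show ?thesis using surj unfolding weight_map_surjective_def by (metis imageE)
  qed
  then obtain c where c: "\<And>i. weight_map \<beta> (c i) = (\<lambda>x. \<phi> x i)" by metis
  have "y l = (\<Sum>i\<in>UNIV. (\<Sum>j<k. of_int (c j $ i) * y (b j)) * of_int (\<beta> i l))" for l
  proof -
    have "\<phi> l j = (\<Sum>i\<in>UNIV. c j $ i * \<beta> i l)" for j
      using fun_cong[OF c[of j], of l] by (simp add: weight_map_def)
    then have "y l = (\<Sum>j<k. \<Sum>i\<in>UNIV. of_int (c j $ i) * of_int (\<beta> i l) * y (b j))"
      by (subst ysum) (simp add: sum_distrib_right)
    also have "\<dots> = (\<Sum>i\<in>UNIV. \<Sum>j<k. of_int (c j $ i) * of_int (\<beta> i l) * y (b j))" by (rule sum.swap)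
    finally show ?thesis by (simp add: sum_distrib_right sum_distrib_left mult_ac)
  qed
  then show ?thesis by (intro exI[of _ "\<lambda>i. \<Sum>j<k. of_int (c j $ i) * y (b j)"]) blast
qed

text \<open>Exponentiating the coefficients of y with respect to the weights gives a preimage under
  the quotient map.\<close>

lemma universal_cover_in_torus_quotient:
  fixes \<beta> :: "'n::finite \<Rightarrow> 'l::ab_group_add \<Rightarrow> int"
  assumes "lattice_of_rank TYPE('l) k" "weight_map_surjective \<beta>" "y \<in> complex_dual"
  shows "\<exists>a\<in>torus. universal_cover y = torus_quotient \<beta> a"
proof -
  obtain c where c: "\<And>l. y l = (\<Sum>i\<in>UNIV. c i * of_int (\<beta> i l))"
    using complex_dual_combination[OF assms] by blast
  let ?a = "(\<chi> i. exp (2 * of_real pi * \<i> * c i)) :: complex ^ 'n"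
  have "universal_cover y l = torus_quotient \<beta> ?a l" for l
  proof -
    have "exp (2 * of_real pi * \<i> * y l) = (\<Prod>i\<in>UNIV. exp (of_int (\<beta> i l) * (2 * of_real pi * \<i> * c i)))"
      by (simp add: c sum_distrib_left exp_sum mult_ac)
    then show ?thesis
      by (simp add: universal_cover_def torus_quotient_def exp_power_int mult.commute)
  qed
  moreover have "?a \<in> torus" by (simp add: torus_def)
  ultimately show ?thesis by blast
qed

text \<open>The relation u comes from some l in L, so a^u is the value at l of the image of a in the
  quotient torus. The equation a^u = c then says that y(l) is one of the logarithms of c, divided by
  2 pi i.\<close>

lemma log_face_discriminant_hyperplanes:
  fixes \<beta> :: "'n::finite \<Rightarrow> 'l::ab_group_add \<Rightarrow> int" and \<omega> :: "'n \<Rightarrow> int ^ 'd::finite"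
  assumes lat: "lattice_of_rank TYPE('l) k" and w: "is_weights \<beta>" and surj: "weight_map_surjective \<beta>"
    and rays: "rays_of \<beta> \<omega>" and qs: "quasi_symmetric \<beta>" and circ: "circuit_face \<omega> \<Gamma>"
  shows "union_of_hyperplanes (log_face_discriminant \<beta> \<omega> \<Gamma>)"
proof -
  let ?D = "discriminant \<omega> (rays_in \<omega> \<Gamma>)"
  have "dim (linear_relations \<omega> (rays_in \<omega> \<Gamma>)) = 1" using circ by (simp add: circuit_face_def)
  from discriminant_circuit[OF w qs rays this] show ?thesis
  proof (elim disjE exE conjE)
    assume "\<forall>a\<in>torus. poly_eval ?D a \<noteq> 0"
    then have "log_face_discriminant \<beta> \<omega> \<Gamma> = {}"
      unfolding log_face_discriminant_def by (intro log_locus_empty) auto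
    then show ?thesis unfolding union_of_hyperplanes_def by (intro exI[of _ "{}"]) simp
  next
    fix u c assume u: "ray_map \<omega> u = 0" "u \<noteq> 0"
      and D: "\<forall>a\<in>torus. poly_eval ?D a = 0 \<longleftrightarrow> laurent_monomial a u = c"
    obtain l where l: "u = dual_weight_map \<beta> l" using u(1) rays unfolding rays_of_def by blast
    let ?H = "\<lambda>t. {y \<in> complex_dual. y l = t}"
    let ?T = "{t :: complex. exp (2 * of_real pi * \<i> * t) = c}"
    \<comment> \<open>As u is nonzero, evaluation at l is a nonzero functional.\<close>
    obtain i where i: "\<beta> i l \<noteq> 0" using u(2) by (auto simp: l vec_eq_iff dual_weight_map_def)
    have "complex_affine_hyperplane (?H t)" for t
    proof -
      have "complex_linear_functional (\<lambda>y. y l)" by (simp add: complex_linear_functional_def)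
      moreover have "(\<lambda>x. of_int (\<beta> i x)) \<in> complex_dual"
        using w by (simp add: complex_dual_def is_weights_def Modules.additive_def)
      then have "\<exists>y\<in>complex_dual. y l \<noteq> (0 :: complex)" using i by (intro bexI[of _ "\<lambda>x. of_int (\<beta> i x)"]) auto
      ultimately show ?thesis unfolding complex_affine_hyperplane_def by blast
    qed
    moreover have "log_face_discriminant \<beta> \<omega> \<Gamma> = \<Union>(?H ` ?T)"
    proof (intro equalityI subsetI)
      fix y assume "y \<in> log_face_discriminant \<beta> \<omega> \<Gamma>"
      then obtain a where a: "y \<in> complex_dual" "a \<in> torus" "poly_eval ?D a = 0" "universal_cover y = torus_quotient \<beta> a"
        unfolding log_face_discriminant_def log_locus_def quotient_locus_def by blast
      then have "universal_cover y l = c" using D by (simp add: torus_quotient_eq l)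
      then show "y \<in> \<Union>(?H ` ?T)" using a(1) by (simp add: universal_cover_def)
    next
      fix y assume "y \<in> \<Union>(?H ` ?T)"
      then have y: "y \<in> complex_dual" "universal_cover y l = c" by (auto simp: universal_cover_def)
      \<comment> \<open>Any preimage serves, since the equation depends only on the point of the
        quotient torus.\<close>
      obtain a where a: "a \<in> torus" "universal_cover y = torus_quotient \<beta> a"
        using universal_cover_in_torus_quotient[OF lat surj y(1)] by blast
      have "laurent_monomial a u = c" using y(2) by (simp add: a(2) torus_quotient_eq l)
      then have "poly_eval ?D a = 0" using D a(1) by blast
      then show "y \<in> log_face_discriminant \<beta> \<omega> \<Gamma>"
        using a y(1) unfolding log_face_discriminant_def log_locus_def quotient_locus_def by auto
    qed
    ultimately show ?thesis
      unfolding union_of_hyperplanes_def by (intro exI[of _ "?H ` ?T"] conjI ballI) auto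
  qed
qed

text \<open>Taking all hyperplanes contained in the union avoids choosing a family for each
  member.\<close>

lemma union_of_hyperplanes_UN:
  assumes "\<And>x. x \<in> A \<Longrightarrow> union_of_hyperplanes (F x)"
  shows "union_of_hyperplanes (\<Union>x\<in>A. F x)"
proof -
  let ?\<H> = "{H. complex_affine_hyperplane H \<and> H \<subseteq> (\<Union>x\<in>A. F x)}"
  have "(\<Union>x\<in>A. F x) \<subseteq> \<Union>?\<H>"
  proof
    fix y assume "y \<in> (\<Union>x\<in>A. F x)"
    then obtain x where x: "x \<in> A" "y \<in> F x" by blast
    obtain \<H> where "\<forall>H\<in>\<H>. complex_affine_hyperplane H" "F x = \<Union>\<H>"
      using assms[OF x(1)] by (auto simp: union_of_hyperplanes_def)
    with x show "y \<in> \<Union>?\<H>" by blast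
  qed
  then have "(\<Union>x\<in>A. F x) = \<Union>?\<H>" by blast
  then show ?thesis
    unfolding union_of_hyperplanes_def by (intro exI[of _ "?\<H>"] conjI ballI) auto
qed

theorem theorem3p4:
  fixes \<beta> :: "'n::finite \<Rightarrow> 'l::ab_group_add \<Rightarrow> int"
    and \<omega> :: "'n \<Rightarrow> int ^ 'd::finite"
    and k :: nat
  assumes "lattice_of_rank TYPE('l) k"
    and "is_weights \<beta>"
    and "weight_map_surjective \<beta>"
    and "rays_of \<beta> \<omega>"
    and "inj \<omega>"
    and "quasi_symmetric \<beta>"
  shows "union_of_hyperplanes (log_discriminant_locus \<beta> \<omega>)
    \<and> (\<forall>\<Gamma>. circuit_face \<omega> \<Gamma> \<longrightarrow> union_of_hyperplanes (log_face_discriminant \<beta> \<omega> \<Gamma>))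
    \<and> log_discriminant_locus \<beta> \<omega> =
        (\<Union>\<Gamma>\<in>{\<Gamma>. circuit_face \<omega> \<Gamma>}. log_face_discriminant \<beta> \<omega> \<Gamma>)"
proof -
  have empty: "log_face_discriminant \<beta> \<omega> \<Gamma> = {}" if "\<Gamma> \<in> faces \<omega>" "\<not> circuit_face \<omega> \<Gamma>" for \<Gamma>
    unfolding log_face_discriminant_def
    using that face_rays(1)[OF that(1)]
    by (intro log_locus_empty discriminant_not_circuit[OF assms(2,6,4)]) (auto simp: circuit_face_def)
  have "\<Gamma> \<in> faces \<omega>" if "circuit_face \<omega> \<Gamma>" for \<Gamma> using that by (simp add: circuit_face_def)
  then have eq: "log_discriminant_locus \<beta> \<omega> = (\<Union>\<Gamma>\<in>{\<Gamma>. circuit_face \<omega> \<Gamma>}. log_face_discriminant \<beta> \<omega> \<Gamma>)"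
    unfolding log_discriminant_locus_eq_faces[OF assms(2,6,4)] using empty by blast
  have hyp: "union_of_hyperplanes (log_face_discriminant \<beta> \<omega> \<Gamma>)" if "circuit_face \<omega> \<Gamma>" for \<Gamma>
    by (rule log_face_discriminant_hyperplanes[OF assms(1-4,6) that])
  then have "union_of_hyperplanes (log_discriminant_locus \<beta> \<omega>)"
    unfolding eq by (intro union_of_hyperplanes_UN) auto
  then show ?thesis using hyp eq by blast
qed

end
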